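(* Let $(W,S)$ be a Coxeter system and let $w\in\mathrm{CFC}(W)$ be an element with no large bands. Then $w$ is logarithmic if and only if $w$ is torsion-free.
   Context: $(W,S)$ is a Coxeter system of finite rank: $W=\langle S\mid (st)^{m(s,t)}=1\rangle$, where $m(s,t)=m(t,s)\in\{1,2,\dots,\infty\}$, $m(s,t)=1$ iff $s=t$, and $m(s,t)=\infty$ means no relation. The Coxeter graph $\Gamma$ has vertex set $S$ and an edge $\{s,t\}$ labeled $m(s,t)$ whenever $m(s,t)\ge 3$. $S^*$ is the free monoid on $S$; a word representing $w$ is an expression for $w$, and it is reduced if it has minimal length $\ell(w)$. The support $\mathrm{supp}(w)$ is the set of generators occurring in any reduced expression of $w$. "Subword" means consecutive subword. $\langle s,t\rangle_m=stst\cdots\in S^*$ ($m$ letters, starting with $s$). $w$ is logarithmic if $\ell(w^k)=k\cdot\ell(w)$ for all $k\ge1$. $w$ is torsion-free if every connected component of the subgraph $\Gamma_{\mathrm{supp}(w)}$ of $\Gamma$ induced by $\mathrm{supp}(w)$ describes an infinite Coxeter group. Two words are commutation equivalent if they differ by a sequence of moves $st\leftrightarrow ts$ with $m(s,t)=2$. An element is fully commutative (FC) if all its reduced expressions are commutation equivalent. A cyclic shift of a word is any word obtained by repeatedly moving the first letter to the end. $w$ is cyclically fully commutative, $w\in\mathrm{CFC}(W)$, if every cyclic shift of every reduced expression for $w$ is a reduced expression for an FC element. An endpoint of a Coxeter graph is a vertex $s$ of degree $1$; its weight is $m(s,t)$ for the unique $t$ adjacent to it, and it is odd if this weight is a (finite)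 odd number. Bands: let $w\in\mathrm{CFC}(W)$ and let $(W',S')$ be the Coxeter system generated by $S'=\mathrm{supp}(w)$. For distinct $s,t\in S'$, exactly one of which is an odd endpoint of $(W',S')$, $w$ has an $st$-band if for some reduced expression $\mathsf{w}$ of $w$: (1) some cyclic shift of $\mathsf{w}$ is commutation equivalent to a reduced expression containing $\langle s,t\rangle_{m(s,t)-1}$ as a subword; and (2) neither $s$ nor $t$ appears elsewhere in $\mathsf{w}$. An $st$-band is small if $m(s,t)=3$ and large otherwise. $w$ has no large bands if it has no large $st$-band for any ordered pair $(s,t)$. *)

theory Defs
  imports "HOL-Algebra.Coset" "HOL-Library.Extended_Nat"
begin

section \<open>Group presentations\<close>

text \<open>Words of the free group on \<open>X\<close> are lists of signed letters: \<open>(x, True)\<close> stands for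
  \<open>x\<close> and \<open>(x, False)\<close> for its formal inverse.\<close>

inductive_set presentation_rel ::
    "'a set \<Rightarrow> ('a \<times> bool) list set \<Rightarrow> (('a \<times> bool) list \<times> ('a \<times> bool) list) set"
  for X :: "'a set" and R :: "('a \<times> bool) list set" where
  refl: "u \<in> lists (X \<times> UNIV) \<Longrightarrow> (u, u) \<in> presentation_rel X R"
| sym: "(u, v) \<in> presentation_rel X R \<Longrightarrow> (v, u) \<in> presentation_rel X R"
| trans: "(u, v) \<in> presentation_rel X R \<Longrightarrow> (v, w) \<in> presentation_rel X R
    \<Longrightarrow> (u, w) \<in> presentation_rel X R"
| cancel: "u \<in> lists (X \<times> UNIV) \<Longrightarrow> v \<in> lists (X \<times> UNIV) \<Longrightarrow> x \<in> X
    \<Longrightarrow> (u @ [(x, b), (x, \<not> b)] @ v, u @ v) \<in> presentation_rel X R"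
| relator: "u \<in> lists (X \<times> UNIV) \<Longrightarrow> v \<in> lists (X \<times> UNIV)
    \<Longrightarrow> r \<in> R \<Longrightarrow> r \<in> lists (X \<times> UNIV)
    \<Longrightarrow> (u @ r @ v, u @ v) \<in> presentation_rel X R"

definition presented_group ::
    "'a set \<Rightarrow> ('a \<times> bool) list set \<Rightarrow> ('a \<times> bool) list set monoid" where
  "presented_group X R =
    \<lparr>carrier = lists (X \<times> UNIV) // presentation_rel X R,
     mult = (\<lambda>A B. \<Union>u\<in>A. \<Union>v\<in>B. presentation_rel X R `` {u @ v}),
     one = presentation_rel X R `` {[]}\<rparr>"

lemma presentation_rel_lists:
  "(u, v) \<in> presentation_rel X R \<Longrightarrow> u \<in> lists (X \<times> UNIV) \<and> v \<in> lists (X \<times> UNIV)"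
  by (induction rule: presentation_rel.induct) auto

lemma equiv_presentation_rel: "equiv (lists (X \<times> UNIV)) (presentation_rel X R)"
proof (rule equivI)
  show "presentation_rel X R \<subseteq> lists (X \<times> UNIV) \<times> lists (X \<times> UNIV)"
    using presentation_rel_lists by fast
  show "refl_on (lists (X \<times> UNIV)) (presentation_rel X R)"
    by (rule refl_onI) (rule presentation_rel.refl)
  show "sym (presentation_rel X R)"
    by (rule symI) (rule presentation_rel.sym)
  show "trans (presentation_rel X R)"
    by (rule transI) (rule presentation_rel.trans)
qed

lemma presentation_rel_context:
  assumes "(u, v) \<in> presentation_rel X R"
    and "a \<in> lists (X \<times> UNIV)" "b \<in> lists (X \<times> UNIV)"
  shows "(a @ u @ b, a @ v @ b) \<in> presentation_rel X R"
  using assms(1)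
proof (induction rule: presentation_rel.induct)
  case (refl u)
  then show ?case using assms by (intro presentation_rel.refl) auto
next
  case (sym u v)
  show ?case by (rule presentation_rel.sym) (rule sym.IH)
next
  case (trans u v w)
  show ?case by (rule presentation_rel.trans[OF trans.IH])
next
  case (cancel u v x c)
  then show ?case
    using assms presentation_rel.cancel[of "a @ u" X "v @ b" x c R] by simp
next
  case (relator u v r)
  then show ?case
    using assms presentation_rel.relator[of "a @ u" X "v @ b" r R] by simp
qed

lemma presentation_rel_append:
  assumes "(u, u') \<in> presentation_rel X R" "(v, v') \<in> presentation_rel X R"
  shows "(u @ v, u' @ v') \<in> presentation_rel X R"
proof (rule presentation_rel.trans)
  show "(u @ v, u' @ v) \<in> presentation_rel X R"
    using presentation_rel_context[OF assms(1), of "[]" v] presentation_rel_lists[OF assms(2)]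
    by simp
  show "(u' @ v, u' @ v') \<in> presentation_rel X R"
    using presentation_rel_context[OF assms(2), of u' "[]"] presentation_rel_lists[OF assms(1)]
    by simp
qed

lemma presented_group_mult:
  assumes "u \<in> lists (X \<times> UNIV)" "v \<in> lists (X \<times> UNIV)"
  shows "presentation_rel X R `` {u} \<otimes>\<^bsub>presented_group X R\<^esub> presentation_rel X R `` {v}
    = presentation_rel X R `` {u @ v}"
proof -
  let ?r = "presentation_rel X R"
  have "congruent2 ?r ?r (\<lambda>u v. ?r `` {u @ v})"
  proof (rule congruent2I')
    fix u u' v v' assume "(u, u') \<in> ?r" "(v, v') \<in> ?r"
    then show "?r `` {u @ v} = ?r `` {u' @ v'}"
      by (intro equiv_class_eq[OF equiv_presentation_rel] presentation_rel_append)
  qed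
  from UN_equiv_class2[OF equiv_presentation_rel equiv_presentation_rel this assms]
  show ?thesis by (simp add: presented_group_def)
qed

lemma presentation_rel_inverse:
  assumes "u \<in> lists (X \<times> UNIV)"
  shows "(rev (map (apsnd Not) u) @ u, []) \<in> presentation_rel X R"
  using assms
proof (induction u rule: list.induct)
  case Nil
  then show ?case by (auto intro: presentation_rel.refl)
next
  case (Cons p u)
  obtain x b where p: "p = (x, b)" by force
  have u: "u \<in> lists (X \<times> UNIV)" "x \<in> X"
    using Cons.prems by (auto simp: p)
  then have v: "rev (map (apsnd Not) u) \<in> lists (X \<times> UNIV)"
    by (auto simp: in_lists_conv_set)
  have "(rev (map (apsnd Not) u) @ [(x, \<not> b), (x, \<not> \<not> b)] @ u,
      rev (map (apsnd Not) u) @ u) \<in> presentation_rel X R"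
    by (rule presentation_rel.cancel) (use u v in auto)
  from presentation_rel.trans[OF this Cons.IH[OF u(1)]] show ?case
    by (simp add: p)
qed

lemma presented_group_is_group: "group (presented_group X R)"
proof -
  let ?r = "presentation_rel X R" and ?G = "presented_group X R" and ?L = "lists (X \<times> UNIV)"
  have car: "carrier ?G = ?L // ?r" and one: "\<one>\<^bsub>?G\<^esub> = ?r `` {[]}"
    by (simp_all add: presented_group_def)
  have cl: "\<exists>u. u \<in> ?L \<and> A = ?r `` {u}" if "A \<in> carrier ?G" for A
    using that by (auto simp: car quotient_def)
  have in_car: "?r `` {u} \<in> carrier ?G" if "u \<in> ?L" for u
    using that by (auto simp: car quotient_def)
  note mult = presented_group_mult[of _ X _ R]
  show ?thesis
  proof (rule groupI)
    fix A B assume "A \<in> carrier ?G" "B \<in> carrier ?G"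
    then obtain u v where uv: "u \<in> ?L" "A = ?r `` {u}" "v \<in> ?L" "B = ?r `` {v}"
      using cl by metis
    then show "A \<otimes>\<^bsub>?G\<^esub> B \<in> carrier ?G"
      using in_car[of "u @ v"] mult[of u v] by auto
  next
    show "\<one>\<^bsub>?G\<^esub> \<in> carrier ?G" using in_car[of "[]"] by (simp add: one)
  next
    fix A B C assume "A \<in> carrier ?G" "B \<in> carrier ?G" "C \<in> carrier ?G"
    then obtain u v w where "u \<in> ?L" "A = ?r `` {u}" "v \<in> ?L" "B = ?r `` {v}"
        "w \<in> ?L" "C = ?r `` {w}"
      using cl by metis
    then show "A \<otimes>\<^bsub>?G\<^esub> B \<otimes>\<^bsub>?G\<^esub> C = A \<otimes>\<^bsub>?G\<^esub> (B \<otimes>\<^bsub>?G\<^esub> C)"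
      using mult[of u v] mult[of "u @ v" w] mult[of v w] mult[of u "v @ w"] by simp
  next
    fix A assume "A \<in> carrier ?G"
    then obtain u where u: "u \<in> ?L" "A = ?r `` {u}" using cl by metis
    then show "\<one>\<^bsub>?G\<^esub> \<otimes>\<^bsub>?G\<^esub> A = A" using mult[of "[]" u] by (simp add: one)
    let ?v = "rev (map (apsnd Not) u)"
    have v: "?v \<in> ?L" using u(1) by (auto simp: in_lists_conv_set)
    have "?r `` {?v @ u} = ?r `` {[]}"
      using equiv_class_eq[OF equiv_presentation_rel presentation_rel_inverse[OF u(1)]] .
    then show "\<exists>B\<in>carrier ?G. B \<otimes>\<^bsub>?G\<^esub> A = \<one>\<^bsub>?G\<^esub>"
      using in_car[OF v] mult[OF v u(1)] u(2) one by auto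
  qed
qed


section \<open>Coxeter systems\<close>

definition coxeter_matrix :: "'a set \<Rightarrow> ('a \<Rightarrow> 'a \<Rightarrow> enat) \<Rightarrow> bool" where
  "coxeter_matrix S m \<longleftrightarrow>
    (\<forall>s\<in>S. \<forall>t\<in>S. m s t = m t s \<and> 1 \<le> m s t \<and> (m s t = 1 \<longleftrightarrow> s = t))"

text \<open>A pair with \<open>m s t = \<infinity>\<close> contributes no relator.\<close>

definition coxeter_relators :: "'a set \<Rightarrow> ('a \<Rightarrow> 'a \<Rightarrow> enat) \<Rightarrow> ('a \<times> bool) list set" where
  "coxeter_relators S m =
    {concat (replicate k [(s, True), (t, True)]) | s t k. s \<in> S \<and> t \<in> S \<and> m s t = enat k}"

definition coxeter_group :: "'a set \<Rightarrow> ('a \<Rightarrow> 'a \<Rightarrow> enat) \<Rightarrow> ('a \<times> bool) list set monoid" where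
  "coxeter_group S m = presented_group S (coxeter_relators S m)"

definition coxeter_generator ::
    "'a set \<Rightarrow> ('a \<Rightarrow> 'a \<Rightarrow> enat) \<Rightarrow> 'a \<Rightarrow> ('a \<times> bool) list set" where
  "coxeter_generator S m s = presentation_rel S (coxeter_relators S m) `` {[(s, True)]}"

locale coxeter_system = group W for W (structure) +
  fixes S :: "'a set" and m :: "'a \<Rightarrow> 'a \<Rightarrow> enat"
  assumes finite_rank: "finite S"
    and generators_carrier: "S \<subseteq> carrier W"
    and matrix: "coxeter_matrix S m"
    and presentation:
      "\<exists>\<phi> \<in> iso (coxeter_group S m) W. \<forall>s\<in>S. \<phi> (coxeter_generator S m s) = s"


section \<open>Expressions, length and support\<close>

definition word_prod :: "('a, 'b) monoid_scheme \<Rightarrow> 'a list \<Rightarrow> 'a" where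
  "word_prod W u = foldr (\<otimes>\<^bsub>W\<^esub>) u \<one>\<^bsub>W\<^esub>"

definition expressions :: "('a, 'b) monoid_scheme \<Rightarrow> 'a set \<Rightarrow> 'a \<Rightarrow> 'a list set" where
  "expressions W S w = {u \<in> lists S. word_prod W u = w}"

definition cox_length :: "('a, 'b) monoid_scheme \<Rightarrow> 'a set \<Rightarrow> 'a \<Rightarrow> nat" where
  "cox_length W S w = (LEAST n. \<exists>u \<in> expressions W S w. length u = n)"

definition reduced_expressions :: "('a, 'b) monoid_scheme \<Rightarrow> 'a set \<Rightarrow> 'a \<Rightarrow> 'a list set" where
  "reduced_expressions W S w = {u \<in> expressions W S w. length u = cox_length W S w}"

definition reduced_word :: "('a, 'b) monoid_scheme \<Rightarrow> 'a set \<Rightarrow> 'a list \<Rightarrow> bool" where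
  "reduced_word W S u \<longleftrightarrow> u \<in> reduced_expressions W S (word_prod W u)"

text \<open>All reduced expressions of an element of a Coxeter group use the same generators, so the
  union below is the letter set of any one of them.\<close>

definition cox_supp :: "('a, 'b) monoid_scheme \<Rightarrow> 'a set \<Rightarrow> 'a \<Rightarrow> 'a set" where
  "cox_supp W S w = (\<Union>u \<in> reduced_expressions W S w. set u)"

definition logarithmic :: "('a, 'b) monoid_scheme \<Rightarrow> 'a set \<Rightarrow> 'a \<Rightarrow> bool" where
  "logarithmic W S w \<longleftrightarrow>
    (\<forall>k::nat. k \<ge> 1 \<longrightarrow> cox_length W S (w [^]\<^bsub>W\<^esub> k) = k * cox_length W S w)"


section \<open>The Coxeter graph\<close>

definition cox_edges :: "'a set \<Rightarrow> ('a \<Rightarrow> 'a \<Rightarrow> enat) \<Rightarrow> ('a \<times> 'a) set" where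
  "cox_edges I m = {(s, t). s \<in> I \<and> t \<in> I \<and> 3 \<le> m s t}"

definition cox_components :: "'a set \<Rightarrow> ('a \<Rightarrow> 'a \<Rightarrow> enat) \<Rightarrow> 'a set set" where
  "cox_components I m = I // (cox_edges I m)\<^sup>*"

definition torsion_free :: "('a, 'b) monoid_scheme \<Rightarrow> 'a set \<Rightarrow> ('a \<Rightarrow> 'a \<Rightarrow> enat) \<Rightarrow> 'a \<Rightarrow> bool" where
  "torsion_free W S m w \<longleftrightarrow>
    (\<forall>C \<in> cox_components (cox_supp W S w) m. infinite (carrier (coxeter_group C m)))"

definition cox_neighbours :: "'a set \<Rightarrow> ('a \<Rightarrow> 'a \<Rightarrow> enat) \<Rightarrow> 'a \<Rightarrow> 'a set" where
  "cox_neighbours I m s = cox_edges I m `` {s}"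

definition endpoint :: "'a set \<Rightarrow> ('a \<Rightarrow> 'a \<Rightarrow> enat) \<Rightarrow> 'a \<Rightarrow> bool" where
  "endpoint I m s \<longleftrightarrow> s \<in> I \<and> card (cox_neighbours I m s) = 1"

definition endpoint_weight :: "'a set \<Rightarrow> ('a \<Rightarrow> 'a \<Rightarrow> enat) \<Rightarrow> 'a \<Rightarrow> enat" where
  "endpoint_weight I m s = m s (the_elem (cox_neighbours I m s))"

definition odd_endpoint :: "'a set \<Rightarrow> ('a \<Rightarrow> 'a \<Rightarrow> enat) \<Rightarrow> 'a \<Rightarrow> bool" where
  "odd_endpoint I m s \<longleftrightarrow> endpoint I m s \<and> (\<exists>k. endpoint_weight I m s = enat k \<and> odd k)"


section \<open>Cyclically fully commutative elements and bands\<close>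

definition commutation_move :: "('a \<Rightarrow> 'a \<Rightarrow> enat) \<Rightarrow> 'a list \<Rightarrow> 'a list \<Rightarrow> bool" where
  "commutation_move m u v \<longleftrightarrow>
    (\<exists>a b s t. u = a @ [s, t] @ b \<and> v = a @ [t, s] @ b \<and> m s t = 2)"

definition commutation_equivalent :: "('a \<Rightarrow> 'a \<Rightarrow> enat) \<Rightarrow> 'a list \<Rightarrow> 'a list \<Rightarrow> bool" where
  "commutation_equivalent m = (commutation_move m)\<^sup>*\<^sup>*"

definition fully_commutative ::
    "('a, 'b) monoid_scheme \<Rightarrow> 'a set \<Rightarrow> ('a \<Rightarrow> 'a \<Rightarrow> enat) \<Rightarrow> 'a \<Rightarrow> bool" where
  "fully_commutative W S m w \<longleftrightarrow>
    (\<forall>u \<in> reduced_expressions W S w. \<forall>v \<in> reduced_expressions W S w.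
      commutation_equivalent m u v)"

definition cyclic_shift :: "'a list \<Rightarrow> 'a list \<Rightarrow> bool" where
  "cyclic_shift u v \<longleftrightarrow> (\<exists>n. v = rotate n u)"

definition CFC :: "('a, 'b) monoid_scheme \<Rightarrow> 'a set \<Rightarrow> ('a \<Rightarrow> 'a \<Rightarrow> enat) \<Rightarrow> 'a set" where
  "CFC W S m = {w \<in> carrier W. \<forall>u \<in> reduced_expressions W S w. \<forall>v. cyclic_shift u v \<longrightarrow>
    reduced_word W S v \<and> fully_commutative W S m (word_prod W v)}"

fun alternating :: "'a \<Rightarrow> 'a \<Rightarrow> nat \<Rightarrow> 'a list" where
  "alternating s t 0 = []"
| "alternating s t (Suc n) = s # alternating t s n"

text \<open>If \<open>m s t = \<infinity>\<close> there is no band. Cyclic shifts and commutations only permute letters, so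
  ``neither \<open>s\<close> nor \<open>t\<close> appears elsewhere in the expression'' says that the expression \<open>u\<close> has
  as many letters \<open>s\<close>, and as many letters \<open>t\<close>, as the alternating subword. Since \<open>t\<close> lies in
  the support, this rules out commuting \<open>s\<close> and \<open>t\<close>.\<close>

definition has_band ::
    "('a, 'b) monoid_scheme \<Rightarrow> 'a set \<Rightarrow> ('a \<Rightarrow> 'a \<Rightarrow> enat) \<Rightarrow> 'a \<Rightarrow> 'a \<Rightarrow> 'a \<Rightarrow> bool" where
  "has_band W S m w s t \<longleftrightarrow>
    s \<in> cox_supp W S w \<and> t \<in> cox_supp W S w \<and> s \<noteq> t \<and>
    (odd_endpoint (cox_supp W S w) m s \<noteq> odd_endpoint (cox_supp W S w) m t) \<and>
    (\<exists>k u. m s t = enat k \<and> u \<in> reduced_expressions W S w \<and>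
      (\<exists>v a b. cyclic_shift u v \<and>
        commutation_equivalent m v (a @ alternating s t (k - 1) @ b) \<and>
        reduced_word W S (a @ alternating s t (k - 1) @ b)) \<and>
      (\<forall>x \<in> {s, t}. count_list u x = count_list (alternating s t (k - 1)) x))"

definition has_large_band ::
    "('a, 'b) monoid_scheme \<Rightarrow> 'a set \<Rightarrow> ('a \<Rightarrow> 'a \<Rightarrow> enat) \<Rightarrow> 'a \<Rightarrow> 'a \<Rightarrow> 'a \<Rightarrow> bool" where
  "has_large_band W S m w s t \<longleftrightarrow> has_band W S m w s t \<and> m s t \<noteq> 3"

definition no_large_bands ::
    "('a, 'b) monoid_scheme \<Rightarrow> 'a set \<Rightarrow> ('a \<Rightarrow> 'a \<Rightarrow> enat) \<Rightarrow> 'a \<Rightarrow> bool" where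
  "no_large_bands W S m w \<longleftrightarrow> (\<forall>s t. \<not> has_large_band W S m w s t)"

end

theory Submission
  imports Defs Complex_Main "HOL-Library.Multiset" "HOL-Algebra.Multiplicative_Group"
begin

text \<open>If a component of the support generates a finite group, the corresponding factor of \<open>w\<close> has
  finite order and some power of \<open>w\<close> is too short. Conversely, a word is reduced as soon as all the
  roots met along it in the reflection representation are nonnegative, so the components of the
  support can be treated separately. Let \<open>u\<close> be the part of a reduced expression in one component.

  If no letter of \<open>u\<close> repeats, \<open>u\<close> is a Coxeter element of an infinite irreducible group and
  Speyer's argument applies: if some power of \<open>u\<close> were not reduced, a skew-symmetric form would
  force every positive root through some vertex to be an inversion of one fixed word, but
  infinitely many positive roots pass through each vertex. Otherwise some letter repeats. Then
  full commutativity of the cyclic shifts and the absence of large bands leave, in the periodic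
  word \<open>uuu...\<close>, only the braids \<open>sts\<close> of small bands. Deleting their odd endpoints one at a time
  preserves the situation and ends in a periodic word without braids, all of whose prefixes are
  reduced; and putting a letter back keeps a word reduced if a neighbour occurs between any two
  consecutive occurrences of it.\<close>

section \<open>The reflection representation on words\<close>

text \<open>The obstacle is that full commutativity of the cyclic shifts controls only windows of
  one period \<open>u\<close>, whereas a braid in \<open>uuu...\<close> may be longer than a period.
  Suppose an alternating chain in \<open>x\<close>, \<open>y\<close> is. Between two consecutive
  occurrences of \<open>x\<close> on it, every letter except the \<open>y\<close> of the chain
  commutes with \<open>x\<close>; as the chain covers a whole period, \<open>y\<close> is the only
  neighbour of \<open>x\<close>. The \<open>x\<close> one period after the start lies on the chain
  too, say after \<open>2k\<close> letters. If the chain went on, the same argument for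
  \<open>y\<close> would make the component dihedral of finite order. So the chain has exactly
  \<open>2k + 1 = m x y\<close> letters, and one period holds \<open>2k\<close> of them and no other
  \<open>x\<close> or \<open>y\<close>. This is precisely a band: hence the odd endpoints and the
  number \<open>m x y - 1\<close>. Without large bands, \<open>k = 1\<close>.\<close>

locale coxeter_data =
  fixes S :: "'a set" and m :: "'a \<Rightarrow> 'a \<Rightarrow> enat"
  assumes finite_S: "finite S" and coxeter_matrix: "coxeter_matrix S m"
begin

lemma m_sym: "s \<in> S \<Longrightarrow> t \<in> S \<Longrightarrow> m s t = m t s"
  using coxeter_matrix by (auto simp: coxeter_matrix_def)

lemma m_eq_1_iff: "s \<in> S \<Longrightarrow> t \<in> S \<Longrightarrow> m s t = 1 \<longleftrightarrow> s = t"
  using coxeter_matrix by (auto simp: coxeter_matrix_def)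

lemma m_ge_1: "s \<in> S \<Longrightarrow> t \<in> S \<Longrightarrow> 1 \<le> m s t"
  using coxeter_matrix by (auto simp: coxeter_matrix_def)

lemma m_ge_2: "s \<in> S \<Longrightarrow> t \<in> S \<Longrightarrow> s \<noteq> t \<Longrightarrow> m s t = enat k \<Longrightarrow> 2 \<le> k"
  using m_ge_1[of s t] m_eq_1_iff[of s t]
  by (cases "k = 0 \<or> k = 1") (auto simp: one_enat_def zero_enat_def)

lemma m_neq_2_iff: "s \<in> S \<Longrightarrow> t \<in> S \<Longrightarrow> s \<noteq> t \<Longrightarrow> m s t \<noteq> 2 \<longleftrightarrow> 3 \<le> m s t"
  using m_ge_2[of s t] by (cases "m s t") (auto simp: numeral_eq_enat)

text \<open>This is -2 B(s, t) for the canonical bilinear form B(s, t) = -cos(pi / m(s, t)), with B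
  = -1 on edges labelled infinity.\<close>

definition bond :: "'a \<Rightarrow> 'a \<Rightarrow> real" where
  "bond s t = (case m s t of enat k \<Rightarrow> 2 * cos (pi / real k) | \<infinity> \<Rightarrow> 2)"

lemma bond_sym: "s \<in> S \<Longrightarrow> t \<in> S \<Longrightarrow> bond s t = bond t s"
  by (simp add: bond_def m_sym)

lemma bond_eq_0: "m s t = 2 \<Longrightarrow> bond s t = 0"
  by (simp add: bond_def numeral_eq_enat)

text \<open>The bound 1 = 2 cos(pi/3) makes the product of the two bonds across an edge at least 1,
  just enough to offset the -1 of a reflected simple root in \<open>redw_insert\<close>.\<close>

lemma bond_ge_1:
  assumes "3 \<le> m s t"
  shows "1 \<le> bond s t"
proof (cases "m s t")
  case (enat k)
  then have k: "3 \<le> k" using assms by (simp add: numeral_eq_enat)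
  have "cos (pi / 3) \<le> cos (pi / real k)"
    by (rule cos_monotone_0_pi_le) (use k in \<open>auto simp: field_simps\<close>)
  then show ?thesis using enat by (simp add: bond_def cos_60)
qed (simp add: bond_def)

lemma bond_nonneg: "s \<in> S \<Longrightarrow> t \<in> S \<Longrightarrow> s \<noteq> t \<Longrightarrow> 0 \<le> bond s t"
  using bond_eq_0[of s t] bond_ge_1[of s t] m_neq_2_iff[of s t] by fastforce


section \<open>The geometric representation in coordinates\<close>

definition nbsum :: "'a \<Rightarrow> ('a \<Rightarrow> real) \<Rightarrow> real" where
  "nbsum s x = (\<Sum>t\<in>S - {s}. bond s t * x t)"

text \<open>A function is the coordinate vector of a linear combination of simple roots. In x - 2
  B(x, alpha_s) alpha_s only the coordinate at \<open>s\<close> changes, to x s - 2 (x s - nbsum s x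
  / 2).\<close>

definition reflect :: "'a \<Rightarrow> ('a \<Rightarrow> real) \<Rightarrow> ('a \<Rightarrow> real)" where
  "reflect s x = x(s := nbsum s x - x s)"

fun act :: "'a list \<Rightarrow> ('a \<Rightarrow> real) \<Rightarrow> ('a \<Rightarrow> real)" where
  "act [] x = x"
| "act (s # v) x = reflect s (act v x)"

definition sroot :: "'a \<Rightarrow> 'a \<Rightarrow> real" where
  "sroot s t = (if t = s then 1 else 0)"

definition nonneg :: "('a \<Rightarrow> real) \<Rightarrow> bool" where
  "nonneg x \<longleftrightarrow> (\<forall>t. 0 \<le> x t)"

definition nonpos :: "('a \<Rightarrow> real) \<Rightarrow> bool" where
  "nonpos x \<longleftrightarrow> (\<forall>t. x t \<le> 0)"

text \<open>The roots \<open>act A (sroot e)\<close> are the inversions met along the word. The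
  condition mentions neither a group nor an alphabet; \<open>minw_iff_redw\<close> identifies it
  with minimality of length.\<close>

definition redw :: "'a list \<Rightarrow> bool" where
  "redw v \<longleftrightarrow> (\<forall>A e B. v = A @ e # B \<longrightarrow> nonneg (act A (sroot e)))"

lemma act_append [simp]: "act (u @ v) x = act u (act v x)"
  by (induction u) auto

lemma nbsum_linear: "nbsum s (\<lambda>t. c * x t + d * y t) = c * nbsum s x + d * nbsum s y"
  by (simp add: nbsum_def algebra_simps sum.distrib sum_distrib_left)

lemma reflect_linear:
  "reflect s (\<lambda>t. c * x t + d * y t) = (\<lambda>t. c * reflect s x t + d * reflect s y t)"
  by (auto simp: reflect_def nbsum_linear algebra_simps)

lemma act_linear:
  "act v (\<lambda>t. c * x t + d * y t) = (\<lambda>t. c * act v x t + d * act v y t)"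
  by (induction v) (auto simp: reflect_linear)

lemma act_scale: "act v (\<lambda>t. c * x t) = (\<lambda>t. c * act v x t)"
  using act_linear[of v c x 0 x] by simp

lemma act_uminus: "act v (\<lambda>t. - x t) = (\<lambda>t. - act v x t)"
  using act_scale[of v "-1" x] by simp

lemma nbsum_upd: "nbsum s (x(s := c)) = nbsum s x"
  by (auto simp: nbsum_def intro!: sum.cong)

lemma reflect_reflect [simp]: "reflect s (reflect s x) = x"
  by (auto simp: reflect_def nbsum_upd)

lemma act_rev_act [simp]: "act (rev v) (act v x) = x"
  by (induction v) auto

lemma act_act_rev [simp]: "act v (act (rev v) x) = x"
  using act_rev_act[of "rev v"] by simp

lemma nbsum_sroot: "nbsum s (sroot s) = 0"
  by (auto simp: nbsum_def sroot_def)

lemma reflect_sroot: "reflect s (sroot s) = (\<lambda>t. - sroot s t)"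
  by (auto simp: reflect_def nbsum_sroot sroot_def)

lemma act_snoc_sroot: "act (v @ [e]) (sroot e) = (\<lambda>t. - act v (sroot e) t)"
  by (simp add: reflect_sroot act_uminus)

lemma nonneg_sroot: "nonneg (sroot s)"
  by (simp add: nonneg_def sroot_def)

lemma act_zero: "act v (\<lambda>_. 0) = (\<lambda>_. 0)"
  using act_scale[of v 0 "\<lambda>_. 0"] by simp

lemma act_sroot_nonzero: "act v (sroot s) \<noteq> (\<lambda>_. 0)"
proof
  assume "act v (sroot s) = (\<lambda>_. 0)"
  then have "sroot s = (\<lambda>_. 0)" by (metis act_rev_act act_zero)
  then show False by (auto simp: sroot_def fun_eq_iff split: if_splits)
qed

lemma nonneg_nonpos: "nonneg x \<Longrightarrow> nonpos x \<Longrightarrow> x = (\<lambda>_. 0)"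
  by (auto simp: nonneg_def nonpos_def fun_eq_iff intro: antisym)

lemma nonneg_uminus: "nonneg (\<lambda>t. - x t) \<longleftrightarrow> nonpos x"
  by (auto simp: nonneg_def nonpos_def)

lemma nonpos_uminus: "nonpos (\<lambda>t. - x t) \<longleftrightarrow> nonneg x"
  by (auto simp: nonneg_def nonpos_def)

lemma redw_append: "redw (u @ v) \<Longrightarrow> redw u"
  by (auto simp: redw_def)

lemma redw_snoc: "redw (v @ [e]) \<longleftrightarrow> redw v \<and> nonneg (act v (sroot e))"
  unfolding redw_def
proof (intro iffI conjI allI impI)
  fix A d B assume *: "(\<forall>A d B. v = A @ d # B \<longrightarrow> nonneg (act A (sroot d))) \<and> nonneg (act v (sroot e))"
    "v @ [e] = A @ d # B"
  show "nonneg (act A (sroot d))"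
    using * by (cases B rule: rev_cases) auto
qed auto

lemma nbsum_pair:
  assumes "s \<in> S" "t \<in> S" "s \<noteq> t"
  shows "nbsum s (\<lambda>r. c * sroot s r + d * sroot t r) = bond s t * d"
proof -
  have "nbsum s (\<lambda>r. c * sroot s r + d * sroot t r) =
      (\<Sum>r\<in>S - {s}. if r = t then bond s t * d else 0)"
    unfolding nbsum_def by (rule sum.cong) (auto simp: sroot_def)
  also have "\<dots> = bond s t * d" using assms finite_S by simp
  finally show ?thesis .
qed

section \<open>Braid relations as rotations\<close>

lemma sin_recurrence: "sin ((r + 2) * \<theta>) = 2 * cos \<theta> * sin ((r + 1) * \<theta>) - sin (r * \<theta>)" for r \<theta> :: real
proof -
  have "sin ((r + 2) * \<theta>) = sin ((r + 1) * \<theta> + \<theta>)" "sin (r * \<theta>) = sin ((r + 1) * \<theta> - \<theta>)"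
    by (simp_all add: algebra_simps)
  then show ?thesis by (simp only: sin_add sin_diff) (simp add: algebra_simps)
qed

lemma sin_pos_of_m:
  assumes "2 \<le> k" shows "0 < sin (pi / real k)"
  by (rule sin_gt_zero) (use assms in \<open>auto simp: field_simps\<close>)

text \<open>The affine plane of vectors agreeing with \<open>x\<close> off \<open>{s, t}\<close> contains a common fixed point
  \<open>(p, q)\<close> of the two reflections; around it their product is a rotation by \<open>2\<pi>/k\<close>.\<close>

lemma act_braid:
  assumes s: "s \<in> S" and t: "t \<in> S" and "s \<noteq> t" and mst: "m s t = enat k"
  shows "act (concat (replicate k [s, t])) x = x"
proof -
  define \<theta> where "\<theta> = pi / real k"
  have k: "2 \<le> k" using m_ge_2 assms by blast
  have sin: "0 < sin \<theta>" unfolding \<theta>_def using k by (rule sin_pos_of_m)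
  have b: "bond s t = 2 * cos \<theta>" "bond t s = 2 * cos \<theta>"
    using mst m_sym[OF s t] by (auto simp: bond_def \<theta>_def)
  define R where "R r = (\<Sum>i\<in>S - {s, t}. bond r i * x i)" for r
  have fin: "finite (S - {s, t})" using finite_S by simp
  have nbs: "nbsum s (x(s := X, t := Y)) = 2 * cos \<theta> * Y + R s" for X Y
  proof -
    have *: "S - {s} = insert t (S - {s, t})" using t \<open>s \<noteq> t\<close> by auto
    show ?thesis unfolding nbsum_def * using fin
      by (subst sum.insert) (auto simp: b R_def intro!: sum.cong)
  qed
  have nbt: "nbsum t (x(s := X, t := Y)) = 2 * cos \<theta> * X + R t" for X Y
  proof -
    have *: "S - {t} = insert s (S - {s, t})" using s \<open>s \<noteq> t\<close> by auto
    show ?thesis unfolding nbsum_def * using fin \<open>s \<noteq> t\<close>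
      by (subst sum.insert) (auto simp: b R_def intro!: sum.cong)
  qed
  \<comment> \<open>\<open>2 * D\<close> is the determinant of the linear system for the fixed point
    \<open>(p, q)\<close>.\<close>
  define D where "D = 2 - 2 * (cos \<theta>)\<^sup>2"
  have "D = 2 * (sin \<theta>)\<^sup>2" by (simp add: D_def sin_squared_eq)
  then have D: "D \<noteq> 0" using sin by simp
  define p where "p = (cos \<theta> * R t + R s) / D"
  define q where "q = (cos \<theta> * R s + R t) / D"
  have pD: "p * D = cos \<theta> * R t + R s" and qD: "q * D = cos \<theta> * R s + R t"
    using D by (simp_all add: p_def q_def)
  have "(2 * p - 2 * cos \<theta> * q - R s) * D = 2 * (p * D) - 2 * cos \<theta> * (q * D) - R s * D"
    "(2 * q - 2 * cos \<theta> * p - R t) * D = 2 * (q * D) - 2 * cos \<theta> * (p * D) - R t * D"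
    by (simp_all add: left_diff_distrib mult.assoc)
  then have "(2 * p - 2 * cos \<theta> * q - R s) * D = 0" "(2 * q - 2 * cos \<theta> * p - R t) * D = 0"
    unfolding pD qD by (simp_all add: D_def power2_eq_square algebra_simps)
  then have pq: "2 * p = 2 * cos \<theta> * q + R s" "2 * q = 2 * cos \<theta> * p + R t"
    using D by auto
  \<comment> \<open>Reflecting alternately in \<open>t\<close> and \<open>s\<close>, each new offset
    from \<open>(p, q)\<close> is 2 cos \<theta> times the previous one minus the one before that.
    \<open>g\<close> solves this recurrence with initial offsets \<open>g (- 1) = x t - q\<close>
    and \<open>g 0 = x s - p\<close>; even arguments belong to \<open>s\<close>, odd ones to
    \<open>t\<close>.\<close>
  define g where "g r = ((x s - p) * sin ((r + 1) * \<theta>) - (x t - q) * sin (r * \<theta>)) / sin \<theta>" for r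
  have grec: "g (r + 2) = 2 * cos \<theta> * g (r + 1) - g r" for r
  proof -
    have "g (r + 2) - (2 * cos \<theta> * g (r + 1) - g r) =
        ((x s - p) * (sin ((r + 1 + 2) * \<theta>) - (2 * cos \<theta> * sin ((r + 1 + 1) * \<theta>) - sin ((r + 1) * \<theta>)))
        - (x t - q) * (sin ((r + 2) * \<theta>) - (2 * cos \<theta> * sin ((r + 1) * \<theta>) - sin (r * \<theta>)))) / sin \<theta>"
      unfolding g_def by (simp add: add_divide_distrib diff_divide_distrib algebra_simps)
    then show ?thesis by (simp only: sin_recurrence) simp
  qed
  have step: "act (concat (replicate j [s, t])) x
      = x(s := p + g (2 * real j), t := q + g (2 * real j - 1))" for j
  proof (induction j)
    case 0
    have "g 0 = x s - p" "g (- 1) = x t - q"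
      using sin by (auto simp: g_def)
    then show ?case by auto
  next
    case (Suc j)
    have i1: "2 * real j - 1 + 2 = 2 * real j + 1" "2 * real j - 1 + 1 = 2 * real j" by simp_all
    have e1: "2 * cos \<theta> * (p + g (2 * real j)) + R t - (q + g (2 * real j - 1)) = q + g (2 * real j + 1)"
      using grec[of "2 * real j - 1", unfolded i1] pq(2) by (simp add: distrib_left)
    have e2: "2 * cos \<theta> * (q + g (2 * real j + 1)) + R s - (p + g (2 * real j)) = p + g (2 * real j + 2)"
      using grec[of "2 * real j"] pq(1) by (simp add: distrib_left)
    have r1: "reflect t (x(s := p + g (2 * real j), t := q + g (2 * real j - 1)))
        = x(s := p + g (2 * real j), t := q + g (2 * real j + 1))"
      unfolding reflect_def nbt by (simp only: e1 fun_upd_same fun_upd_upd)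
    have r2: "reflect s (x(s := p + g (2 * real j), t := q + g (2 * real j + 1)))
        = x(s := p + g (2 * real j + 2), t := q + g (2 * real j + 1))"
      unfolding reflect_def nbs using \<open>s \<noteq> t\<close>
      by (simp add: e2 fun_upd_twist)
    have "act (concat (replicate (Suc j) [s, t])) x
        = reflect s (reflect t (act (concat (replicate j [s, t])) x))" by simp
    also have "\<dots> = x(s := p + g (2 * real j + 2), t := q + g (2 * real j + 1))"
      by (simp only: Suc r1 r2)
    also have "2 * real j + 2 = 2 * real (Suc j)" by simp
    also have "2 * real j + 1 = 2 * real (Suc j) - 1" by simp
    finally show ?case .
  qed
  \<comment> \<open>After \<open>2k\<close> reflections the argument of the sines has advanced by a
    full turn, so the offsets return to their initial values.\<close>
  have k\<theta>: "2 * real k * \<theta> = 2 * pi" using k by (simp add: \<theta>_def)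
  have "(2 * real k + 1) * \<theta> = \<theta> + 2 * pi" "(2 * real k - 1) * \<theta> = 2 * pi - \<theta>"
    using k\<theta> by (simp_all add: algebra_simps)
  moreover have "sin (2 * real k * \<theta>) = 0" by (simp only: k\<theta>) simp
  ultimately have "g (2 * real k) = x s - p" "g (2 * real k - 1) = x t - q"
    using sin by (simp_all add: g_def sin_diff)
  then show ?thesis using step[of k] by auto
qed

end

section \<open>Minimal words and positive roots\<close>

lemma concat_replicate_map: "map f (concat (replicate k u)) = concat (replicate k (map f u))"
  by (induction k) auto

lemma length_alternating [simp]: "length (alternating s t n) = n"
  by (induction n arbitrary: s t) auto

lemma set_alternating: "set (alternating s t n) \<subseteq> {s, t}"
  by (induction n arbitrary: s t) auto

lemma alternating_in_lists: "s \<in> L \<Longrightarrow> t \<in> L \<Longrightarrow> alternating s t n \<in> lists L"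
  using set_alternating[of s t n] by (auto simp: in_lists_conv_set)

lemma alternating_snoc:
  "alternating s t (Suc n) = alternating s t n @ [if odd n then t else s]"
proof (induction n arbitrary: s t)
  case (Suc n)
  have "alternating s t (Suc (Suc n)) = s # alternating t s (Suc n)" by simp
  also have "\<dots> = s # alternating t s n @ [if odd n then s else t]" by (simp only: Suc)
  finally show ?case by simp
qed simp

lemma nth_alternating: "i < n \<Longrightarrow> alternating s t n ! i = (if even i then s else t)"
  by (induction n arbitrary: s t i) (auto simp: nth_Cons')

lemma alternating_add:
  "alternating s t (a + b) =
    alternating s t a @ (if even a then alternating s t b else alternating t s b)"
  by (induction a arbitrary: s t) auto

lemma rev_alternating:
  "rev (alternating s t n) = (if odd n then alternating s t n else alternating t s n)"
proof (induction n arbitrary: s t)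
  case (Suc n)
  have "rev (alternating s t (Suc n)) =
      (if odd n then t else s) # rev (alternating s t n)"
    by (subst alternating_snoc) simp
  then show ?case by (simp add: Suc)
qed simp

lemma concat_replicate_alternating: "concat (replicate k [s, t]) = alternating s t (k + k)"
  by (induction k) auto

context coxeter_data begin

section \<open>Positive words modulo the relations over an alphabet\<close>

abbreviation pos_word :: "'a list \<Rightarrow> ('a \<times> bool) list" where
  "pos_word \<equiv> map (\<lambda>s. (s, True))"

text \<open>Positive words suffice because the generators are involutions (see
  \<open>unsign\<close>). The alphabet is a parameter because parabolic subgroups enter with their
  own presentations.\<close>

definition eqw :: "'a set \<Rightarrow> 'a list \<Rightarrow> 'a list \<Rightarrow> bool" where
  "eqw L u v \<longleftrightarrow> (pos_word u, pos_word v) \<in> presentation_rel L (coxeter_relators L m)"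

text \<open>Signs can be forgotten since a reflection is its own inverse; the relators act trivially
  by \<open>act_braid\<close>.\<close>

lemma presentation_rel_act:
  assumes "L \<subseteq> S" and "(p, q) \<in> presentation_rel L (coxeter_relators L m)"
  shows "act (map fst p) x = act (map fst q) x"
  using assms(2)
proof (induction arbitrary: x rule: presentation_rel.induct)
  case (relator u v r)
  then obtain s t k where st: "s \<in> L" "t \<in> L" "m s t = enat k"
    and r: "r = concat (replicate k [(s, True), (t, True)])"
    by (auto simp: coxeter_relators_def)
  have r': "map fst r = concat (replicate k [s, t])"
    by (simp add: r concat_replicate_map)
  have "act (map fst r) y = y" for y
  proof (cases "s = t")
    case True
    then have "k = 1" using st m_eq_1_iff[of s t] assms(1) by (auto simp: one_enat_def)
    then show ?thesis using True by (simp add: r')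
  next
    case False
    then show ?thesis unfolding r' using st assms(1) by (intro act_braid) auto
  qed
  then show ?case by simp
qed auto

text \<open>Every relator has even length. The resulting sign character is what makes lengths change
  by exactly one in \<open>not_minw_snocE\<close>.\<close>

lemma presentation_rel_parity:
  "(p, q) \<in> presentation_rel L (coxeter_relators L m) \<Longrightarrow> even (length p) = even (length q)"
proof (induction rule: presentation_rel.induct)
  case (relator u v r)
  then obtain s t k where "r = concat (replicate k [(s, True), (t, True)])"
    by (auto simp: coxeter_relators_def)
  then have "length r = k * 2" by (simp add: length_concat sum_list_replicate)
  then show ?case by simp
qed auto

lemma pos_word_lists: "pos_word u \<in> lists (L \<times> UNIV) \<longleftrightarrow> u \<in> lists L"
  by (auto simp: in_lists_conv_set)

lemma eqw_lists: "eqw L u v \<Longrightarrow> u \<in> lists L \<and> v \<in> lists L"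
  unfolding eqw_def by (drule presentation_rel_lists) (simp only: pos_word_lists)

lemma eqw_refl: "u \<in> lists L \<Longrightarrow> eqw L u u"
  unfolding eqw_def by (rule presentation_rel.refl) (simp only: pos_word_lists)

lemma eqw_sym: "eqw L u v \<Longrightarrow> eqw L v u"
  unfolding eqw_def by (rule presentation_rel.sym)

lemma eqw_trans [trans]: "eqw L u v \<Longrightarrow> eqw L v w \<Longrightarrow> eqw L u w"
  unfolding eqw_def by (rule presentation_rel.trans)

lemma eqw_append: "eqw L u u' \<Longrightarrow> eqw L v v' \<Longrightarrow> eqw L (u @ v) (u' @ v')"
  by (simp add: eqw_def presentation_rel_append)

lemma eqw_context:
  "eqw L u v \<Longrightarrow> a \<in> lists L \<Longrightarrow> b \<in> lists L \<Longrightarrow> eqw L (a @ u @ b) (a @ v @ b)"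
  by (intro eqw_append eqw_refl)

lemma eqw_act: "L \<subseteq> S \<Longrightarrow> eqw L u v \<Longrightarrow> act u x = act v x"
  using presentation_rel_act[of L "pos_word u" "pos_word v" x] by (simp add: eqw_def comp_def)

lemma eqw_parity: "eqw L u v \<Longrightarrow> even (length u) = even (length v)"
  unfolding eqw_def by (auto dest: presentation_rel_parity)

lemma eqw_relator:
  assumes "s \<in> L" "t \<in> L" "m s t = enat k"
  shows "eqw L (concat (replicate k [s, t])) []"
proof -
  let ?r = "concat (replicate k [(s, True), (t, True)])"
  have "([] @ ?r @ [], [] @ []) \<in> presentation_rel L (coxeter_relators L m)"
    by (rule presentation_rel.relator)
      (use assms in \<open>auto simp: coxeter_relators_def in_lists_conv_set\<close>)
  then show ?thesis by (simp add: eqw_def concat_replicate_map)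
qed

lemma eqw_square: "L \<subseteq> S \<Longrightarrow> s \<in> L \<Longrightarrow> eqw L [s, s] []"
  using eqw_relator[of s L s 1] m_eq_1_iff[of s s] by (auto simp: one_enat_def)

lemma eqw_rev_cancel:
  assumes "L \<subseteq> S" "v \<in> lists L"
  shows "eqw L (rev v @ v) []"
  using assms(2)
proof (induction v)
  case (Cons s v)
  then have "eqw L (rev v @ [s, s] @ v) (rev v @ [] @ v)"
    using assms(1) by (intro eqw_context eqw_square) (auto simp: in_lists_conv_set)
  also have "eqw L (rev v @ [] @ v) []" using Cons by auto
  finally show ?case by simp
qed (simp add: eqw_refl)

lemma eqw_cancel_rev: "L \<subseteq> S \<Longrightarrow> v \<in> lists L \<Longrightarrow> eqw L (v @ rev v) []"
  using eqw_rev_cancel[of L "rev v"] by (simp add: in_lists_conv_set)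

lemma eqw_rev:
  assumes "L \<subseteq> S" "eqw L u v"
  shows "eqw L (rev u) (rev v)"
proof -
  have uv: "u \<in> lists L" "v \<in> lists L" using eqw_lists assms by auto
  then have uv': "rev u \<in> lists L" "rev v \<in> lists L" by (simp_all add: in_lists_conv_set)
  have "eqw L (rev u @ [] @ []) (rev u @ (v @ rev v) @ [])"
    by (rule eqw_context) (use uv uv' assms(1) in \<open>auto intro: eqw_sym eqw_cancel_rev\<close>)
  also have "eqw L (rev u @ (v @ rev v) @ []) (rev u @ u @ rev v)"
    using eqw_context[OF eqw_sym[OF assms(2)] uv'] by simp
  also have "eqw L (rev u @ u @ rev v) (rev v)"
    using eqw_context[OF eqw_rev_cancel[OF assms(1) uv(1)], of "[]" "rev v"] uv' by simp
  finally show ?thesis by simp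
qed

text \<open>For either parity of \<open>k\<close>, the relator is one alternating word of length
  \<open>k\<close> followed by the reverse of the other.\<close>

lemma eqw_braid:
  assumes L: "L \<subseteq> S" and s: "s \<in> L" and t: "t \<in> L" and k: "m s t = enat k"
  shows "eqw L (alternating s t k) (alternating t s k)"
proof -
  let ?u = "alternating s t k" and ?v = "alternating t s k"
  have l: "?u \<in> lists L" "?v \<in> lists L" using s t by (simp_all only: alternating_in_lists)
  have eq: "concat (replicate k [s, t]) = ?u @ rev ?v"
    by (simp add: concat_replicate_alternating alternating_add rev_alternating)
  have "eqw L (?u @ [] @ []) (?u @ (rev ?v @ ?v) @ [])"
    by (rule eqw_context) (use l L in \<open>auto intro: eqw_sym eqw_rev_cancel\<close>)
  also have "eqw L (?u @ (rev ?v @ ?v) @ []) ([] @ [] @ ?v)"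
    using eqw_context[OF eqw_relator[OF s t k], of "[]" ?v] l by (simp add: eq)
  finally show ?thesis by simp
qed


section \<open>Minimal words, descents and parabolic decompositions\<close>

definition minw :: "'a set \<Rightarrow> 'a list \<Rightarrow> bool" where
  "minw L v \<longleftrightarrow> v \<in> lists L \<and> (\<forall>u. eqw L u v \<longrightarrow> length v \<le> length u)"

lemma minw_lists: "minw L v \<Longrightarrow> v \<in> lists L"
  by (simp add: minw_def)

lemma ex_minw:
  assumes "v \<in> lists L"
  obtains u where "eqw L u v" "minw L u"
proof -
  obtain u where "eqw L u v" "\<forall>u'. eqw L u' v \<longrightarrow> length u \<le> length u'"
    using ex_has_least_nat[of "\<lambda>u. eqw L u v" v length] eqw_refl[OF assms] by blast
  then have "minw L u" unfolding minw_def by (meson eqw_lists eqw_trans)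
  then show ?thesis using that \<open>eqw L u v\<close> by blast
qed

lemma minw_factor:
  assumes "minw L (a @ v @ b)"
  shows "minw L v"
proof -
  have l: "a \<in> lists L" "v \<in> lists L" "b \<in> lists L"
    using minw_lists[OF assms] by (auto simp: in_lists_conv_set)
  {
    fix u assume "eqw L u v"
    then have "eqw L (a @ u @ b) (a @ v @ b)" using l by (intro eqw_context)
    then have "length (a @ v @ b) \<le> length (a @ u @ b)" using assms unfolding minw_def by blast
    then have "length v \<le> length u" by simp
  }
  then show ?thesis using l by (simp add: minw_def)
qed

lemma minw_prefix: "minw L (a @ b) \<Longrightarrow> minw L a"
  using minw_factor[of L "[]" a b] by simp

lemma minw_suffix: "minw L (a @ b) \<Longrightarrow> minw L b"
  using minw_factor[of L a b "[]"] by simp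

lemma minw_eqw: "minw L v \<Longrightarrow> eqw L u v \<Longrightarrow> length u \<le> length v \<Longrightarrow> minw L u"
  unfolding minw_def by (meson eqw_lists eqw_trans le_trans)

lemma minw_rev:
  assumes "L \<subseteq> S" "minw L v"
  shows "minw L (rev v)"
proof -
  {
    fix u assume "eqw L u (rev v)"
    then have "eqw L (rev u) v" using eqw_rev[OF assms(1)] by fastforce
    then have "length v \<le> length u" using assms(2) by (auto simp: minw_def)
  }
  then show ?thesis using minw_lists[OF assms(2)] by (auto simp: minw_def in_lists_conv_set)
qed

lemma not_minw_square:
  assumes "L \<subseteq> S"
  shows "\<not> minw L (a @ s # s # b)"
proof
  assume *: "minw L (a @ s # s # b)"
  then have l: "a \<in> lists L" "s \<in> L" "b \<in> lists L" using minw_lists by fastforce+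
  have "eqw L (a @ [] @ b) (a @ [s, s] @ b)"
    using l assms by (intro eqw_context eqw_sym[OF eqw_square])
  then have "length (a @ s # s # b) \<le> length (a @ b)" using * unfolding minw_def by fastforce
  then show False by simp
qed

text \<open>By parity, a word for \<open>v @ [e]\<close> with fewer letters has at most
  \<open>length v - 1\<close> of them. Appending \<open>e\<close> to it gives back \<open>v\<close>,
  so it has exactly that many: a descent can be brought to the end.\<close>

lemma not_minw_snocE:
  assumes L: "L \<subseteq> S" and v: "minw L v" and e: "e \<in> L" and n: "\<not> minw L (v @ [e])"
  obtains u where "minw L (u @ [e])" "eqw L (u @ [e]) v" "length u + 1 = length v"
proof -
  have "v @ [e] \<in> lists L" using minw_lists[OF v] e by simp
  then obtain u where u: "eqw L u (v @ [e])" "length u < length v + 1"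
    using n by (auto simp: minw_def not_le)
  then have "length u \<noteq> length v" using eqw_parity[OF u(1)] by auto
  have lu: "u \<in> lists L" using eqw_lists[OF u(1)] by simp
  have "eqw L (u @ [e]) ((v @ [e]) @ [e])" using u(1) e by (intro eqw_append eqw_refl) auto
  also have "eqw L ((v @ [e]) @ [e]) v"
    using eqw_context[OF eqw_square[OF L e], of v "[]"] minw_lists[OF v] by simp
  finally have eq: "eqw L (u @ [e]) v" .
  then have "length v \<le> length u + 1" using v unfolding minw_def by fastforce
  then have len: "length u + 1 = length v" using u(2) \<open>length u \<noteq> length v\<close> by simp
  then have "minw L (u @ [e])" using minw_eqw[OF v eq] by simp
  then show ?thesis using that eq len by blast
qed

text \<open>Among all splittings with second factor over \<open>D\<close> and lengths adding up,
  take one with shortest \<open>z\<close>: a letter of \<open>D\<close> that could still be split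
  off \<open>z\<close> would be moved into \<open>a\<close>. The last clause compares
  \<open>z\<close> with the visible suffixes over \<open>D\<close> and supplies the decrease in the
  induction of \<open>minw_nonneg\<close>.\<close>

lemma parabolic_decomposition:
  assumes L: "L \<subseteq> S" and v: "minw L v" and D: "D \<subseteq> L"
  shows "\<exists>z a. a \<in> lists D \<and> eqw L (z @ a) v \<and> length z + length a = length v \<and>
    (\<forall>d\<in>D. minw L (z @ [d])) \<and>
    (\<forall>b c. v = b @ c \<longrightarrow> c \<in> lists D \<longrightarrow> length z \<le> length b)"
proof -
  define P where "P = (\<lambda>p. snd p \<in> lists D \<and> eqw L (fst p @ snd p) v
    \<and> length (fst p) + length (snd p) = length v)"
  have "P (v, [])" using eqw_refl[OF minw_lists[OF v]] by (simp add: P_def)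
  then obtain p where p: "P p" and least: "\<And>q. P q \<Longrightarrow> length (fst p) \<le> length (fst q)"
    using ex_has_least_nat[of P _ "\<lambda>p. length (fst p)"] by blast
  obtain z a where za: "p = (z, a)" by (cases p)
  have a: "a \<in> lists D" "eqw L (z @ a) v" "length z + length a = length v"
    using p by (simp_all add: P_def za)
  have mz: "minw L (z @ a)" using minw_eqw[OF v a(2)] a(3) by simp
  have min: "minw L (z @ [d])" if d: "d \<in> D" for d
  proof (rule ccontr)
    assume "\<not> minw L (z @ [d])"
    then obtain u where u: "eqw L (u @ [d]) z" "length u + 1 = length z"
      using not_minw_snocE[OF L minw_prefix[OF mz]] D d by blast
    have "eqw L ((u @ [d]) @ a) (z @ a)"
      using minw_lists[OF mz] by (intro eqw_append u eqw_refl) simp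
    then have "eqw L (u @ d # a) v" using a(2) eqw_trans by fastforce
    then have "P (u, d # a)" using a d u(2) by (simp add: P_def)
    then show False using least[of "(u, d # a)"] u(2) by (simp add: za)
  qed
  have "length z \<le> length b" if "v = b @ c" "c \<in> lists D" for b c
    using least[of "(b, c)"] that eqw_refl[OF minw_lists[OF v]] by (simp add: P_def za)
  then show ?thesis using a min by blast
qed

lemma minw_alternating:
  assumes "L \<subseteq> S" "minw L a" "a \<in> lists {d, e}"
  shows "a = alternating d e (length a) \<or> a = alternating e d (length a)"
  using assms(2,3)
proof (induction a)
  case (Cons c a)
  have IH: "a = alternating d e (length a) \<or> a = alternating e d (length a)"
    using Cons minw_suffix[of L "[c]" a] by simp
  show ?case
  proof (cases a)
    case Nil
    then show ?thesis using Cons.prems by auto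
  next
    case (Cons f b)
    have "f \<noteq> c" using not_minw_square[OF assms(1), of "[]" c b] Cons.prems Cons by auto
    moreover have "c = d \<or> c = e" "f = d \<or> f = e" using Cons Cons.prems by auto
    ultimately show ?thesis using IH Cons by auto
  qed
qed simp

text \<open>In an alternating word of length \<open>k + 1\<close>, braiding the last
  \<open>k\<close> letters makes the second letter equal to the first, and a square appears.\<close>

lemma minw_alternating_length:
  assumes "L \<subseteq> S" "minw L (alternating d e n)" "d \<in> L" "e \<in> L" "m d e = enat k"
  shows "n \<le> k"
proof (rule ccontr)
  assume "\<not> n \<le> k"
  then obtain j where j: "n = Suc k + j" using le_Suc_ex[of "Suc k" n] by auto
  have mw: "minw L (alternating d e (Suc k))"
    by (rule minw_prefix) (use assms(2) in \<open>simp only: j alternating_add\<close>)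
  have "m e d = enat k" using m_sym[OF subsetD[OF assms(1,3)] subsetD[OF assms(1,4)]] assms(5) by simp
  then have "eqw L ([d] @ alternating d e k @ []) ([d] @ alternating e d k @ [])"
    using assms by (intro eqw_context eqw_sym[OF eqw_braid]) auto
  then have "minw L (d # alternating d e k)" using minw_eqw[OF mw] by simp
  moreover have "k \<noteq> 0" using m_ge_1[OF subsetD[OF assms(1,3)] subsetD[OF assms(1,4)]] assms(5)
    by (auto simp: one_enat_def)
  ultimately show False
    using not_minw_square[OF assms(1), of "[]" d] by (cases k) auto
qed

section \<open>Roots of dihedral subgroups\<close>

fun cheb :: "real \<Rightarrow> nat \<Rightarrow> real" where
  "cheb b 0 = 0"
| "cheb b (Suc 0) = 1"
| "cheb b (Suc (Suc n)) = b * cheb b (Suc n) - cheb b n"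

text \<open>So \<open>cheb b n\<close> is the Chebyshev polynomial of the second kind of degree n -
  1 at b/2, that is, sin(n \<theta>) / sin \<theta> where this makes sense.\<close>

lemma cheb_cos: "cheb (2 * cos \<theta>) n * sin \<theta> = sin (real n * \<theta>)"
proof (induction "2 * cos \<theta>" n rule: cheb.induct)
  case (3 n)
  have "sin (real (Suc (Suc n)) * \<theta>) = 2 * cos \<theta> * sin (real (Suc n) * \<theta>) - sin (real n * \<theta>)"
    using sin_recurrence[of "real n" \<theta>] by (simp add: algebra_simps)
  then show ?case using 3 by (simp add: left_diff_distrib)
qed auto

lemma cheb_2: "cheb 2 n = real n"
  by (induction "2::real" n rule: cheb.induct) auto

text \<open>For n at most k the angle n pi / k does not pass pi. At label infinity the value is n
  itself.\<close>

lemma cheb_nonneg: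
  assumes "s \<in> S" "t \<in> S" "s \<noteq> t" "\<And>k. m s t = enat k \<Longrightarrow> n \<le> k"
  shows "0 \<le> cheb (bond s t) n"
proof (cases "m s t")
  case (enat k)
  define \<theta> where "\<theta> = pi / real k"
  have k: "2 \<le> k" using m_ge_2 assms enat by blast
  then have sin: "0 < sin \<theta>" unfolding \<theta>_def by (rule sin_pos_of_m)
  have "real n * \<theta> \<le> pi" "0 \<le> real n * \<theta>"
    using assms(4)[OF enat] k by (auto simp: \<theta>_def field_simps)
  then have "0 \<le> sin (real n * \<theta>)" by (intro sin_ge_zero)
  then have "0 \<le> cheb (2 * cos \<theta>) n * sin \<theta>" by (simp only: cheb_cos)
  then show ?thesis using sin enat by (simp add: bond_def \<theta>_def zero_le_mult_iff)
qed (simp add: bond_def cheb_2)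

text \<open>Reflecting in \<open>s\<close> turns the \<open>s\<close>-coordinate into
  \<open>bond s t\<close> times the \<open>t\<close>-coordinate minus itself, which is the
  recurrence of \<open>cheb\<close>.\<close>

lemma act_alternating:
  assumes "s \<in> S" "t \<in> S" "s \<noteq> t"
  shows "act (alternating s t n) (sroot (if odd n then t else s)) =
    (\<lambda>r. cheb (bond s t) (Suc n) * sroot s r + cheb (bond s t) n * sroot t r)"
  using assms
proof (induction n arbitrary: s t)
  case (Suc n)
  have b: "bond t s = bond s t" using Suc.prems bond_sym by simp
  have "act (alternating s t (Suc n)) (sroot (if odd (Suc n) then t else s)) =
      reflect s (act (alternating t s n) (sroot (if odd n then s else t)))" by simp
  also have "\<dots> = reflect s (\<lambda>r. cheb (bond s t) (Suc n) * sroot t r + cheb (bond s t) n * sroot s r)"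
    using Suc.IH[of t s] Suc.prems by (simp add: b)
  also have "\<dots> = reflect s (\<lambda>r. cheb (bond s t) n * sroot s r + cheb (bond s t) (Suc n) * sroot t r)"
    by (simp add: add.commute)
  also have "\<dots> = (\<lambda>r. cheb (bond s t) (Suc (Suc n)) * sroot s r + cheb (bond s t) (Suc n) * sroot t r)"
    using Suc.prems unfolding reflect_def
    by (simp only: nbsum_pair[OF Suc.prems]) (auto simp: sroot_def fun_eq_iff)
  finally show ?case .
qed simp

text \<open>If \<open>z\<close> keeps both simple roots of the dihedral subgroup positive, it keeps
  all its positive roots positive. The bound on \<open>n\<close> prevents the alternating word from
  passing the longest element.\<close>

lemma nonneg_act_dihedral:
  assumes "d \<in> S" "e \<in> S" "d \<noteq> e"
    and af: "a @ [f] = alternating d e (Suc n)"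
    and n: "\<And>k. m d e = enat k \<Longrightarrow> Suc n \<le> k"
    and z: "nonneg (act z (sroot d))" "nonneg (act z (sroot e))"
  shows "nonneg (act (z @ a) (sroot f))"
proof -
  have a: "a = alternating d e n" "f = (if odd n then e else d)"
    using af[unfolded alternating_snoc] by auto
  have "0 \<le> cheb (bond d e) (Suc n)" "0 \<le> cheb (bond d e) n"
    using assms(1-3) n by (auto intro!: cheb_nonneg dest: n)
  then show ?thesis
    using act_alternating[OF assms(1-3), of n] z
    by (simp only: act_append a act_linear) (simp add: nonneg_def)
qed

lemma nonneg_act_dihedral':
  assumes L: "L \<subseteq> S" and de: "d \<in> L" "e \<in> L" "d \<noteq> e"
    and af: "a @ [f] = alternating d e (Suc n) \<or> a @ [f] = alternating e d (Suc n)"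
    and n: "\<And>k. m d e = enat k \<Longrightarrow> Suc n \<le> k"
    and z: "nonneg (act z (sroot d))" "nonneg (act z (sroot e))"
  shows "nonneg (act (z @ a) (sroot f))"
  using af
proof
  assume "a @ [f] = alternating d e (Suc n)"
  then show ?thesis using nonneg_act_dihedral[of d e] assms by blast
next
  assume *: "a @ [f] = alternating e d (Suc n)"
  have "m e d = m d e" using m_sym de L by auto
  then show ?thesis using nonneg_act_dihedral[of e d a f n z] * assms by auto
qed

text \<open>A minimal word is split as \<open>z @ a\<close>, where \<open>a\<close> uses only its last letter and \<open>e\<close> and
  \<open>z\<close> is shortest; then both simple roots stay positive under \<open>z\<close> by induction.\<close>

lemma minw_nonneg:
  assumes L: "L \<subseteq> S"
  shows "minw L (v @ [e]) \<Longrightarrow> nonneg (act v (sroot e))"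
proof (induction "length v" arbitrary: v e rule: less_induct)
  case less
  have e: "e \<in> L" using minw_lists[OF less.prems] by simp
  show ?case
  proof (cases v rule: rev_cases)
    case Nil
    then show ?thesis by (simp add: nonneg_sroot)
  next
    case (snoc v' d)
    have d: "d \<in> L" "d \<noteq> e"
      using minw_lists[OF less.prems] not_minw_square[OF L, of v' e "[]"] less.prems snoc by auto
    have v: "minw L v" using minw_prefix[OF less.prems] .
    obtain z a where za: "a \<in> lists {d, e}" "eqw L (z @ a) v" "length z + length a = length v"
      and z: "\<And>c. c \<in> {d, e} \<Longrightarrow> minw L (z @ [c])"
      and sh: "\<And>b c. v = b @ c \<Longrightarrow> c \<in> lists {d, e} \<Longrightarrow> length z \<le> length b"
      using parabolic_decomposition[OF L v, of "{d, e}"] d e by auto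
    \<comment> \<open>The last letter \<open>d\<close> of \<open>v\<close> is by itself a suffix
      over \<open>{d, e}\<close>, so \<open>z\<close> is at most as long as
      \<open>v'\<close>.\<close>
    have "length z < length v" using sh[of v' "[d]"] snoc by auto
    then have nn: "nonneg (act z (sroot d))" "nonneg (act z (sroot e))"
      using less.hyps z by auto
    have eq: "eqw L (z @ (a @ [e])) (v @ [e])" using eqw_append[OF za(2) eqw_refl[of "[e]" L]] e by simp
    then have "minw L (a @ [e])"
      using minw_eqw[OF less.prems eq] za(3) minw_suffix by fastforce
    moreover from this have alt: "a @ [e] = alternating d e (Suc (length a)) \<or>
        a @ [e] = alternating e d (Suc (length a))"
      using minw_alternating[OF L, of "a @ [e]" d e] za(1) by simp
    moreover have sym: "m e d = m d e" using m_sym d e L by auto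
    ultimately have "\<And>k. m d e = enat k \<Longrightarrow> Suc (length a) \<le> k"
      using minw_alternating_length[OF L _ d(1) e] minw_alternating_length[OF L _ e d(1)] sym
      by auto
    then have "nonneg (act (z @ a) (sroot e))"
      using nonneg_act_dihedral'[OF L d(1) e d(2) alt _ nn] by blast
    then show ?thesis using eqw_act[OF L za(2)] by simp
  qed
qed

section \<open>Signs of roots and pairs of descents\<close>

lemma not_minw_nonpos:
  assumes L: "L \<subseteq> S" and "minw L v" "e \<in> L" "\<not> minw L (v @ [e])"
  shows "nonpos (act v (sroot e))"
proof -
  obtain u where u: "minw L (u @ [e])" "eqw L (u @ [e]) v"
    using not_minw_snocE[OF assms] by blast
  have "act v (sroot e) = (\<lambda>t. - act u (sroot e) t)"
    using eqw_act[OF L u(2)] act_snoc_sroot by metis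
  then show ?thesis using minw_nonneg[OF L u(1)] nonpos_uminus by simp
qed

lemma not_nonneg_nonpos: "nonneg (act v (sroot e)) \<Longrightarrow> nonpos (act v (sroot e)) \<Longrightarrow> False"
  using nonneg_nonpos act_sroot_nonzero by blast

lemma minw_snoc_iff:
  assumes "L \<subseteq> S" "minw L v" "e \<in> L"
  shows "minw L (v @ [e]) \<longleftrightarrow> nonneg (act v (sroot e))"
  using minw_nonneg not_minw_nonpos not_nonneg_nonpos assms by blast

text \<open>Replace \<open>v\<close> by a minimal word with the same action; then \<open>e\<close>
  is an ascent or a descent of it.\<close>

lemma root_dichotomy:
  assumes "L \<subseteq> S" "v \<in> lists L" "e \<in> L"
  shows "nonneg (act v (sroot e)) \<or> nonpos (act v (sroot e))"
proof -
  obtain u where u: "eqw L u v" "minw L u" using ex_minw[OF assms(2)] .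
  have "nonneg (act u (sroot e)) \<or> nonpos (act u (sroot e))"
    using minw_nonneg not_minw_nonpos u(2) assms by blast
  then show ?thesis using eqw_act[OF assms(1) u(1)] by simp
qed

text \<open>Since \<open>redw\<close> does not refer to \<open>L\<close>, minimality over
  \<open>L\<close> and over any larger alphabet inside \<open>S\<close> agree. This is how parabolic
  subgroups inherit length from the whole group.\<close>

lemma minw_iff_redw:
  assumes L: "L \<subseteq> S" and "v \<in> lists L"
  shows "minw L v \<longleftrightarrow> redw v"
  using assms(2)
proof (induction v rule: rev_induct)
  case Nil
  then show ?case by (simp add: minw_def redw_def)
next
  case (snoc e v)
  then have "minw L v \<longleftrightarrow> redw v" "e \<in> L" by auto
  then show ?case
    unfolding redw_snoc using minw_snoc_iff[OF L] minw_prefix by blast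
qed

text \<open>Split off a factor \<open>a\<close> over \<open>{d, e}\<close> with shortest remainder.
  If \<open>a\<close> had fewer than \<open>m d e\<close> letters, it could be continued alternately
  by a letter whose root stays positive, although both letters are descents. So \<open>a\<close> is
  the longest element of the dihedral subgroup, and a braid lets it start with
  \<open>d\<close>.\<close>

lemma two_descents:
  assumes L: "L \<subseteq> S" and v: "minw L v" and d: "d \<in> L" and e: "e \<in> L" and "d \<noteq> e"
    and nd: "\<not> minw L (v @ [d])" and ne: "\<not> minw L (v @ [e])"
  obtains k z where "m d e = enat k" "eqw L (z @ alternating d e k) v" "length z + k = length v"
proof -
  obtain z a where za: "a \<in> lists {d, e}" "eqw L (z @ a) v" "length z + length a = length v"
    and z: "\<And>c. c \<in> {d, e} \<Longrightarrow> minw L (z @ [c])"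
    using parabolic_decomposition[OF L v, of "{d, e}"] d e by auto
  have nn: "nonneg (act z (sroot d))" "nonneg (act z (sroot e))"
    using minw_nonneg[OF L] z by auto
  have "minw L a" using minw_eqw[OF v za(2)] za(3) minw_suffix by fastforce
  then have alt: "a = alternating d e (length a) \<or> a = alternating e d (length a)"
    and le: "\<And>k. m d e = enat k \<Longrightarrow> length a \<le> k"
  proof -
    show alt: "a = alternating d e (length a) \<or> a = alternating e d (length a)"
      using minw_alternating[OF L \<open>minw L a\<close> za(1)] .
    show "length a \<le> k" if "m d e = enat k" for k
      using alt
    proof
      assume a: "a = alternating d e (length a)"
      show ?thesis by (rule minw_alternating_length[OF L _ d e that]) (use \<open>minw L a\<close> a in simp)
    next
      assume a: "a = alternating e d (length a)"
      have "m e d = enat k" using m_sym[OF subsetD[OF L d] subsetD[OF L e]] that by simp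
      then show ?thesis
        by (intro minw_alternating_length[OF L _ e d]) (use \<open>minw L a\<close> a in simp_all)
    qed
  qed
  have "\<exists>k. m d e = enat k \<and> length a = k"
  proof (rule ccontr)
    assume *: "\<nexists>k. m d e = enat k \<and> length a = k"
    then have le': "\<And>k. m d e = enat k \<Longrightarrow> Suc (length a) \<le> k"
      using le by (simp add: Suc_le_eq le_neq_implies_less)
    obtain f where f: "f \<in> {d, e}"
      and af: "a @ [f] = alternating d e (Suc (length a)) \<or> a @ [f] = alternating e d (Suc (length a))"
    proof (cases "a = alternating d e (length a)")
      case True
      then show ?thesis
        using that[of "if odd (length a) then e else d"] alternating_snoc[of d e "length a"] by auto
    next
      case False
      then have "a = alternating e d (length a)" using alt by simp
      then show ?thesis
        using that[of "if odd (length a) then d else e"] alternating_snoc[of e d "length a"] by auto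
    qed
    have "nonneg (act v (sroot f))"
      using nonneg_act_dihedral'[OF L d e \<open>d \<noteq> e\<close> af le' nn] eqw_act[OF L za(2)] by simp
    moreover have "nonpos (act v (sroot f))"
      using not_minw_nonpos[OF L v] d e nd ne f by auto
    ultimately show False using not_nonneg_nonpos by blast
  qed
  then obtain k where k: "m d e = enat k" "length a = k" by blast
  have "eqw L (z @ alternating d e k) (z @ a)"
  proof (cases "a = alternating d e k")
    case True
    then show ?thesis using eqw_refl[of "z @ a" L] eqw_lists[OF za(2)] by simp
  next
    case False
    then have a: "a = alternating e d k" using alt k by simp
    have "z \<in> lists L" using eqw_lists[OF za(2)] by simp
    then show ?thesis
      using eqw_append[OF eqw_refl eqw_braid[OF L d e k(1)]] a by simp
  qed
  then have "eqw L (z @ alternating d e k) v" using eqw_trans[OF _ za(2)] by simp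
  then show ?thesis using that k za(3) by simp
qed

end

section \<open>Words without long braids\<close>

abbreviation (input) ceq where "ceq \<equiv> commutation_equivalent"

section \<open>Commutation equivalence\<close>

lemma ceq_refl [simp]: "ceq m u u"
  by (simp add: commutation_equivalent_def)

lemma ceq_trans [trans]:
  "ceq m u v \<Longrightarrow> ceq m v x \<Longrightarrow> ceq m u x"
  by (simp add: commutation_equivalent_def)

lemma commutation_move_context:
  assumes "commutation_move m u v"
  shows "commutation_move m (a @ u @ b) (a @ v @ b)"
proof -
  obtain c d s t where "u = c @ [s, t] @ d" "v = c @ [t, s] @ d" "m s t = 2"
    using assms by (auto simp: commutation_move_def)
  then show ?thesis
    unfolding commutation_move_def
    by (intro exI[of _ "a @ c"] exI[of _ "d @ b"] exI[of _ s] exI[of _ t]) simp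
qed

lemma ceq_context:
  assumes "ceq m u v"
  shows "ceq m (a @ u @ b) (a @ v @ b)"
  using assms unfolding commutation_equivalent_def
proof (induction rule: rtranclp_induct)
  case (step v x)
  then show ?case
    using rtranclp.rtrancl_into_rtrancl[OF step.IH commutation_move_context[OF step.hyps(2)]] by simp
qed simp

lemma ceq_append1:
  "ceq m u v \<Longrightarrow> ceq m (a @ u) (a @ v)"
  using ceq_context[of m u v a "[]"] by simp

lemma ceq_append2:
  "ceq m u v \<Longrightarrow> ceq m (u @ b) (v @ b)"
  using ceq_context[of m u v "[]" b] by simp

lemma ceq_swap:
  "m s t = 2 \<Longrightarrow> ceq m (a @ s # t # b) (a @ t # s # b)"
  unfolding commutation_equivalent_def commutation_move_def
  by (intro r_into_rtranclp exI[of _ a] exI[of _ b] exI[of _ s] exI[of _ t]) simp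

lemma ceq_move_left:
  "(\<And>a. a \<in> set v \<Longrightarrow> m a c = 2) \<Longrightarrow> ceq m (v @ [c]) (c # v)"
proof (induction v)
  case (Cons a v)
  have "ceq m ([a] @ v @ [c]) ([a] @ c # v)"
    using Cons by (intro ceq_append1) auto
  also have "[a] @ c # v = [] @ a # c # v" by simp
  also have "ceq m ([] @ a # c # v) ([] @ c # a # v)"
    using Cons.prems by (intro ceq_swap) auto
  finally show ?case by simp
qed simp

lemma ceq_mset: "ceq m u v \<Longrightarrow> mset u = mset v"
  unfolding commutation_equivalent_def
proof (induction rule: rtranclp_induct)
  case (step v x)
  then obtain a b s t where "v = a @ [s, t] @ b" "x = a @ [t, s] @ b"
    unfolding commutation_move_def by blast
  then show ?case using step.IH by simp
qed simp

text \<open>Letters that pairwise do not commute never pass each other, so the sequence of their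
  occurrences is an invariant of the commutation class.\<close>

lemma ceq_filter:
  assumes "ceq m u v" "\<And>s t. P s \<Longrightarrow> P t \<Longrightarrow> m s t \<noteq> 2"
  shows "filter P u = filter P v"
  using assms(1) unfolding commutation_equivalent_def
proof (induction rule: rtranclp_induct)
  case (step v x)
  then obtain a b s t where "v = a @ [s, t] @ b" "x = a @ [t, s] @ b" "m s t = 2"
    unfolding commutation_move_def by blast
  then show ?case using step.IH assms(2)[of s t] by (cases "P s"; cases "P t") simp_all
qed simp

section \<open>Reading a word along a set of positions\<close>

definition word_on :: "(nat \<Rightarrow> 'a) \<Rightarrow> nat set \<Rightarrow> 'a list" where
  "word_on w I = map w (sorted_list_of_set I)"

lemma set_word_on: "finite I \<Longrightarrow> set (word_on w I) = w ` I"
  by (simp add: word_on_def)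

lemma length_word_on: "length (word_on w I) = card I"
  by (simp add: word_on_def)

lemma sorted_list_of_set_eq:
  "sorted_wrt (<) ps \<Longrightarrow> set ps = I \<Longrightarrow> sorted_list_of_set I = (ps :: nat list)"
  using sorted_list_of_set_unique[of I ps] distinct_card[of ps] strict_sorted_iff[of ps] by auto

lemma word_on_set: "sorted_wrt (<) ps \<Longrightarrow> word_on w (set ps) = map w ps"
  using sorted_list_of_set_eq[of ps "set ps"] by (simp add: word_on_def)

lemma word_on_insert_max:
  assumes "finite A" "\<And>a. a \<in> A \<Longrightarrow> a < z"
  shows "word_on w (insert z A) = word_on w A @ [w z]"
proof -
  have "sorted_list_of_set (insert z A) = sorted_list_of_set A @ [z]"
    by (rule sorted_list_of_set_eq) (use assms in \<open>auto simp: sorted_wrt_append\<close>)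
  then show ?thesis by (simp add: word_on_def)
qed

text \<open>Remove the largest position: if it is in \<open>Y\<close>, it is already last; if it is
  in \<open>X\<close>, it moves left past all of \<open>Y\<close>, which precedes it.\<close>

lemma word_on_split:
  assumes "finite X" "finite Y" "X \<inter> Y = {}"
    and "\<And>x y. x \<in> X \<Longrightarrow> y \<in> Y \<Longrightarrow> y < x \<Longrightarrow> m (w y) (w x) = 2"
  shows "ceq m (word_on w (X \<union> Y)) (word_on w X @ word_on w Y)"
  using assms
proof (induction "card (X \<union> Y)" arbitrary: X Y)
  case 0
  then show ?case by (simp add: word_on_def)
next
  case (Suc n)
  let ?Z = "X \<union> Y"
  define z where "z = Max ?Z"
  have fin: "finite ?Z" using Suc.prems by simp
  have ne: "?Z \<noteq> {}" using Suc.hyps(2) by auto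
  have z: "z \<in> ?Z" and mx: "\<And>i. i \<in> ?Z \<Longrightarrow> i \<le> z"
    unfolding z_def using Max_in[OF fin ne] Max_ge[OF fin] by auto
  have lt: "a < z" if "a \<in> ?Z - {z}" for a using mx[of a] that by auto
  have Z: "word_on w ?Z = word_on w (?Z - {z}) @ [w z]"
    using word_on_insert_max[of "?Z - {z}" z w] lt fin z by (simp add: insert_absorb)
  show ?case
  proof (cases "z \<in> Y")
    case True
    then have *: "?Z - {z} = X \<union> (Y - {z})" using Suc.prems(3) by auto
    have c: "n = card (X \<union> (Y - {z}))" unfolding *[symmetric] using Suc.hyps(2) z fin by simp
    have "ceq m (word_on w (X \<union> (Y - {z}))) (word_on w X @ word_on w (Y - {z}))"
      by (rule Suc.hyps(1)[OF c]) (use Suc.prems in auto)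
    then have "ceq m (word_on w ?Z) ((word_on w X @ word_on w (Y - {z})) @ [w z])"
      unfolding Z * by (rule ceq_append2)
    moreover have "word_on w Y = word_on w (Y - {z}) @ [w z]"
      using word_on_insert_max[of "Y - {z}" z w] lt Suc.prems True by (simp add: insert_absorb)
    ultimately show ?thesis by simp
  next
    case False
    then have zX: "z \<in> X" using z by simp
    then have *: "?Z - {z} = (X - {z}) \<union> Y" using False by auto
    have c: "n = card ((X - {z}) \<union> Y)" unfolding *[symmetric] using Suc.hyps(2) z fin by simp
    have m1: "ceq m (word_on w ((X - {z}) \<union> Y)) (word_on w (X - {z}) @ word_on w Y)"
      by (rule Suc.hyps(1)[OF c]) (use Suc.prems in auto)
    have m2: "ceq m (word_on w Y @ [w z]) (w z # word_on w Y)"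
    proof (rule ceq_move_left)
      fix a assume "a \<in> set (word_on w Y)"
      then obtain y where y: "y \<in> Y" "a = w y" by (auto simp: set_word_on[OF Suc.prems(2)])
      then have "y < z" using lt[of y] False by auto
      then show "m a (w z) = 2" using Suc.prems(4)[OF zX y(1)] y(2) by simp
    qed
    have "ceq m (word_on w ?Z) ((word_on w (X - {z}) @ [w z]) @ word_on w Y)"
      using ceq_trans[OF ceq_append2[OF m1, of "[w z]"],
        of "word_on w (X - {z}) @ w z # word_on w Y"]
        ceq_append1[OF m2, of "word_on w (X - {z})"]
      unfolding Z * by simp
    moreover have "word_on w X = word_on w (X - {z}) @ [w z]"
      using word_on_insert_max[of "X - {z}" z w] lt Suc.prems zX by (simp add: insert_absorb)
    ultimately show ?thesis by simp
  qed
qed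

text \<open>Words are read along a set \<open>I\<close> of positions of a labelling \<open>w\<close>. A local chain of length
  \<open>m x y\<close> is a long braid, up to commutations.\<close>

definition local_chain ::
    "('a \<Rightarrow> 'a \<Rightarrow> enat) \<Rightarrow> (nat \<Rightarrow> 'a) \<Rightarrow> nat set \<Rightarrow> 'a \<Rightarrow> 'a \<Rightarrow> nat list \<Rightarrow> bool" where
  "local_chain m w I x y ps \<longleftrightarrow> sorted_wrt (<) ps \<and> set ps \<subseteq> I \<and>
    map w ps = alternating x y (length ps) \<and>
    (\<forall>a r. a + 2 < length ps \<longrightarrow> r \<in> I \<longrightarrow> ps ! a < r \<longrightarrow> r < ps ! (a + 2) \<longrightarrow> r \<noteq> ps ! (a + 1)
      \<longrightarrow> m (w r) (w (ps ! a)) = 2)"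

definition square_free :: "('a \<Rightarrow> 'a \<Rightarrow> enat) \<Rightarrow> (nat \<Rightarrow> 'a) \<Rightarrow> nat set \<Rightarrow> bool" where
  "square_free m w I \<longleftrightarrow> (\<forall>p\<in>I. \<forall>q\<in>I. p < q \<longrightarrow> w p = w q \<longrightarrow>
    (\<exists>r\<in>I. p < r \<and> r < q \<and> m (w r) (w p) \<noteq> 2))"

definition braid_free :: "('a \<Rightarrow> 'a \<Rightarrow> enat) \<Rightarrow> (nat \<Rightarrow> 'a) \<Rightarrow> nat set \<Rightarrow> bool" where
  "braid_free m w I \<longleftrightarrow> (\<forall>x y ps. local_chain m w I x y ps \<longrightarrow> x \<noteq> y \<longrightarrow> 3 \<le> length ps \<longrightarrow>
    m x y \<noteq> enat (length ps))"

text \<open>A maximal element of the heap of the word: its letter can be commuted to the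
  end.\<close>

definition heap_max :: "('a \<Rightarrow> 'a \<Rightarrow> enat) \<Rightarrow> (nat \<Rightarrow> 'a) \<Rightarrow> nat set \<Rightarrow> nat \<Rightarrow> bool" where
  "heap_max m w I q \<longleftrightarrow> q \<in> I \<and> (\<forall>r\<in>I. q < r \<longrightarrow> m (w r) (w q) = 2)"

lemma local_chain_nth:
  assumes "local_chain m w I x y ps" "i < length ps"
  shows "w (ps ! i) = (if even i then x else y)"
proof -
  have "w (ps ! i) = map w ps ! i" using assms(2) by simp
  also have "map w ps = alternating x y (length ps)" using assms(1) by (simp add: local_chain_def)
  finally show ?thesis using assms(2) by (simp add: nth_alternating)
qed

lemma local_chain_less:
  "local_chain m w I x y ps \<Longrightarrow> i < j \<Longrightarrow> j < length ps \<Longrightarrow> ps ! i < ps ! j"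
  by (simp add: local_chain_def sorted_wrt_nth_less)

lemma local_chain_comm:
  "local_chain m w I x y ps \<Longrightarrow> a + 2 < length ps \<Longrightarrow> r \<in> I \<Longrightarrow> ps ! a < r \<Longrightarrow> r < ps ! (a + 2)
    \<Longrightarrow> r \<noteq> ps ! (a + 1) \<Longrightarrow> m (w r) (w (ps ! a)) = 2"
  by (simp add: local_chain_def)

context coxeter_data begin

section \<open>Gathering chains and removing maximal letters\<close>

lemma eqw_commutation_move:
  assumes "L \<subseteq> S" "commutation_move m u v" "u \<in> lists L"
  shows "eqw L u v"
proof -
  obtain a b s t where uv: "u = a @ [s, t] @ b" "v = a @ [t, s] @ b" "m s t = 2"
    using assms by (auto simp: commutation_move_def)
  have "eqw L (alternating s t 2) (alternating t s 2)"
    by (rule eqw_braid) (use assms uv in \<open>auto simp: numeral_eq_enat\<close>)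
  then show ?thesis
    unfolding uv using assms(3) by (intro eqw_context) (auto simp: uv numeral_2_eq_2)
qed

lemma eqw_ceq:
  assumes "L \<subseteq> S" "ceq m u v" "u \<in> lists L"
  shows "eqw L u v"
  using assms(2) unfolding commutation_equivalent_def
proof (induction rule: rtranclp_induct)
  case base
  then show ?case using assms(3) by (rule eqw_refl)
next
  case (step v x)
  have "v \<in> lists L" using eqw_lists[OF step.IH] by simp
  then show ?case using eqw_trans[OF step.IH eqw_commutation_move[OF assms(1) step.hyps(2)]] by simp
qed

text \<open>Positions before the penultimate chain element leave the chain to the left, later ones
  to the right. One of the former commutes with the nearest chain letter on its left and, if there
  is one, with the chain letter before that, hence with every chain letter on its left. Between the
  last two elements only the final letter is known to commute, so the exit is on the right.\<close>

lemma gather_chain: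
  assumes I: "finite I" "w ` I \<subseteq> S" and c: "local_chain m w I x y ps" and l: "3 \<le> length ps"
  shows "\<exists>a b. ceq m (word_on w I) (a @ alternating x y (length ps) @ b)"
proof -
  let ?l = "length ps"
  let ?c = "ps ! (?l - 2)"
  have ps: "sorted_wrt (<) ps" "set ps \<subseteq> I" "map w ps = alternating x y ?l"
    using c by (auto simp: local_chain_def)
  have mono: "i < j" if "ps ! i < ps ! j" "i < ?l" "j < ?l" for i j
    using that local_chain_less[OF c, of j i] by (metis less_asym less_irrefl linorder_neqE_nat)
  define A where "A = {r \<in> I - set ps. r < ?c}"
  define B where "B = {r \<in> I - set ps. ?c < r}"
  have cin: "?c \<in> set ps" using l by simp
  have IAB: "I = A \<union> (set ps \<union> B)"
    unfolding A_def B_def using ps(2) cin by (auto simp: not_less le_less)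
  have "ceq m (word_on w (A \<union> (set ps \<union> B))) (word_on w A @ word_on w (set ps \<union> B))"
  proof (rule word_on_split)
    fix r q assume r: "r \<in> A" and q: "q \<in> set ps \<union> B" "q < r"
    have rI: "r \<in> I" "r \<notin> set ps" "r < ?c" using r by (auto simp: A_def)
    have "q \<in> set ps" using q rI by (auto simp: B_def)
    then obtain i where i: "i < ?l" "q = ps ! i" by (auto simp: in_set_conv_nth)
    define J where "J = {j. j < ?l \<and> ps ! j < r}"
    define j where "j = Max J"
    have "finite J" "i \<in> J" using i q(2) by (auto simp: J_def)
    then have j: "j \<in> J" "i \<le> j" unfolding j_def using Max_in by auto
    have jl: "j < ?l" "ps ! j < r" using j(1) by (auto simp: J_def)
    have jc: "j < ?l - 2" using mono[of j "?l - 2"] jl rI(3) l by auto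
    have "Suc j \<notin> J" using Max_ge[OF \<open>finite J\<close>, of "Suc j"] by (auto simp: j_def)
    moreover have "ps ! (j + 1) \<in> set ps" using jc by simp
    then have "r \<noteq> ps ! (j + 1)" using rI(2) by auto
    ultimately have rj: "r < ps ! (j + 1)" using jc by (auto simp: J_def)
    have j2: "j + 2 < ?l" using jc by simp
    have "r < ps ! (j + 2)" using rj local_chain_less[OF c, of "j + 1" "j + 2"] j2 by simp
    then have m1: "m (w r) (w (ps ! j)) = 2"
      using local_chain_comm[OF c j2 rI(1) jl(2)] rj by simp
    have m2: "m (w r) (w (ps ! i)) = 2"
    proof (cases "even i = even j")
      case True
      then show ?thesis using m1 local_chain_nth[OF c] i jl by simp
    next
      case False
      then have ij: "i < j" using j(2) by (metis le_neq_implies_less)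
      \<comment> \<open>A chain letter of the other parity is handled by the gap starting one step
        earlier, which also contains \<open>r\<close>.\<close>
      define h where "h = j - 1"
      have h: "j = h + 1" using ij by (simp add: h_def)
      have "ps ! h < r" using local_chain_less[OF c, of h j] jl h by simp
      then have "m (w r) (w (ps ! h)) = 2"
        using local_chain_comm[OF c, of h r] rI(1) jl j2 rj by (simp add: h)
      moreover have "even h = even i" using False h by auto
      ultimately show ?thesis using local_chain_nth[OF c] i h jl by simp
    qed
    have "q \<in> I" using i ps(2) nth_mem[of i ps] by auto
    then have "w r \<in> S" "w q \<in> S" using I(2) rI(1) by auto
    then show "m (w q) (w r) = 2" using m2 i m_sym by simp
  qed (use I in \<open>auto simp: A_def B_def\<close>)
  also have "ceq m (word_on w A @ word_on w (set ps \<union> B))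
      (word_on w A @ word_on w (set ps) @ word_on w B)"
  proof (intro ceq_append1 word_on_split)
    fix q r assume q: "q \<in> set ps" and r: "r \<in> B" "r < q"
    have rI: "r \<in> I" "r \<notin> set ps" "?c < r" using r by (auto simp: B_def)
    obtain i where i: "i < ?l" "q = ps ! i" using q by (auto simp: in_set_conv_nth)
    have "?l - 2 < i" using mono[of "?l - 2" i] i rI r l by auto
    then have il: "i = ?l - 1" using i by simp
    obtain h where h: "?l = h + 3" using l le_Suc_ex[of 3 ?l] by (metis add.commute)
    have "m (w r) (w (ps ! h)) = 2"
      using local_chain_comm[OF c, of h r] rI r i il h local_chain_less[OF c, of h "h + 1"]
      by (simp add: numeral_eq_Suc)
    moreover have "w (ps ! h) = w (ps ! i)"
      using local_chain_nth[OF c] i il h by simp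
    ultimately show "m (w r) (w q) = 2" using i by simp
  qed (use I in \<open>auto simp: B_def\<close>)
  finally have "ceq m (word_on w I) (word_on w A @ alternating x y ?l @ word_on w B)"
    by (simp only: IAB[symmetric] word_on_set[OF ps(1)] ps(3))
  then show ?thesis by blast
qed

lemma gather_square:
  assumes I: "finite I" "w ` I \<subseteq> S" and pq: "p \<in> I" "q \<in> I" "p < q" "w p = w q"
    and c: "\<And>r. r \<in> I \<Longrightarrow> p < r \<Longrightarrow> r < q \<Longrightarrow> m (w r) (w p) = 2"
  shows "\<exists>a b. ceq m (word_on w I) (a @ [w p, w p] @ b)"
proof -
  define A where "A = {r \<in> I. r < q \<and> r \<noteq> p}"
  define B where "B = {r \<in> I. q < r}"
  have IAB: "I = A \<union> ({p, q} \<union> B)" unfolding A_def B_def using pq by auto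
  have "ceq m (word_on w (A \<union> ({p, q} \<union> B))) (word_on w A @ word_on w ({p, q} \<union> B))"
    by (rule word_on_split) (use I pq c m_sym in \<open>auto simp: A_def B_def image_subset_iff\<close>)
  also have "ceq m (word_on w A @ word_on w ({p, q} \<union> B))
      (word_on w A @ word_on w {p, q} @ word_on w B)"
    by (intro ceq_append1 word_on_split) (use I pq in \<open>auto simp: B_def\<close>)
  also have "word_on w {p, q} = [w p, w p]" using word_on_set[of "[p, q]" w] pq by simp
  finally have "ceq m (word_on w I) (word_on w A @ [w p, w p] @ word_on w B)"
    by (simp only: IAB[symmetric])
  then show ?thesis by blast
qed

text \<open>The separating letter is never the removed one: a maximal letter commutes with
  everything later, in particular with the second of the two equal letters.\<close>

lemma square_free_remove:
  assumes "square_free m w I" "heap_max m w I q" "w ` I \<subseteq> S"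
  shows "square_free m w (I - {q})"
  unfolding square_free_def
proof (intro ballI impI)
  fix p p' assume p: "p \<in> I - {q}" "p' \<in> I - {q}" "p < p'" "w p = w p'"
  then obtain r where r: "r \<in> I" "p < r" "r < p'" "m (w r) (w p) \<noteq> 2"
    using assms(1) unfolding square_free_def by blast
  have "r \<noteq> q"
  proof
    assume "r = q"
    then have "m (w p') (w r) = 2" using assms(2) p r by (auto simp: heap_max_def)
    then show False using r p m_sym[of "w r" "w p'"] assms(3) by auto
  qed
  then show "\<exists>r\<in>I - {q}. p < r \<and> r < p' \<and> m (w r) (w p) \<noteq> 2" using r by blast
qed

text \<open>Removing \<open>q\<close> creates no chain: if \<open>q\<close> lay inside a gap, it
  would commute with the later end of the gap, which carries the same letter as its
  beginning.\<close>

lemma braid_free_remove: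
  assumes "braid_free m w I" "heap_max m w I q" "w ` I \<subseteq> S"
  shows "braid_free m w (I - {q})"
  unfolding braid_free_def
proof (intro allI impI)
  fix x y ps assume c: "local_chain m w (I - {q}) x y ps" and xy: "x \<noteq> y" "3 \<le> length ps"
  have "local_chain m w I x y ps"
    unfolding local_chain_def
  proof (intro conjI allI impI)
    fix a r assume r: "a + 2 < length ps" "r \<in> I" "ps ! a < r" "r < ps ! (a + 2)" "r \<noteq> ps ! (a + 1)"
    show "m (w r) (w (ps ! a)) = 2"
    proof (cases "r = q")
      case True
      have "set ps \<subseteq> I" using c by (auto simp: local_chain_def)
      then have a: "ps ! (a + 2) \<in> I" using nth_mem[OF r(1)] by blast
      then have "m (w (ps ! (a + 2))) (w r) = 2"
        using assms(2) True r by (auto simp: heap_max_def)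
      then have "m (w r) (w (ps ! (a + 2))) = 2"
        using m_sym assms(3) a r(2) by (metis image_subset_iff)
      then show ?thesis using local_chain_nth[OF c] r(1) by simp
    next
      case False
      then show ?thesis using local_chain_comm[OF c, of a r] r by simp
    qed
  qed (use c in \<open>auto simp: local_chain_def\<close>)
  then show "m x y \<noteq> enat (length ps)" using assms(1) xy unfolding braid_free_def by blast
qed

lemma word_on_remove:
  assumes "finite I" "w ` I \<subseteq> S" "heap_max m w I q"
  shows "eqw S (word_on w I) (word_on w (I - {q}) @ [w q])"
proof -
  have "ceq m (word_on w ((I - {q}) \<union> {q})) (word_on w (I - {q}) @ word_on w {q})"
    by (rule word_on_split) (use assms m_sym in \<open>auto simp: heap_max_def image_subset_iff\<close>)
  moreover have "(I - {q}) \<union> {q} = I" using assms(3) by (auto simp: heap_max_def)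
  moreover have "word_on w {q} = [w q]" by (simp add: word_on_def)
  moreover have "word_on w I \<in> lists S" using assms(1,2) by (auto simp: word_on_def)
  ultimately show ?thesis
    using eqw_ceq[OF subset_refl, of "word_on w I"] by simp
qed

lemma word_on_remove_cancel:
  assumes "finite I" "w ` I \<subseteq> S" "heap_max m w I q" "eqw S (word_on w I) (u @ [w q])"
  shows "eqw S (word_on w (I - {q})) u"
proof -
  have q: "w q \<in> S" using assms by (auto simp: heap_max_def)
  have sq: "eqw S (v @ [w q] @ [w q]) v" if "v \<in> lists S" for v
    using eqw_context[OF eqw_square[of S "w q"], of v "[]"] q that by simp
  have l: "word_on w (I - {q}) \<in> lists S" "u \<in> lists S"
    using assms(1,2) eqw_lists[OF assms(4)] by (auto simp: word_on_def)
  have "eqw S (word_on w (I - {q})) (word_on w (I - {q}) @ [w q] @ [w q])"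
    using sq[OF l(1)] by (rule eqw_sym)
  also have "eqw S (word_on w (I - {q}) @ [w q] @ [w q]) (word_on w I @ [w q])"
    using eqw_append[OF eqw_sym[OF word_on_remove[OF assms(1-3)]] eqw_refl[of "[w q]" S]] q by simp
  also have "eqw S (word_on w I @ [w q]) (u @ [w q] @ [w q])"
    using eqw_append[OF assms(4) eqw_refl[of "[w q]" S]] q by simp
  also have "eqw S (u @ [w q] @ [w q]) u" using sq[OF l(2)] .
  finally show ?thesis .
qed

lemma not_minw_of_last:
  assumes "eqw S v (u @ [c])" "length v = length u + 1"
  shows "\<not> minw S (v @ [c])"
proof
  assume *: "minw S (v @ [c])"
  have c: "c \<in> S" "u \<in> lists S" using eqw_lists[OF assms(1)] by auto
  have "eqw S u (u @ [c, c])"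
    using eqw_context[OF eqw_sym[OF eqw_square[of S c]], of u "[]"] c by simp
  also have "eqw S (u @ [c, c]) (v @ [c])"
    using eqw_append[OF eqw_sym[OF assms(1)] eqw_refl[of "[c]" S]] c by simp
  finally have "length (v @ [c]) \<le> length u" using * by (simp add: minw_def)
  then show False using assms(2) by simp
qed

text \<open>The analogue of Matsumoto's theorem for words without long braids: every right descent is
  visible at a maximal position. If \<open>d\<close>, the last letter, and \<open>e\<close> are both descents, peeling off
  maximal positions labelled alternately \<open>d\<close> and \<open>e\<close> exhibits a long braid.\<close>

lemma braid_free_descents:
  assumes "finite I" "w ` I \<subseteq> S" "square_free m w I" "braid_free m w I"
  shows "minw S (word_on w I) \<and> (\<forall>e\<in>S. \<not> minw S (word_on w I @ [e]) \<longrightarrow>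
    (\<exists>q. heap_max m w I q \<and> w q = e))"
  using assms
proof (induction "card I" arbitrary: I rule: less_induct)
  case less
  note fin = less.prems(1) and IS = less.prems(2)
  have IH: "minw S (word_on w J)"
      "\<And>e. e \<in> S \<Longrightarrow> \<not> minw S (word_on w J @ [e]) \<Longrightarrow> \<exists>q. heap_max m w J q \<and> w q = e"
    if "J \<subset> I" "square_free m w J" "braid_free m w J" for J
    using less.hyps[of J] that psubset_card_mono[OF fin that(1)] finite_subset[of J I] fin IS
    by blast+
  show ?case
  proof (cases "I = {}")
    case True
    have "minw S [e]" if "e \<in> S" for e
      using that by (simp add: minw_iff_redw redw_snoc[of "[]", simplified] redw_def nonneg_sroot Cons_eq_append_conv)
    moreover have "minw S []" by (simp add: minw_def)
    ultimately show ?thesis using True by (simp add: word_on_def)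
  next
    case False
    define N where "N = Max I"
    let ?I = "I - {N}" and ?d = "w N"
    have N: "N \<in> I" "\<And>i. i \<in> I \<Longrightarrow> i \<le> N" unfolding N_def using fin False by auto
    then have hN: "heap_max m w I N" by (force simp: heap_max_def)
    have d: "?d \<in> S" using N IS by auto
    have wI: "word_on w I = word_on w ?I @ [?d]"
      using word_on_insert_max[of ?I N w] N fin by (force simp: insert_absorb)
    have good': "square_free m w ?I" "braid_free m w ?I"
      using square_free_remove braid_free_remove hN less.prems by auto
    have sub: "?I \<subset> I" using N by auto
    note IH' = IH[OF sub good']
    \<comment> \<open>If appending the letter at \<open>N\<close> did not keep the word minimal, the
      induction hypothesis would give the same letter at a position maximal without
      \<open>N\<close>, with nothing separating it from \<open>N\<close>, against
      \<open>square_free\<close>.\<close>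
    have mw: "minw S (word_on w I)"
    proof (rule ccontr)
      assume "\<not> minw S (word_on w I)"
      then obtain q where q: "heap_max m w ?I q" "w q = ?d" using IH'(2)[OF d] wI by auto
      then have "q \<in> I" "q < N" using N(2)[of q] by (auto simp: heap_max_def)
      then obtain r where "r \<in> I" "q < r" "r < N" "m (w r) (w q) \<noteq> 2"
        using less.prems(3) N(1) q(2) unfolding square_free_def by blast
      then show False using q(1) by (auto simp: heap_max_def)
    qed
    have "\<exists>q. heap_max m w I q \<and> w q = e" if e: "e \<in> S" and ne: "\<not> minw S (word_on w I @ [e])" for e
    proof (cases "e = ?d")
      case True
      then show ?thesis using hN by blast
    next
      case False
      have nd: "\<not> minw S (word_on w I @ [?d])"
        using not_minw_square[of S "word_on w ?I" ?d "[]"] wI by simp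
      \<comment> \<open>\<open>x\<close> and \<open>y\<close> are \<open>?d\<close> and
        \<open>e\<close> in the order for which the alternating suffix ends in \<open>?d\<close>,
        the letter at \<open>N\<close>, so that peeling can start there.\<close>
      obtain k z x y where k: "m x y = enat k" "eqw S (z @ alternating x y k) (word_on w I)"
          "length z + k = card I" and xy: "{x, y} = {?d, e}" "x \<noteq> y" and last: "(if odd k then x else y) = ?d"
      proof -
        obtain k z where kz: "m ?d e = enat k" "eqw S (z @ alternating ?d e k) (word_on w I)"
          "length z + k = card I"
          using two_descents[OF _ mw d e _ nd ne] False by (auto simp: length_word_on)
        obtain z' where kz': "eqw S (z' @ alternating e ?d k) (word_on w I)" "length z' + k = card I"
          using two_descents[OF _ mw e d _ ne nd] False kz(1) m_sym[OF d e] by (auto simp: length_word_on)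
        show ?thesis
          using that[of ?d e k z] that[of e ?d k z'] kz kz' False m_sym[OF d e] by (cases "odd k") auto
      qed
      have xyS: "x \<in> S" "y \<in> S" using xy(1) d e by (metis insertCI insertE singletonD)+
      have k2: "2 \<le> k" using m_ge_2[OF xyS xy(2) k(1)] .
      \<comment> \<open>\<open>l r\<close> is the letter with \<open>r\<close> letters of the
        alternating suffix to its right, the one to be peeled after \<open>r\<close> others.\<close>
      define l where "l r = (if odd (k - r) then x else y)" for r
      have alt: "alternating x y (k - r) = alternating x y (k - Suc r) @ [l r]" if "r < k" for r
        using alternating_snoc[of x y "k - Suc r"] that by (auto simp: l_def Suc_diff_Suc)
      have l0: "l 0 = ?d" using last by (simp add: l_def)
      have l1: "l 1 = e" using xy last k2 by (auto simp: l_def doubleton_eq_iff)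
      have e0: "eqw S (word_on w ?I) (z @ alternating x y (k - 1))"
        using word_on_remove_cancel[OF fin IS hN] eqw_sym[OF k(2)] alt[of 0] l0 k2 by simp
      show ?thesis
      proof (cases "k = 2")
        case True
        have "alternating x y (k - 1) = alternating x y (k - 2) @ [e]"
          using alt[of 1] l1 k2 by (simp add: numeral_2_eq_2)
        then have "eqw S (word_on w ?I) ((z @ alternating x y (k - 2)) @ [e])" using e0 by simp
        then have "\<not> minw S (word_on w ?I @ [e])"
          by (rule not_minw_of_last) (use k k2 fin N in \<open>simp add: length_word_on\<close>)
        then obtain q where q: "heap_max m w ?I q" "w q = e" using IH'(2)[OF e] by blast
        \<comment> \<open>As the letter at \<open>N\<close> commutes with \<open>e\<close>, a
          position labelled \<open>e\<close> that is maximal without \<open>N\<close> is maximal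
          with it.\<close>
        have "m ?d e = 2" using k True xy m_sym[OF xyS] by (auto simp: doubleton_eq_iff numeral_eq_enat)
        then have "heap_max m w I q" using q by (auto simp: heap_max_def)
        then show ?thesis using q by blast
      next
        case False
        then have k3: "3 \<le> k" using k2 by simp
        then have mxy: "m x y \<noteq> 2" "m y x \<noteq> 2"
          using k m_sym[OF xyS] by (auto simp: numeral_eq_enat)
        \<comment> \<open>\<open>qs\<close> lists the peeled positions in increasing order, so each
          new one is put in front. The last clause records that \<open>qs ! a\<close> was maximal
          when it was peeled; the positions gone by then are those in
          \<open>drop (a + 1) qs\<close>.\<close>
        have "\<exists>qs. length qs = r \<and> sorted_wrt (<) qs \<and> set qs \<subseteq> I \<and>
            map w qs = drop (k - r) (alternating x y k) \<and>
            eqw S (word_on w (I - set qs)) (z @ alternating x y (k - r)) \<and>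
            square_free m w (I - set qs) \<and> braid_free m w (I - set qs) \<and>
            (\<forall>a<r. \<forall>j\<in>I - set (drop (a + 1) qs). qs ! a < j \<longrightarrow> m (w j) (w (qs ! a)) = 2)"
          if "r \<le> k" for r
          using that
        proof (induction r)
          case 0
          then show ?case using less.prems k eqw_sym by (intro exI[of _ "[]"]) auto
        next
          case (Suc r)
          then obtain qs where qs: "length qs = r" "sorted_wrt (<) qs" "set qs \<subseteq> I"
              "map w qs = drop (k - r) (alternating x y k)"
              "eqw S (word_on w (I - set qs)) (z @ alternating x y (k - r))"
              "square_free m w (I - set qs)" "braid_free m w (I - set qs)"
            and loc: "\<And>a j. a < r \<Longrightarrow> j \<in> I - set (drop (a + 1) qs) \<Longrightarrow> qs ! a < j \<Longrightarrow> m (w j) (w (qs ! a)) = 2"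
            by auto
          let ?J = "I - set qs"
          have finJ: "finite ?J" "w ` ?J \<subseteq> S" using fin IS by auto
          have cardJ: "card ?J = card I - r"
            using qs(1-3) fin by (simp add: card_Diff_subset distinct_card strict_sorted_iff)
          have rk: "r < k" using Suc by simp
          have eJ: "eqw S (word_on w ?J) ((z @ alternating x y (k - Suc r)) @ [l r])"
            using qs(5) alt[OF rk] by simp
          obtain q where q: "heap_max m w ?J q" "w q = l r" and qlt: "\<And>h. h \<in> set qs \<Longrightarrow> q < h"
          proof (cases "r = 0")
            case True
            then show ?thesis using that[of N] hN qs(1) l0 by simp
          next
            case False
            then have ne: "qs \<noteq> []" using qs(1) by auto
            then have sub: "?J \<subset> I" using qs(3) by (cases qs) auto
            have "\<not> minw S (word_on w ?J @ [l r])"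
              by (rule not_minw_of_last[OF eJ]) (use k(3) rk cardJ in \<open>simp add: length_word_on\<close>)
            moreover have "l r \<in> S" using xyS by (simp add: l_def)
            ultimately obtain q where q: "heap_max m w ?J q" "w q = l r"
              using IH(2)[OF sub qs(6,7)] by blast
            \<comment> \<open>Otherwise \<open>q\<close> would lie to the right of the position
              peeled last and commute with its letter; but the two letters are \<open>x\<close> and
              \<open>y\<close>, which do not commute.\<close>
            have "q < h" if h: "h \<in> set qs" for h
            proof (rule ccontr)
              assume "\<not> q < h"
              have "hd qs \<le> h" using h qs(2) ne by (cases qs) auto
              moreover have qh: "q \<noteq> h" "q \<in> I" "q \<notin> set qs" using h q(1) by (auto simp: heap_max_def)
              ultimately have "qs ! 0 < q" using \<open>\<not> q < h\<close> ne by (simp add: hd_conv_nth)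
              then have "m (w q) (w (qs ! 0)) = 2"
                using loc[of 0 q] qh False by (meson DiffI gr0I in_set_dropD)
              moreover have "w (qs ! 0) = alternating x y k ! (k - r)"
                using qs(4) ne False rk by (metis (no_types, lifting) qs(1) length_greater_0_conv nth_map
                    add.right_neutral diff_le_self length_alternating nth_drop)
              ultimately show False
                using q(2) False rk mxy by (auto simp: nth_alternating l_def split: if_splits)
            qed
            then show ?thesis using that q by blast
          qed
          have qI: "q \<in> I" "q \<notin> set qs" using q(1) by (auto simp: heap_max_def)
          have J': "I - set (q # qs) = ?J - {q}" by auto
          have "eqw S (word_on w (?J - {q})) (z @ alternating x y (k - Suc r))"
            using word_on_remove_cancel[OF finJ q(1)] eJ q(2) by simp
          moreover have "map w (q # qs) = drop (k - Suc r) (alternating x y k)"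
          proof -
            have "drop (k - Suc r) (alternating x y k) =
                alternating x y k ! (k - Suc r) # drop (k - r) (alternating x y k)"
              using Cons_nth_drop_Suc[of "k - Suc r" "alternating x y k"] rk by (simp add: Suc_diff_Suc)
            moreover have "alternating x y k ! (k - Suc r) = l r"
              using rk by (auto simp: nth_alternating l_def)
            ultimately show ?thesis using qs(4) q(2) by simp
          qed
          moreover have "square_free m w (?J - {q})" "braid_free m w (?J - {q})"
            using square_free_remove[OF qs(6) q(1) finJ(2)] braid_free_remove[OF qs(7) q(1) finJ(2)] by auto
          moreover have "m (w j) (w ((q # qs) ! a)) = 2"
            if "a < Suc r" "j \<in> I - set (drop (a + 1) (q # qs))" "(q # qs) ! a < j" for a j
            using that loc[of "a - 1" j] q(1) by (cases a) (auto simp: heap_max_def)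
          ultimately show ?case
            unfolding J'[symmetric] using qs(1-3) qlt qI(1) by (intro exI[of _ "q # qs"]) (simp del: drop_Suc_Cons)
        qed
        from this[of k] obtain qs where qs: "length qs = k" "sorted_wrt (<) qs" "set qs \<subseteq> I"
              "map w qs = alternating x y k"
            and loc: "\<And>a j. a < k \<Longrightarrow> j \<in> I - set (drop (a + 1) qs) \<Longrightarrow> qs ! a < j \<Longrightarrow> m (w j) (w (qs ! a)) = 2"
          by auto
        have "local_chain m w I x y qs"
          unfolding local_chain_def
        proof (intro conjI allI impI)
          fix a r assume a: "a + 2 < length qs" and r: "r \<in> I" "qs ! a < r" "r < qs ! (a + 2)" "r \<noteq> qs ! (a + 1)"
          \<comment> \<open>The positions peeled before \<open>qs ! a\<close>, apart from
            \<open>qs ! (a + 1)\<close>, start at \<open>qs ! (a + 2)\<close>. So \<open>r\<close>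
            is none of them and the recorded maximality applies to it.\<close>
          have "r \<notin> set (drop (a + 1) qs)"
          proof
            assume "r \<in> set (drop (a + 1) qs)"
            then obtain i where "i < length (drop (a + 1) qs)" "r = drop (a + 1) qs ! i"
              unfolding in_set_conv_nth by blast
            then have i: "a + 1 + i < length qs" "r = qs ! (a + 1 + i)" by simp_all
            then have "0 < i" using r by (cases i) auto
            then have "qs ! (a + 2) \<le> r"
              using i a qs(2) sorted_wrt_nth_less[of "(<)" qs "a + 2" "a + 1 + i"]
              by (cases "i = 1") (auto simp: numeral_2_eq_2)
            then show False using r by simp
          qed
          then show "m (w r) (w (qs ! a)) = 2" using loc[of a r] a r qs by simp
        qed (use qs in auto)
        then have False using less.prems(4) xy k qs k3 unfolding braid_free_def by metis
        then show ?thesis ..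
      qed
    qed
    then show ?thesis using mw by blast
  qed
qed

lemma braid_free_redw:
  assumes "finite I" "w ` I \<subseteq> S" "square_free m w I" "braid_free m w I"
  shows "redw (word_on w I)"
proof -
  have "word_on w I \<in> lists S" using assms by (auto simp: word_on_def)
  then show ?thesis using braid_free_descents[OF assms] minw_iff_redw by blast
qed

end

section \<open>Inserting a letter and splitting into components\<close>

context coxeter_data begin

definition supported :: "'a set \<Rightarrow> ('a \<Rightarrow> real) \<Rightarrow> bool" where
  "supported L x \<longleftrightarrow> (\<forall>t. t \<notin> L \<longrightarrow> x t = 0)"

lemma supported_sroot: "e \<in> L \<Longrightarrow> supported L (sroot e)"
  by (auto simp: supported_def sroot_def)

lemma supported_act: "set v \<subseteq> L \<Longrightarrow> supported L x \<Longrightarrow> supported L (act v x)"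
  by (induction v) (auto simp: supported_def reflect_def)

lemma act_unchanged: "s \<notin> set v \<Longrightarrow> act v x s = x s"
  by (induction v) (auto simp: reflect_def)

lemma nbsum_nonneg: "s \<in> S \<Longrightarrow> nonneg x \<Longrightarrow> 0 \<le> nbsum s x"
  unfolding nbsum_def by (rule sum_nonneg) (auto simp: nonneg_def intro!: mult_nonneg_nonneg bond_nonneg)

lemma nbsum_reflect_commuting:
  assumes "m s r = 2"
  shows "nbsum s (reflect r x) = nbsum s x"
  unfolding nbsum_def by (rule sum.cong) (use bond_eq_0[OF assms] in \<open>auto simp: reflect_def\<close>)

lemma nbsum_act_commuting:
  "(\<And>r. r \<in> set v \<Longrightarrow> m s r = 2) \<Longrightarrow> nbsum s (act v x) = nbsum s x"
  by (induction v) (auto simp: nbsum_reflect_commuting)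

lemma nbsum_sroot_other: "s \<in> S \<Longrightarrow> t \<in> S \<Longrightarrow> s \<noteq> t \<Longrightarrow> nbsum s (sroot t) = bond s t"
  using nbsum_pair[of s t 0 1] by simp

lemma reflect_sroot_other:
  "s \<in> S \<Longrightarrow> t \<in> S \<Longrightarrow> s \<noteq> t \<Longrightarrow> reflect t (sroot s) = (\<lambda>r. 1 * sroot s r + bond t s * sroot t r)"
  by (auto simp: reflect_def nbsum_sroot_other sroot_def fun_eq_iff)

lemma nonneg_add: "nonneg x \<Longrightarrow> nonneg y \<Longrightarrow> 0 \<le> c \<Longrightarrow> nonneg (\<lambda>r. x r + c * y r)"
  by (auto simp: nonneg_def)

lemma act_add: "act v (\<lambda>t. x t + c * y t) = (\<lambda>t. act v x t + c * act v y t)"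
  using act_linear[of v 1 x c y] by simp

text \<open>Only translates by \<open>u\<close> of the roots of \<open>v\<close> occur among the
  roots of \<open>u @ v\<close>. Minimality, which passes to all factors, bridges this gap.\<close>

lemma redw_suffix:
  assumes "redw (u @ v)" "set (u @ v) \<subseteq> S"
  shows "redw v"
proof -
  have "u @ v \<in> lists S" "v \<in> lists S" using assms(2) by auto
  then show ?thesis using assms(1) minw_iff_redw[of S] minw_suffix by blast
qed

text \<open>Expanding the last \<open>s\<close> of a prefix writes each root of \<open>v\<close> as a nonnegative combination of
  roots of shorter prefixes. A further \<open>s\<close> contributes with coefficient \<open>bond s t * bond t s - 1\<close>
  at least, for a neighbour \<open>t\<close> seen since the previous \<open>s\<close>.\<close>

lemma redw_insert:
  assumes v: "set v \<subseteq> S" and s: "s \<in> S"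
    and red: "redw (filter (\<lambda>t. t \<noteq> s) v)"
    and nb: "\<And>A B D. v = A @ s # B @ s # D \<Longrightarrow> s \<notin> set B \<Longrightarrow> \<exists>t\<in>set B. m s t \<noteq> 2"
  shows "redw v"
proof -
  let ?f = "filter (\<lambda>t. t \<noteq> s)"
  have f_id: "?f B = B" if "s \<notin> set B" for B
    using that by (auto simp: filter_id_conv)
  \<comment> \<open>The second claim, with a free continuation \<open>D\<close> avoiding
    \<open>s\<close>, is what the induction needs: cutting \<open>A\<close> at its last
    \<open>s\<close> turns everything after that \<open>s\<close> into a continuation of a shorter
    prefix.\<close>
  have main: "(\<forall>R. v = A @ s # R \<longrightarrow> nonneg (act A (sroot s))) \<and>
      (\<forall>D e. s \<notin> set D \<longrightarrow> e \<noteq> s \<longrightarrow> set D \<subseteq> S \<longrightarrow> e \<in> S \<longrightarrow> redw (?f A @ D @ [e])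
        \<longrightarrow> nonneg (act (A @ D) (sroot e)))" if "\<exists>R. v = A @ R" for A
    using that
  proof (induction "length A" arbitrary: A rule: less_induct)
    case less
    then obtain R0 where R0: "v = A @ R0" by blast
    then have AS: "set A \<subseteq> S" using v by auto
    show ?case
    proof (cases "s \<in> set A")
      case False
      have "nonneg (act A (sroot s))"
      proof -
        \<comment> \<open>No letter of \<open>A\<close> touches the coordinate at \<open>s\<close>,
          so the root has a positive coordinate and the dichotomy decides its sign.\<close>
        have "act A (sroot s) s = 1" using act_unchanged[OF False] by (simp add: sroot_def)
        then have "\<not> nonpos (act A (sroot s))" unfolding nonpos_def by (metis not_one_le_zero)
        then show ?thesis using root_dichotomy[of S A s] AS s by auto
      qed
      moreover have "nonneg (act (A @ D) (sroot e))" if "redw (?f A @ D @ [e])" for D e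
        using that f_id[OF False] redw_snoc[of "A @ D" e] by simp
      ultimately show ?thesis by blast
    next
      case True
      then obtain A1 A2 where A: "A = A1 @ s # A2" and sA2: "s \<notin> set A2"
        using split_list_last by metis
      have "length A1 < length A" "\<exists>R. v = A1 @ R" using A R0 by auto
      note IH = less.hyps[OF this]
      have A1s: "nonneg (act A1 (sroot s))" using IH A R0 by auto
      have IH2: "nonneg (act (A1 @ D) (sroot e))"
        if "s \<notin> set D" "e \<noteq> s" "set D \<subseteq> S" "e \<in> S" "redw (?f A1 @ D @ [e])" for D e
        using IH that by blast
      have A2S: "set A2 \<subseteq> S" "set A1 \<subseteq> S" using AS A by auto
      show ?thesis
      proof (intro conjI allI impI)
        fix D e assume D: "s \<notin> set D" "e \<noteq> s" "set D \<subseteq> S" "e \<in> S" "redw (?f A @ D @ [e])"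
        define y where "y = act (A2 @ D) (sroot e)"
        have r: "redw (?f A1 @ (A2 @ D) @ [e])" using D(5) A f_id[OF sA2] by simp
        have "redw ((A2 @ D) @ [e])"
          by (rule redw_suffix[OF r]) (use A2S D in auto)
        then have y: "nonneg y" unfolding redw_snoc y_def by simp
        have ys: "y s = 0" using act_unchanged[of s "A2 @ D"] sA2 D by (simp add: y_def sroot_def)
        have eq: "reflect s y = (\<lambda>t. y t + nbsum s y * sroot s t)"
          using ys by (auto simp: reflect_def sroot_def fun_eq_iff)
        have "nonneg (act A1 y)" using IH2[of "A2 @ D" e] r sA2 D A2S by (simp add: y_def)
        then have "nonneg (act A1 (reflect s y))"
          unfolding eq act_add using A1s nbsum_nonneg[OF s y] by (intro nonneg_add)
        then show "nonneg (act (A @ D) (sroot e))" by (simp add: A y_def)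
      next
        fix R assume R: "v = A @ s # R"
        have fv: "redw (?f A1 @ A2 @ ?f (s # R))" using red R A f_id[OF sA2] by simp
        \<comment> \<open>Each letter of \<open>F\<close> adds a nonnegative multiple of its root to
          the difference of \<open>act F (sroot s)\<close> and \<open>sroot s\<close>. Positivity is
          tracked before and after applying \<open>A1\<close>; the neighbour sum at \<open>s\<close>
          reaches 1 with the first letter not commuting with \<open>s\<close> and never
          decreases.\<close>
        have "nonneg (\<lambda>r. act F (sroot s) r - sroot s r) \<and>
            nonneg (act A1 (\<lambda>r. act F (sroot s) r - sroot s r)) \<and>
            ((\<exists>t\<in>set F. m s t \<noteq> 2) \<longrightarrow> 1 \<le> nbsum s (\<lambda>r. act F (sroot s) r - sroot s r))"
          if "\<exists>G. A2 = F @ G" for F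
          using that
        proof (induction F rule: rev_induct)
          case Nil
          then show ?case using act_zero by (simp add: nonneg_def)
        next
          case (snoc t F)
          then obtain G where G: "A2 = F @ t # G" by auto
          have t: "t \<in> S" "t \<noteq> s" "s \<notin> set F" "set F \<subseteq> S" using G A2S sA2 by auto
          let ?\<mu> = "\<lambda>F r. act F (sroot s) r - sroot s r"
          have IHF: "nonneg (?\<mu> F)" "nonneg (act A1 (?\<mu> F))"
            "(\<exists>t\<in>set F. m s t \<noteq> 2) \<Longrightarrow> 1 \<le> nbsum s (?\<mu> F)"
            using snoc G by auto
          define \<beta> where "\<beta> = act F (sroot t)"
          have "act [t] (sroot s) = (\<lambda>r. 1 * sroot s r + bond t s * sroot t r)"
            using reflect_sroot_other[of s t] s t by simp
          then have eq: "?\<mu> (F @ [t]) = (\<lambda>r. ?\<mu> F r + bond t s * \<beta> r)"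
            unfolding act_append \<beta>_def by (simp only: act_linear) (simp add: fun_eq_iff)
          have b: "0 \<le> bond t s" using bond_nonneg s t by auto
          have r1: "redw ((?f A1 @ F @ [t]) @ G @ ?f (s # R))" using fv G by simp
          then have r2: "redw (?f A1 @ F @ [t])" by (rule redw_append)
          then have "redw (F @ [t])" by (rule redw_suffix) (use A2S t in auto)
          then have \<beta>: "nonneg \<beta>" by (simp add: redw_snoc \<beta>_def)
          have \<beta>1: "nonneg (act A1 \<beta>)" using IH2[of F t] r2 t by (simp add: \<beta>_def)
          have nbs: "nbsum s (?\<mu> (F @ [t])) = nbsum s (?\<mu> F) + bond t s * nbsum s \<beta>"
            unfolding eq using nbsum_linear[of s 1 "?\<mu> F" "bond t s" \<beta>] by simp
          have ge: "0 \<le> nbsum s (?\<mu> F)" "0 \<le> nbsum s \<beta>" using nbsum_nonneg[OF s] IHF \<beta> by auto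
          have "1 \<le> nbsum s (?\<mu> (F @ [t]))" if ex: "\<exists>t\<in>set (F @ [t]). m s t \<noteq> 2"
          proof (cases "\<exists>t\<in>set F. m s t \<noteq> 2")
            case True
            then show ?thesis unfolding nbs using IHF(3) b ge by (simp add: add_increasing2)
          next
            case False
            then have "nbsum s \<beta> = bond s t"
              unfolding \<beta>_def using nbsum_act_commuting[of F s] nbsum_sroot_other[of s t] s t by simp
            moreover have "3 \<le> m s t" using False ex m_neq_2_iff[of s t] s t by auto
            then have "1 \<le> bond s t" by (rule bond_ge_1)
            moreover have "bond t s = bond s t" using bond_sym s t by simp
            moreover have "1 \<le> bond s t * bond s t"
              using mult_mono[of 1 "bond s t" 1 "bond s t"] \<open>1 \<le> bond s t\<close> by simp
            ultimately show ?thesis unfolding nbs using ge by simp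
          qed
          then show ?case
            unfolding eq act_add
            using nonneg_add[OF IHF(1) \<beta> b] nonneg_add[OF IHF(2) \<beta>1 b] by (simp add: eq)
        qed
        from this[of A2] have \<mu>: "nonneg (act A1 (\<lambda>r. act A2 (sroot s) r - sroot s r))"
            "(\<exists>t\<in>set A2. m s t \<noteq> 2) \<Longrightarrow> 1 \<le> nbsum s (\<lambda>r. act A2 (sroot s) r - sroot s r)"
          by auto
        define \<mu> where "\<mu> = (\<lambda>r. act A2 (sroot s) r - sroot s r)"
        have "\<exists>t\<in>set A2. m s t \<noteq> 2" using nb[of A1 A2 R] R A sA2 by simp
        then have \<mu>1: "1 \<le> nbsum s \<mu>" using \<mu>(2) by (simp add: \<mu>_def)
        have z: "act A2 (sroot s) = (\<lambda>r. 1 * sroot s r + 1 * \<mu> r)" by (simp add: \<mu>_def)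
        have zs: "\<mu> s = 0" using act_unchanged[OF sA2] by (simp add: \<mu>_def)
        \<comment> \<open>As \<mu> has no coordinate at \<open>s\<close>, reflecting it adds
          \<open>nbsum s\<close> of it times the root of \<open>s\<close>; the -1 comes from the
          root of \<open>s\<close> itself.\<close>
        have "reflect s (act A2 (sroot s)) = (\<lambda>r. \<mu> r + (nbsum s \<mu> - 1) * sroot s r)"
          unfolding z reflect_linear reflect_sroot using zs
          by (auto simp: reflect_def fun_eq_iff sroot_def)
        then have "act A (sroot s) = act A1 (\<lambda>r. \<mu> r + (nbsum s \<mu> - 1) * sroot s r)"
          by (simp add: A)
        then show "nonneg (act A (sroot s))"
          using nonneg_add[of "act A1 \<mu>" "act A1 (sroot s)" "nbsum s \<mu> - 1"] \<mu>(1) A1s \<mu>1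
          by (simp add: act_add \<mu>_def)
      qed
    qed
  qed
  show ?thesis
    unfolding redw_def
  proof (intro allI impI)
    fix A e B assume eq: "v = A @ e # B"
    show "nonneg (act A (sroot e))"
    proof (cases "e = s")
      case True
      then show ?thesis using main[of A] eq by blast
    next
      case False
      have "redw ((?f A @ [e]) @ ?f B)" using red eq False by simp
      then have "redw (?f A @ [] @ [e])" using redw_append[of "?f A @ [e]" "?f B"] by simp
      then have "nonneg (act (A @ []) (sroot e))"
        using main[of A] eq False v by (metis (no_types, lifting) empty_iff empty_set empty_subsetI
            in_set_conv_decomp subsetD)
      then show ?thesis by simp
    qed
  qed
qed

text \<open>A reflection in a letter outside \<open>C\<close> fixes every vector supported on
  \<open>C\<close>: both the coordinate and the neighbour sum at that letter vanish.\<close>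

lemma act_filter:
  assumes "supported C x" "\<And>d b. d \<in> set A \<Longrightarrow> d \<notin> C \<Longrightarrow> b \<in> C \<Longrightarrow> m d b = 2"
  shows "act A x = act (filter (\<lambda>d. d \<in> C) A) x"
  using assms(2)
proof (induction A)
  case (Cons d A)
  let ?y = "act (filter (\<lambda>d. d \<in> C) A) x"
  have IH: "act A x = ?y" using Cons by simp
  have y: "supported C ?y" using assms(1) by (intro supported_act) auto
  show ?case
  proof (cases "d \<in> C")
    case False
    have "bond d t * ?y t = 0" for t
      using Cons.prems[of d t] False y bond_eq_0[of d t] by (cases "t \<in> C") (auto simp: supported_def)
    then have "nbsum d ?y = 0" unfolding nbsum_def by (intro sum.neutral) blast
    moreover have "?y d = 0" using y False by (simp add: supported_def)
    ultimately have "reflect d ?y = ?y" by (simp add: reflect_def fun_upd_idem)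
    then show ?thesis using False IH by simp
  qed (simp add: IH)
qed simp

lemma redw_components:
  assumes "\<And>e. e \<in> set v \<Longrightarrow> \<exists>C. e \<in> C \<and> redw (filter (\<lambda>d. d \<in> C) v) \<and>
    (\<forall>d\<in>set v - C. \<forall>b\<in>C. m d b = 2)"
  shows "redw v"
  unfolding redw_def
proof (intro allI impI)
  fix A e B assume v: "v = A @ e # B"
  then obtain C where C: "e \<in> C" "redw (filter (\<lambda>d. d \<in> C) v)" "\<forall>d\<in>set v - C. \<forall>b\<in>C. m d b = 2"
    using assms[of e] by auto
  have "nonneg (act (filter (\<lambda>d. d \<in> C) A) (sroot e))"
    using C(2) v C(1) by (auto simp: redw_def)
  then show "nonneg (act A (sroot e))"
    using act_filter[OF supported_sroot[OF C(1)], of A] C(3) v by simp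
qed

end

section \<open>Powers of Coxeter elements\<close>

context coxeter_data begin

section \<open>Roots of parabolic subsystems\<close>

definition roots :: "'a set \<Rightarrow> ('a \<Rightarrow> real) set" where
  "roots L = {act A (sroot e) | A e. A \<in> lists L \<and> e \<in> L}"

lemma roots_mono: "K \<subseteq> L \<Longrightarrow> roots K \<subseteq> roots L"
  unfolding roots_def using lists_mono by blast

lemma sroot_in_roots: "e \<in> L \<Longrightarrow> sroot e \<in> roots L"
  unfolding roots_def by (intro CollectI exI[of _ "[]"] exI[of _ e]) simp

lemma act_in_roots:
  assumes "\<gamma> \<in> roots L" "v \<in> lists L"
  shows "act v \<gamma> \<in> roots L"
proof -
  obtain A e where "\<gamma> = act A (sroot e)" "A \<in> lists L" "e \<in> L"
    using assms(1) by (auto simp: roots_def)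
  then show ?thesis
    unfolding roots_def using assms(2) by (intro CollectI exI[of _ "v @ A"] exI[of _ e]) simp
qed

lemma roots_supported: "\<gamma> \<in> roots L \<Longrightarrow> supported L \<gamma>"
  unfolding roots_def by (auto intro!: supported_act supported_sroot)

lemma roots_nonzero: "\<gamma> \<in> roots L \<Longrightarrow> \<gamma> \<noteq> (\<lambda>_. 0)"
  by (auto simp: roots_def act_sroot_nonzero)

lemma roots_dichotomy: "L \<subseteq> S \<Longrightarrow> \<gamma> \<in> roots L \<Longrightarrow> nonneg \<gamma> \<or> nonpos \<gamma>"
  using root_dichotomy by (auto simp: roots_def)


section \<open>The invariant quadratic form\<close>

definition quad :: "('a \<Rightarrow> real) \<Rightarrow> real" where
  "quad x = (\<Sum>r\<in>S. x r * (2 * x r - nbsum r x))"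

text \<open>As a polynomial in X = \<open>x s\<close> the form is 2 X^2 - 2 X nbsum plus a term free
  of X, hence symmetric under X -> nbsum - X, which is the reflection.\<close>

lemma quad_split:
  assumes s: "s \<in> S"
  shows "quad x = 2 * (x s)\<^sup>2 - 2 * x s * nbsum s x +
    (\<Sum>r\<in>S - {s}. x r * (2 * x r - (\<Sum>t\<in>S - {r, s}. bond r t * x t)))"
proof -
  have nb: "nbsum r x = bond s r * x s + (\<Sum>t\<in>S - {r, s}. bond r t * x t)" if "r \<in> S - {s}" for r
  proof -
    have *: "S - {r} = insert s (S - {r, s})" using s that by auto
    show ?thesis unfolding nbsum_def * using finite_S s that
      by (subst sum.insert) (auto simp: bond_sym)
  qed
  have "quad x = x s * (2 * x s - nbsum s x) + (\<Sum>r\<in>S - {s}. x r * (2 * x r - nbsum r x))"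
    unfolding quad_def using sum.remove[OF finite_S s] by simp
  also have "(\<Sum>r\<in>S - {s}. x r * (2 * x r - nbsum r x)) =
      (\<Sum>r\<in>S - {s}. x r * (2 * x r - (\<Sum>t\<in>S - {r, s}. bond r t * x t)) - x s * (bond s r * x r))"
    by (rule sum.cong) (simp_all add: nb algebra_simps)
  also have "\<dots> = (\<Sum>r\<in>S - {s}. x r * (2 * x r - (\<Sum>t\<in>S - {r, s}. bond r t * x t)))
      - x s * nbsum s x"
    unfolding sum_subtractf nbsum_def sum_distrib_left ..
  finally show ?thesis by (simp add: power2_eq_square algebra_simps)
qed

lemma quad_reflect:
  assumes s: "s \<in> S"
  shows "quad (reflect s x) = quad x"
proof -
  let ?R = "\<lambda>x. \<Sum>r\<in>S - {s}. x r * (2 * x r - (\<Sum>t\<in>S - {r, s}. bond r t * x t))"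
  have R: "?R (reflect s x) = ?R x"
    by (auto simp: reflect_def intro!: sum.cong)
  have s': "nbsum s (reflect s x) = nbsum s x" "reflect s x s = nbsum s x - x s"
    by (simp_all add: reflect_def nbsum_upd)
  have "quad (reflect s x) =
      2 * (nbsum s x - x s)\<^sup>2 - 2 * (nbsum s x - x s) * nbsum s x + ?R x"
    unfolding quad_split[OF s, of "reflect s x"] R s' ..
  moreover have "quad x = 2 * (x s)\<^sup>2 - 2 * x s * nbsum s x + ?R x" by (rule quad_split[OF s])
  moreover have "2 * (nbsum s x - x s)\<^sup>2 - 2 * (nbsum s x - x s) * nbsum s x =
      2 * (x s)\<^sup>2 - 2 * x s * nbsum s x"
    by (simp add: power2_eq_square algebra_simps)
  ultimately show ?thesis by simp
qed

lemma quad_sroot: "e \<in> S \<Longrightarrow> quad (sroot e) = 2"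
  unfolding quad_split[of e] by (simp add: nbsum_sroot) (simp add: sroot_def)

lemma quad_act: "set v \<subseteq> S \<Longrightarrow> quad (act v x) = quad x"
  by (induction v) (auto simp: quad_reflect)

lemma quad_scale: "quad (\<lambda>t. c * x t) = c\<^sup>2 * quad x"
proof -
  have "nbsum r (\<lambda>t. c * x t) = c * nbsum r x" for r
    using nbsum_linear[of r c x 0 x] by simp
  then show ?thesis
    by (simp add: quad_def sum_distrib_left power2_eq_square algebra_simps)
qed

text \<open>Only the coordinate at \<open>d\<close> can change sign, so \<gamma> is a multiple of
  the simple root; the invariant form, equal to 2 on every root, makes the multiple 1.\<close>

lemma root_sign_change:
  assumes \<gamma>: "\<gamma> \<in> roots S" "nonneg \<gamma>" and d: "d \<in> S" "nonpos (reflect d \<gamma>)"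
  shows "\<gamma> = sroot d"
proof -
  have "\<gamma> t = 0" if "t \<noteq> d" for t
  proof -
    have "reflect d \<gamma> t = \<gamma> t" using that by (simp add: reflect_def)
    then show ?thesis using \<gamma>(2) d(2) unfolding nonneg_def nonpos_def by (metis order_antisym)
  qed
  then have eq: "\<gamma> = (\<lambda>t. \<gamma> d * sroot d t)" by (auto simp: sroot_def)
  obtain A e where "\<gamma> = act A (sroot e)" "A \<in> lists S" "e \<in> S"
    using \<gamma>(1) by (auto simp: roots_def)
  moreover from this have "set A \<subseteq> S" by auto
  ultimately have "quad \<gamma> = 2" by (simp add: quad_act quad_sroot)
  moreover have "quad \<gamma> = (\<gamma> d)\<^sup>2 * 2" by (subst eq) (simp add: quad_scale quad_sroot d)
  ultimately have "(\<gamma> d)\<^sup>2 = 1" by simp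
  then have "\<gamma> d = 1" using \<gamma>(2) by (simp add: nonneg_def power2_eq_1_iff) (metis neg_0_le_iff_le not_one_le_zero)
  then show ?thesis using eq by simp
qed

text \<open>A new first letter \<open>e\<close> contributes at most its simple root besides the
  reflected images of the inversions already counted.\<close>

lemma finite_inversions:
  "set x \<subseteq> S \<Longrightarrow> finite {\<gamma> \<in> roots S. nonneg \<gamma> \<and> nonpos (act (rev x) \<gamma>)}"
proof (induction x)
  case Nil
  have "{\<gamma> \<in> roots S. nonneg \<gamma> \<and> nonpos (act (rev []) \<gamma>)} = {}"
    using nonneg_nonpos roots_nonzero by auto
  then show ?case by (simp only: finite.emptyI)
next
  case (Cons e x)
  have "{\<gamma> \<in> roots S. nonneg \<gamma> \<and> nonpos (act (rev (e # x)) \<gamma>)} \<subseteq>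
      insert (sroot e) (reflect e ` {\<gamma> \<in> roots S. nonneg \<gamma> \<and> nonpos (act (rev x) \<gamma>)})"
  proof
    fix \<gamma> assume "\<gamma> \<in> {\<gamma> \<in> roots S. nonneg \<gamma> \<and> nonpos (act (rev (e # x)) \<gamma>)}"
    then have \<gamma>: "\<gamma> \<in> roots S" "nonneg \<gamma>" "nonpos (act (rev x) (reflect e \<gamma>))" by auto
    have r: "reflect e \<gamma> \<in> roots S" using act_in_roots[OF \<gamma>(1), of "[e]"] Cons.prems by simp
    show "\<gamma> \<in> insert (sroot e) (reflect e ` {\<gamma> \<in> roots S. nonneg \<gamma> \<and> nonpos (act (rev x) \<gamma>)})"
    proof (cases "nonneg (reflect e \<gamma>)")
      case True
      then show ?thesis using r \<gamma>(3) by (auto intro!: image_eqI[of _ _ "reflect e \<gamma>"])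
    next
      case False
      then show ?thesis using roots_dichotomy[OF _ r] root_sign_change[OF \<gamma>(1,2)] Cons.prems by auto
    qed
  qed
  then show ?case using Cons finite_subset by fastforce
qed


section \<open>Roots of parabolic subgroups of unbounded length\<close>

definition unbounded :: "'a set \<Rightarrow> bool" where
  "unbounded L \<longleftrightarrow> (\<forall>n. \<exists>v. minw L v \<and> n \<le> length v)"

lemma act_expand:
  assumes "finite D" "supported D y"
  shows "act z y = (\<lambda>t. \<Sum>d\<in>D. y d * act z (sroot d) t)"
  using assms
proof (induction D arbitrary: y)
  case empty
  then have "y = (\<lambda>_. 0)" by (auto simp: supported_def)
  then show ?case by (simp add: act_zero)
next
  case (insert d D)
  have y: "y = (\<lambda>t. (y(d := 0)) t + y d * sroot d t)" by (auto simp: sroot_def)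
  have "supported D (y(d := 0))" using insert.prems by (auto simp: supported_def)
  then have IH: "act z (y(d := 0)) = (\<lambda>t. \<Sum>e\<in>D. (y(d := 0)) e * act z (sroot e) t)"
    by (rule insert.IH)
  have "(\<Sum>e\<in>D. (y(d := 0)) e * act z (sroot e) t) = (\<Sum>e\<in>D. y e * act z (sroot e) t)" for t
    by (rule sum.cong) (use insert.hyps in auto)
  then show ?case
    using insert.hyps by (subst y, subst act_add, subst IH) (simp add: add.commute)
qed

lemma nonneg_act_supported:
  assumes "finite D" "supported D y" "nonneg y" "\<And>d. d \<in> D \<Longrightarrow> nonneg (act z (sroot d))"
  shows "nonneg (act z y)"
  unfolding act_expand[OF assms(1,2)] nonneg_def
  using assms(3,4) by (auto simp: nonneg_def intro!: sum_nonneg)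

text \<open>The minimal coset representatives of a bounded parabolic subgroup are arbitrarily long, and
  none of their inversions is supported off \<open>b\<close>.\<close>

lemma infinite_roots_through:
  assumes K: "K \<subseteq> S" and b: "b \<in> K" and unb: "unbounded K" and bd: "\<not> unbounded (K - {b})"
  shows "infinite {\<gamma> \<in> roots K. nonneg \<gamma> \<and> \<gamma> b \<noteq> 0}"
proof
  let ?F = "{\<gamma> \<in> roots K. nonneg \<gamma> \<and> \<gamma> b \<noteq> 0}"
  let ?D = "K - {b}"
  assume fin: "finite ?F"
  obtain M where M: "\<And>v. minw ?D v \<Longrightarrow> length v < M"
    using bd unfolding unbounded_def by (auto simp: not_le)
  \<comment> \<open>The factor over \<open>?D\<close> will have fewer than \<open>M\<close> letters,
    so more than \<open>card ?F\<close> letters remain in \<open>z\<close>, each giving its own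
    inversion.\<close>
  obtain v0 where v0: "minw K v0" "M + card ?F + 1 \<le> length v0"
    using unb unfolding unbounded_def by blast
  obtain z a where za: "a \<in> lists ?D" "eqw K (z @ a) (rev v0)" "length z + length a = length v0"
    and z: "\<And>d. d \<in> ?D \<Longrightarrow> minw K (z @ [d])"
    using parabolic_decomposition[OF K minw_rev[OF K v0(1)], of ?D] by auto
  have mza: "minw K (z @ a)" using minw_eqw[OF minw_rev[OF K v0(1)] za(2)] za(3) by simp
  then have "redw a" using minw_suffix minw_iff_redw[OF K] minw_lists by blast
  then have "minw ?D a" using minw_iff_redw[of ?D a] za(1) K by auto
  then have lz: "card ?F < length z" using M[of a] v0(2) za(3) by simp
  have mz: "minw K z" using minw_prefix[OF mza] .
  then have zK: "z \<in> lists K" by (rule minw_lists)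
  define x where "x = rev z"
  have mx: "minw K x" using minw_rev[OF K mz] by (simp add: x_def)
  have xK: "set x \<subseteq> K" using zK by (auto simp: x_def)
  define \<beta> where "\<beta> i = act (take i x) (sroot (x ! i))" for i
  have dec: "x = take i x @ x ! i # drop (Suc i) x" if "i < length x" for i
    using that by (simp add: id_take_nth_drop)
  have xi: "x ! i \<in> K" if "i < length x" for i using xK that by auto
  have "\<beta> i \<in> ?F" if i: "i < length x" for i
  proof -
    have r: "\<beta> i \<in> roots K"
      unfolding \<beta>_def by (rule act_in_roots) (use sroot_in_roots[OF xi[OF i]] xK in \<open>auto dest: in_set_takeD\<close>)
    have "redw x" using mx minw_iff_redw[OF K] minw_lists by blast
    then have nn: "nonneg (\<beta> i)" unfolding redw_def \<beta>_def using dec[OF i] by blast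
    \<comment> \<open>An inversion vanishing at \<open>b\<close> would be a nonnegative combination
      of simple roots that \<open>z\<close> keeps positive, whereas \<open>z\<close> sends it to a
      negative root.\<close>
    have "\<beta> i b \<noteq> 0"
    proof
      assume 0: "\<beta> i b = 0"
      have "supported ?D (\<beta> i)" using roots_supported[OF r] 0 by (auto simp: supported_def)
      then have "nonneg (act z (\<beta> i))"
        using nonneg_act_supported[of ?D "\<beta> i" z] finite_subset[OF K finite_S] nn z minw_nonneg[OF K]
        by blast
      moreover have "act z (\<beta> i) = (\<lambda>t. - act (rev (drop (Suc i) x)) (sroot (x ! i)) t)"
      proof -
        have "z = rev (take i x @ x ! i # drop (Suc i) x)" using dec[OF i] by (simp add: x_def)
        then have "z = rev (drop (Suc i) x) @ [x ! i] @ rev (take i x)" by simp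
        then have "act z (\<beta> i) = act (rev (drop (Suc i) x)) (reflect (x ! i) (sroot (x ! i)))"
          by (simp add: \<beta>_def)
        then show ?thesis by (simp add: reflect_sroot act_uminus)
      qed
      moreover have "minw K (rev (drop (Suc i) x) @ [x ! i])"
      proof -
        have "z = rev (take i x @ x ! i # drop (Suc i) x)" using dec[OF i] by (simp add: x_def)
        then have "z = (rev (drop (Suc i) x) @ [x ! i]) @ rev (take i x)" by simp
        then show ?thesis using mz minw_prefix by metis
      qed
      then have "nonneg (act (rev (drop (Suc i) x)) (sroot (x ! i)))" by (rule minw_nonneg[OF K])
      ultimately show False
        using not_nonneg_nonpos by (simp add: nonneg_uminus)
    qed
    then show ?thesis using r nn by simp
  qed
  then have sub: "\<beta> ` {..<length x} \<subseteq> ?F" by auto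
  have "inj_on \<beta> {..<length x}"
  proof (rule linorder_inj_onI')
    fix i j assume ij: "i \<in> {..<length x}" "j \<in> {..<length x}" "i < j"
    show "\<beta> i \<noteq> \<beta> j"
    proof
      assume eq: "\<beta> i = \<beta> j"
      \<comment> \<open>If two inversions agreed, the factor \<open>B\<close> between the two
        letters would send the simple root of the second to minus that of the first, although
        \<open>B @ [x ! j]\<close> is minimal.\<close>
      define B where "B = drop (Suc i) (take j x)"
      have tj: "take j x = take i x @ x ! i # B"
        using id_take_nth_drop[of i "take j x"] ij by (simp add: B_def min_def)
      have xj: "x = (take i x @ [x ! i]) @ (B @ [x ! j]) @ drop (Suc j) x"
        using dec[of j] ij tj by simp
      have "act (take i x) (sroot (x ! i)) = act (take i x) (reflect (x ! i) (act B (sroot (x ! j))))"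
        using eq tj by (simp add: \<beta>_def)
      then have "sroot (x ! i) = reflect (x ! i) (act B (sroot (x ! j)))" by (metis act_rev_act)
      then have "reflect (x ! i) (sroot (x ! i)) = act B (sroot (x ! j))" by (metis reflect_reflect)
      then have neg: "(\<lambda>t. - sroot (x ! i) t) = act B (sroot (x ! j))" by (simp only: reflect_sroot)
      have "minw K (B @ [x ! j])" using minw_factor[of K _ "B @ [x ! j]"] mx xj by metis
      then have "nonneg (act B (sroot (x ! j)))" by (rule minw_nonneg[OF K])
      then have "nonneg (\<lambda>t. - sroot (x ! i) t)" by (simp only: neg)
      then show False
        using nonneg_sroot[of "x ! i"] not_nonneg_nonpos[of "[]" "x ! i"] by (simp add: nonneg_uminus)
    qed
  qed
  then have "length x \<le> card ?F" using card_inj_on_le[OF _ sub fin] by simp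
  then show False using lz by (simp add: x_def)
qed

text \<open>Connectedness is phrased by closed subsets because it is applied to properties that
  spread along edges.\<close>

definition cox_connected :: "'a set \<Rightarrow> bool" where
  "cox_connected C \<longleftrightarrow> (\<forall>T. T \<subseteq> C \<longrightarrow> T \<noteq> {} \<longrightarrow> (\<forall>x\<in>T. \<forall>y\<in>C. m x y \<noteq> 2 \<longrightarrow> y \<in> T) \<longrightarrow> T = C)"

lemma not_unbounded_empty: "\<not> unbounded {}"
proof
  assume "unbounded {}"
  then obtain v where "minw {} v" "1 \<le> length v" unfolding unbounded_def by blast
  then show False using minw_lists[of "{}" v] by simp
qed

text \<open>A smallest unbounded subset becomes bounded when a vertex is deleted, so
  \<open>infinite_roots_through\<close> provides one vertex. The property spreads along an edge from
  \<open>x\<close> to \<open>y\<close>: reflecting in \<open>y\<close> sends a positive root through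
  \<open>x\<close> that avoids \<open>y\<close> to a positive root through \<open>y\<close>.\<close>

lemma infinite_roots_at:
  assumes C: "C \<subseteq> S" and conn: "cox_connected C" and unb: "unbounded C" and b: "b \<in> C"
  shows "infinite {\<gamma> \<in> roots C. nonneg \<gamma> \<and> \<gamma> b \<noteq> 0}"
proof -
  let ?P = "\<lambda>b. {\<gamma> \<in> roots C. nonneg \<gamma> \<and> \<gamma> b \<noteq> 0}"
  define T where "T = {b \<in> C. infinite (?P b)}"
  have finC: "finite C" using C finite_S finite_subset by blast
  obtain K where K: "K \<subseteq> C" "unbounded K" "\<And>K'. K' \<subseteq> C \<Longrightarrow> unbounded K' \<Longrightarrow> card K \<le> card K'"
    using ex_has_least_nat[of "\<lambda>K. K \<subseteq> C \<and> unbounded K" C card] unb by blast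
  obtain j where j: "j \<in> K" using K(2) not_unbounded_empty by (cases "K = {}") auto
  have "card (K - {j}) < card K" using j finite_subset[OF K(1) finC] by (intro psubset_card_mono) auto
  then have "\<not> unbounded (K - {j})" using K(1) K(3)[of "K - {j}"] by auto
  then have "infinite {\<gamma> \<in> roots K. nonneg \<gamma> \<and> \<gamma> j \<noteq> 0}"
    using infinite_roots_through[of K j] K j C by auto
  moreover have "{\<gamma> \<in> roots K. nonneg \<gamma> \<and> \<gamma> j \<noteq> 0} \<subseteq> ?P j" using roots_mono[OF K(1)] by auto
  ultimately have "infinite (?P j)" using finite_subset[of _ "?P j"] by blast
  then have ne: "T \<noteq> {}" using j K(1) by (auto simp: T_def)
  have "y \<in> T" if x: "x \<in> T" and y: "y \<in> C" "m x y \<noteq> 2" for x y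
  proof (cases "x = y")
    case False
    have xC: "x \<in> C" "infinite (?P x)" using x by (auto simp: T_def)
    have xy: "x \<in> S" "y \<in> S" using xC y C by auto
    have "infinite (?P y)"
    proof
      assume fin: "finite (?P y)"
      let ?Q = "{\<gamma> \<in> roots C. nonneg \<gamma> \<and> \<gamma> x \<noteq> 0 \<and> \<gamma> y = 0}"
      have sub: "?P x \<subseteq> ?Q \<union> ?P y" by auto
      have "infinite ?Q"
      proof
        assume "finite ?Q"
        then have "finite (?Q \<union> ?P y)" using fin by (rule finite_UnI)
        then show False using finite_subset[OF sub] xC(2) by blast
      qed
      moreover have "inj_on (reflect y) ?Q" by (rule inj_onI) (metis reflect_reflect)
      ultimately have "infinite (reflect y ` ?Q)" by (simp add: finite_image_iff)
      moreover have "reflect y ` ?Q \<subseteq> ?P y"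
      proof
        fix \<delta> assume "\<delta> \<in> reflect y ` ?Q"
        then obtain \<gamma> where \<gamma>: "\<gamma> \<in> roots C" "nonneg \<gamma>" "\<gamma> x \<noteq> 0" "\<gamma> y = 0" "\<delta> = reflect y \<gamma>" by auto
        have "3 \<le> m y x" using m_neq_2_iff[of x y] y(2) False xy m_sym by simp
        then have "1 \<le> bond y x" by (rule bond_ge_1)
        moreover have "0 < \<gamma> x" using \<gamma> by (auto simp: nonneg_def less_le)
        ultimately have "0 < bond y x * \<gamma> x" by simp
        also have "\<dots> \<le> nbsum y \<gamma>"
          unfolding nbsum_def
          by (rule member_le_sum) (use xy False finite_S \<gamma>(2) in \<open>auto simp: nonneg_def intro!: mult_nonneg_nonneg bond_nonneg\<close>)
        finally have "0 < nbsum y \<gamma>" .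
        then have "nonneg \<delta>" "\<delta> y \<noteq> 0" using \<gamma> by (auto simp: reflect_def nonneg_def)
        moreover have "\<delta> \<in> roots C" using act_in_roots[OF \<gamma>(1), of "[y]"] y \<gamma>(5) by simp
        ultimately show "\<delta> \<in> ?P y" by simp
      qed
      ultimately show False using finite_subset[OF _ fin, of "reflect y ` ?Q"] by blast
    qed
    then show ?thesis using y by (simp add: T_def)
  qed (use x in simp)
  moreover have "T \<subseteq> C" by (auto simp: T_def)
  ultimately have "T = C" using conn[unfolded cox_connected_def, rule_format, of T] ne by blast
  then show ?thesis using b by (auto simp: T_def)
qed

lemma not_unbounded_singleton:
  assumes "b \<in> S"
  shows "\<not> unbounded {b}"
proof
  assume "unbounded {b}"
  then obtain v where v: "minw {b} v" "2 \<le> length v" unfolding unbounded_def by blast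
  then obtain c d u where "v = c # d # u" by (cases v; cases "tl v") auto
  moreover have "c = b" "d = b" using minw_lists[OF v(1)] calculation by auto
  ultimately show False using not_minw_square[of "{b}" "[]" b u] v assms by simp
qed


text \<open>Speyer's skew-symmetric form attached to a Coxeter element: it is carried along when the
  first letter moves to the end.\<close>

fun skew :: "'a list \<Rightarrow> ('a \<Rightarrow> real) \<Rightarrow> ('a \<Rightarrow> real) \<Rightarrow> real" where
  "skew [] x y = 0"
| "skew (d # c) x y = (\<Sum>t\<in>set c. bond d t * (x d * y t - x t * y d)) + skew c x y"

lemma skew_cong:
  "(\<And>t. t \<in> set c \<Longrightarrow> x t = x' t \<and> y t = y' t) \<Longrightarrow> skew c x y = skew c x' y'"
proof (induction c)
  case (Cons d c)
  have "skew c x y = skew c x' y'" using Cons by simp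
  moreover have "(\<Sum>t\<in>set c. bond d t * (x d * y t - x t * y d)) =
      (\<Sum>t\<in>set c. bond d t * (x' d * y' t - x' t * y' d))"
    using Cons.prems by (intro sum.cong) auto
  ultimately show ?case by simp
qed simp

lemma skew_snoc:
  "distinct (c @ [d]) \<Longrightarrow>
    skew (c @ [d]) x y = skew c x y + (\<Sum>t\<in>set c. bond t d * (x t * y d - x d * y t))"
  by (induction c) (auto simp: algebra_simps)

text \<open>Pairing with the simple root of the first letter leaves only a neighbour sum, which is
  nonnegative on nonnegative vectors. This sign is used at both ends of the argument in
  \<open>coxeter_powers_redw\<close>.\<close>

lemma skew_sroot:
  assumes "d \<notin> set c"
  shows "skew (d # c) (sroot d) y = (\<Sum>t\<in>set c. bond d t * y t)"
proof -
  have "skew c (sroot d) y = skew c (\<lambda>_. 0) y"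
    by (rule skew_cong) (use assms in \<open>auto simp: sroot_def\<close>)
  moreover have "skew c (\<lambda>_. 0) y = 0" for c by (induction c) auto
  moreover have "(\<Sum>t\<in>set c. bond d t * (sroot d d * y t - sroot d t * y d)) = (\<Sum>t\<in>set c. bond d t * y t)"
    by (rule sum.cong) (use assms in \<open>auto simp: sroot_def\<close>)
  ultimately show ?thesis by simp
qed

lemma nbsum_supported:
  assumes "d \<notin> set c" "set (d # c) \<subseteq> S" "supported (set (d # c)) x"
  shows "nbsum d x = (\<Sum>t\<in>set c. bond d t * x t)"
  unfolding nbsum_def
  by (rule sum.mono_neutral_right) (use assms finite_S in \<open>auto simp: supported_def\<close>)

text \<open>Reflecting replaces the coordinates at \<open>d\<close> by \<open>?X - x d\<close> and
  \<open>?Y - y d\<close>. The products \<open>?X * ?Y\<close> cancel by skew-symmetry, and what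
  remains are the terms of \<open>d\<close> in last place.\<close>

lemma skew_reflect:
  assumes dist: "distinct (d # c)" and S: "set (d # c) \<subseteq> S"
    and x: "supported (set (d # c)) x" and y: "supported (set (d # c)) y"
  shows "skew (d # c) (reflect d x) (reflect d y) = skew (c @ [d]) x y"
proof -
  have dc: "d \<notin> set c" using dist by simp
  let ?X = "\<Sum>t\<in>set c. bond d t * x t" and ?Y = "\<Sum>t\<in>set c. bond d t * y t"
  have nX: "nbsum d x = ?X" and nY: "nbsum d y = ?Y"
    using nbsum_supported[OF dc S] x y by auto
  have "skew c (reflect d x) (reflect d y) = skew c x y"
    by (rule skew_cong) (use dc in \<open>auto simp: reflect_def\<close>)
  moreover have "(\<Sum>t\<in>set c. bond d t * (reflect d x d * reflect d y t - reflect d x t * reflect d y d)) =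
      (\<Sum>t\<in>set c. (?X - x d) * (bond d t * y t) - (?Y - y d) * (bond d t * x t))"
    by (rule sum.cong) (use dc nX nY in \<open>auto simp: reflect_def algebra_simps\<close>)
  moreover have "\<dots> = (?X - x d) * ?Y - (?Y - y d) * ?X"
    by (simp only: sum_subtractf sum_distrib_left)
  moreover have "(\<Sum>t\<in>set c. bond t d * (x t * y d - x d * y t)) =
      (\<Sum>t\<in>set c. y d * (bond d t * x t) - x d * (bond d t * y t))"
    by (rule sum.cong) (use S in \<open>auto simp: bond_sym[of d] algebra_simps\<close>)
  moreover have "\<dots> = y d * ?X - x d * ?Y"
    by (simp only: sum_subtractf sum_distrib_left)
  moreover have "skew (c @ [d]) x y = skew c x y + (\<Sum>t\<in>set c. bond t d * (x t * y d - x d * y t))"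
    using dist by (intro skew_snoc) auto
  ultimately show ?thesis by (simp add: algebra_simps)
qed

lemma coxeter_powers_redw:
  fixes w :: "nat \<Rightarrow> 'a"
  assumes C: "C \<subseteq> S" and conn: "cox_connected C" and unb: "unbounded C"
    and window: "\<And>i. distinct (map w [i..<i + n])" "\<And>i. set (map w [i..<i + n]) = C"
    and period: "\<And>i. w (i + n) = w i"
  shows "redw (map w [0..<N])"
proof (induction N)
  case 0
  then show ?case by (simp add: redw_def)
next
  case (Suc N)
  let ?W = "\<lambda>i. map w [i..<i + n]"
  have n: "0 < n"
    using window(2)[of 0] unb not_unbounded_empty by (cases n) auto
  have wC: "w i \<in> C" for i using window(2)[of i] n by (force simp: image_iff)
  have wS: "w i \<in> S" for i using wC[of i] C by blast
  have Wc: "?W i = w i # map w [Suc i..<i + n]" for i using n by (simp add: upt_conv_Cons)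
  have Ws: "?W (Suc i) = map w [Suc i..<i + n] @ [w i]" for i
    using n period[of i] by simp
  have shift: "skew (?W i) (reflect (w i) x) (reflect (w i) y) = skew (?W (Suc i)) x y"
    if "supported C x" "supported C y" for i x y
  proof -
    have wd: "distinct (w i # map w [Suc i..<i + n])" "set (w i # map w [Suc i..<i + n]) = C"
      using window[of i] unfolding Wc by blast+
    show ?thesis
      unfolding Wc[of i] Ws by (rule skew_reflect) (use wd C that in \<open>simp_all only: wd\<close>)
  qed
  have inv: "skew (?W k) (act (map w [k..<j]) x) (act (map w [k..<j]) y) = skew (?W j) x y"
    if "k \<le> j" "supported C x" "supported C y" for k j x y
    using that(1)
  proof (induction k rule: inc_induct)
    case (step i)
    have "map w [i..<j] = w i # map w [Suc i..<j]" using step by (simp add: upt_conv_Cons)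
    moreover have "supported C (act (map w [Suc i..<j]) x)" "supported C (act (map w [Suc i..<j]) y)"
      using that wC by (auto intro!: supported_act)
    ultimately show ?case using shift[of "act (map w [Suc i..<j]) x" "act (map w [Suc i..<j]) y" i] step.IH
      by simp
  qed simp
  have first: "skew (?W i) (sroot (w i)) y = (\<Sum>t\<in>C - {w i}. bond (w i) t * y t)" for i y
  proof -
    have "d \<notin> set c \<and> set c = C - {d}" if "distinct (d # c)" "set (d # c) = C" for d c
      using that by auto
    from this[OF window(1)[of i, unfolded Wc] window(2)[of i, unfolded Wc]]
    show ?thesis unfolding Wc using skew_sroot[of "w i" "map w [Suc i..<i + n]" y] by metis
  qed
  let ?e = "w N"
  let ?y = "\<lambda>k. act (map w [k..<N]) (sroot ?e)"
  have yr: "?y k \<in> roots S" for k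
    by (intro act_in_roots sroot_in_roots) (auto simp: wS)
  have "nonneg (?y 0)"
  proof (rule ccontr)
    assume "\<not> nonneg (?y 0)"
    then have np: "nonpos (?y 0)" using roots_dichotomy[OF _ yr[of 0]] by blast
    have "\<not> nonpos (?y N)" using not_nonneg_nonpos[of "[]" ?e] nonneg_sroot by auto
    \<comment> \<open>Followed backwards from \<open>N\<close>, the root of the new letter starts
      positive and ends negative. Where its sign changes it is the simple root of the letter applied
      there.\<close>
    then obtain k where k: "k < N" "nonpos (?y k)" "\<not> nonpos (?y (Suc k))"
    proof -
      have "\<exists>k<N. nonpos (?y k) \<and> \<not> nonpos (?y (Suc k))"
      proof (rule ccontr)
        assume *: "\<not> ?thesis"
        have "k \<le> N \<Longrightarrow> nonpos (?y k)" for k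
          by (induction k) (use np * in auto)
        then show False using \<open>\<not> nonpos (?y N)\<close> by blast
      qed
      then show ?thesis using that by blast
    qed
    let ?d = "w k"
    have yk: "?y k = reflect ?d (?y (Suc k))" using k(1) by (simp add: upt_conv_Cons)
    have "?y (Suc k) = sroot ?d"
      by (rule root_sign_change) (use yr k yk roots_dichotomy[OF _ yr] wC C in auto)
    then have yk': "?y k = (\<lambda>t. - sroot ?d t)" unfolding yk by (simp add: reflect_sroot)
    have "\<exists>b\<in>C. b \<noteq> ?d \<and> m ?d b \<noteq> 2"
    proof (rule ccontr)
      assume "\<not> ?thesis"
      then have "{?d} = C"
        using conn[unfolded cox_connected_def, rule_format, of "{?d}"] wC[of k] by blast
      then show False using unb not_unbounded_singleton[of ?d] wC[of k] C by auto
    qed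
    then obtain b where b: "b \<in> C" "b \<noteq> ?d" "m ?d b \<noteq> 2" by blast
    have dS: "?d \<in> S" "b \<in> S" using wC C b by auto
    have "1 \<le> bond ?d b" using bond_ge_1 m_neq_2_iff[of ?d b] b dS by auto
    define x where "x = map w [k..<N]"
    have xC: "set x \<subseteq> C" using wC by (auto simp: x_def)
    \<comment> \<open>If the inverse of \<open>x\<close> kept such a \<gamma> positive, the form of
      the window at \<open>N\<close> would pair \<open>?e\<close> with the image to a nonnegative
      number. Carried back to \<open>k\<close>, this number is minus the neighbour sum of \<gamma>
      at \<open>?d\<close>, which is negative because \<open>b\<close> is a neighbour of
      \<open>?d\<close>.\<close>
    have "{\<gamma> \<in> roots C. nonneg \<gamma> \<and> \<gamma> b \<noteq> 0} \<subseteq> {\<gamma> \<in> roots S. nonneg \<gamma> \<and> nonpos (act (rev x) \<gamma>)}"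
    proof
      fix \<gamma> assume "\<gamma> \<in> {\<gamma> \<in> roots C. nonneg \<gamma> \<and> \<gamma> b \<noteq> 0}"
      then have \<gamma>: "\<gamma> \<in> roots C" "nonneg \<gamma>" "\<gamma> b \<noteq> 0" by auto
      let ?g = "act (rev x) \<gamma>"
      have g: "?g \<in> roots C" using xC by (intro act_in_roots \<gamma>) auto
      have "nonpos ?g"
      proof (rule ccontr)
        assume "\<not> nonpos ?g"
        then have gn: "nonneg ?g" using roots_dichotomy[OF C g] by blast
        have bn: "0 \<le> bond (w i) t * y t" if "t \<in> C - {w i}" "nonneg y" for i t y
          using that bond_nonneg[of "w i" t] wS[of i] C
          by (intro mult_nonneg_nonneg) (auto simp: nonneg_def)
        have "0 \<le> skew (?W N) (sroot ?e) ?g"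
          unfolding first using bn gn by (intro sum_nonneg) auto
        also have "\<dots> = skew (?W k) (act x (sroot ?e)) (act x ?g)"
          unfolding x_def using inv[of k N "sroot ?e" ?g] k(1) roots_supported[OF g] supported_sroot[OF wC]
          by (simp add: x_def)
        also have "\<dots> = skew (?W k) (\<lambda>t. - sroot ?d t) \<gamma>" using yk' by (simp add: x_def)
        also have "\<dots> = - skew (?W k) (sroot ?d) \<gamma>"
        proof -
          have "skew c (\<lambda>t. - x t) y = - skew c x y" for c x y
            by (induction c) (auto simp: sum_negf[symmetric] algebra_simps intro!: sum.cong)
          then show ?thesis .
        qed
        finally have "(\<Sum>t\<in>C - {?d}. bond ?d t * \<gamma> t) \<le> 0" unfolding first by simp
        moreover have "bond ?d b * \<gamma> b \<le> (\<Sum>t\<in>C - {?d}. bond ?d t * \<gamma> t)"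
          by (rule member_le_sum) (use b bn \<gamma> finite_subset[OF C finite_S] in auto)
        moreover have "0 < bond ?d b * \<gamma> b"
          using \<open>1 \<le> bond ?d b\<close> \<gamma> by (intro mult_pos_pos) (auto simp: nonneg_def less_le)
        ultimately show False by simp
      qed
      then show "\<gamma> \<in> {\<gamma> \<in> roots S. nonneg \<gamma> \<and> nonpos (act (rev x) \<gamma>)}"
        using \<gamma> roots_mono[OF C] by auto
    qed
    moreover have "finite {\<gamma> \<in> roots S. nonneg \<gamma> \<and> nonpos (act (rev x) \<gamma>)}"
      using finite_inversions[of x] xC C by auto
    ultimately show False
      using infinite_roots_at[OF C conn unb b(1)] finite_subset[of "{\<gamma> \<in> roots C. nonneg \<gamma> \<and> \<gamma> b \<noteq> 0}"]
      by blast
  qed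
  then show ?case using Suc by (simp add: redw_snoc)
qed

end

section \<open>Pruning odd endpoints\<close>

locale periodic_word = coxeter_data S m for S :: "'a set" and m +
  fixes w :: "nat \<Rightarrow> 'a" and n :: nat
  assumes n_pos: "0 < n" and period: "w (i + n) = w i" and w_S: "w i \<in> S"
begin

section \<open>Periodic labellings and letters occurring once per period\<close>

lemma w_cong:
  assumes "i mod n = j mod n"
  shows "w i = w j"
proof -
  have "w (i + k * n) = w i" for i k
  proof (induction k)
    case (Suc k)
    then show ?case using period[of "i + k * n"] by (simp add: algebra_simps)
  qed simp
  then have "w (i mod n) = w i" for i using mod_div_mult_eq[of i n] by metis
  then show ?thesis using assms by metis
qed

lemma window_rep: "\<exists>r. p \<le> r \<and> r < p + n \<and> r mod n = q mod n"
proof -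
  let ?d = "(q + (n - p mod n)) mod n"
  have "(p + ?d) mod n = (p mod n + (q + (n - p mod n))) mod n" by (simp add: mod_simps)
  also have "p mod n + (q + (n - p mod n)) = q + n"
    using mod_less_divisor[OF n_pos, of p] by linarith
  finally show ?thesis using n_pos by (intro exI[of _ "p + ?d"]) simp
qed

definition positions :: "'a set \<Rightarrow> nat set" where
  "positions P = {i. w i \<in> P}"

text \<open>A gap condition on all positions rather than a count in one window, so that it applies
  directly to consecutive elements of a chain.\<close>

definition once :: "'a \<Rightarrow> bool" where
  "once y \<longleftrightarrow> (\<forall>p q. w p = y \<longrightarrow> w q = y \<longrightarrow> p < q \<longrightarrow> p + n \<le> q)"

lemma onceI:
  assumes "\<And>i. p \<le> i \<Longrightarrow> i < p + n \<Longrightarrow> w i = y \<Longrightarrow> i = r"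
  shows "once y"
  unfolding once_def
proof (intro allI impI)
  fix i j assume ij: "w i = y" "w j = y" "i < j"
  obtain i' where i': "p \<le> i'" "i' < p + n" "i' mod n = i mod n" using window_rep[of p i] by blast
  obtain j' where j': "p \<le> j'" "j' < p + n" "j' mod n = j mod n" using window_rep[of p j] by blast
  have "i' = r" "j' = r" using assms i' j' w_cong[OF i'(3)] w_cong[OF j'(3)] ij by auto
  then have "i mod n = j mod n" using i' j' by simp
  then have "n dvd j - i" using ij(3) mod_eq_dvd_iff_nat[of i j n] by (simp add: less_imp_le)
  then have "n \<le> j - i" using ij(3) by (intro dvd_imp_le) auto
  then show "i + n \<le> j" using ij(3) by simp
qed

text \<open>The gap between two consecutive chain occurrences of such a letter contains a whole
  period. Every letter of \<open>Q\<close> shows up in it and, except at the intermediate chain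
  position, commutes.\<close>

lemma once_only_neighbour:
  assumes c: "local_chain m w (positions Q) x y ps" and a: "a + 2 < length ps"
    and xy: "m x y \<noteq> 2" "x \<noteq> y" and once: "once (w (ps ! a))"
    and occ: "\<And>z. z \<in> Q \<Longrightarrow> \<exists>i. w i = z"
  shows "once (w (ps ! (a + 1)))"
    and "\<And>z. z \<in> Q \<Longrightarrow> m z (w (ps ! a)) \<noteq> 2 \<Longrightarrow> z = w (ps ! a) \<or> z = w (ps ! (a + 1))"
proof -
  let ?p = "ps ! a" and ?q = "ps ! (a + 1)"
  have eq: "w (ps ! (a + 2)) = w ?p" using local_chain_nth[OF c] a by simp
  have lt: "?p < ps ! (a + 2)" using local_chain_less[OF c _ a] by simp
  have ge: "?p + n \<le> ps ! (a + 2)" using once lt eq unfolding once_def by metis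
  have comm: "m (w r) (w ?p) = 2" if "w r \<in> Q" "?p < r" "r < ?p + n" "r \<noteq> ?q" for r
    using local_chain_comm[OF c a, of r] that ge by (simp add: positions_def)
  have nc: "m (w ?q) (w ?p) \<noteq> 2"
    using local_chain_nth[OF c] a xy(1) m_sym[of x y] w_S[of ?p] w_S[of ?q] by auto
  have qQ: "w ?q \<in> Q"
  proof -
    have "?q \<in> set ps" using a by simp
    then show ?thesis using c by (auto simp: local_chain_def positions_def)
  qed
  have ne: "w ?q \<noteq> w ?p" using local_chain_nth[OF c] a xy(2) by simp
  show "once (w ?q)"
  proof (rule onceI)
    fix i assume i: "?p \<le> i" "i < ?p + n" "w i = w ?q"
    then have "i \<noteq> ?p" using ne by auto
    then show "i = ?q" using comm[of i] i nc qQ by fastforce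
  qed
  fix z assume z: "z \<in> Q" "m z (w ?p) \<noteq> 2"
  obtain j where "w j = z" using occ[OF z(1)] by blast
  then obtain i where i: "?p \<le> i" "i < ?p + n" "w i = z"
    using window_rep[of ?p j] w_cong by metis
  show "z = w ?p \<or> z = w ?q"
    using comm[of i] i z by (cases "i = ?p") auto
qed

text \<open>The third clause says that every component of \<open>P\<close> contains a repeated letter. It survives
  pruning and excludes the small tails that pruning could otherwise turn into a finite component.\<close>

definition prunable :: "'a set \<Rightarrow> bool" where
  "prunable P \<longleftrightarrow> P \<subseteq> S \<and> (\<forall>z\<in>P. \<exists>i. w i = z) \<and>
    (\<forall>D. D \<subseteq> P \<longrightarrow> D \<noteq> {} \<longrightarrow> (\<forall>x\<in>D. \<forall>y\<in>P. m y x \<noteq> 2 \<longrightarrow> y \<in> D) \<longrightarrow> (\<exists>x\<in>D. \<not> once x)) \<and>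
    square_free m w (positions P) \<and>
    (\<forall>x y ps. local_chain m w (positions P) x y ps \<longrightarrow> x \<noteq> y \<longrightarrow> 3 \<le> length ps \<longrightarrow>
      m x y = enat (length ps) \<longrightarrow>
      length ps = 3 \<and> once x \<and> once y \<and> (\<forall>z\<in>P. m z x \<noteq> 2 \<longrightarrow> z = x \<or> z = y))"

lemma prunableD:
  assumes "prunable P"
  shows "P \<subseteq> S" and "square_free m w (positions P)"
    and "\<And>z. z \<in> P \<Longrightarrow> \<exists>i. w i = z"
    and "\<And>D. D \<subseteq> P \<Longrightarrow> D \<noteq> {} \<Longrightarrow> (\<And>x y. x \<in> D \<Longrightarrow> y \<in> P \<Longrightarrow> m y x \<noteq> 2 \<Longrightarrow> y \<in> D) \<Longrightarrow>
      \<exists>x\<in>D. \<not> once x"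
    and "\<And>x y ps. local_chain m w (positions P) x y ps \<Longrightarrow> x \<noteq> y \<Longrightarrow> 3 \<le> length ps \<Longrightarrow>
      m x y = enat (length ps) \<Longrightarrow>
      length ps = 3 \<and> once x \<and> once y \<and> (\<forall>z\<in>P. m z x \<noteq> 2 \<longrightarrow> z = x \<or> z = y)"
proof -
  note K = assms[unfolded prunable_def]
  show "P \<subseteq> S" "square_free m w (positions P)" using K by simp_all
  show "\<exists>i. w i = z" if "z \<in> P" for z using K that by simp
  show "\<exists>x\<in>D. \<not> once x" if "D \<subseteq> P" "D \<noteq> {}" "\<And>x y. x \<in> D \<Longrightarrow> y \<in> P \<Longrightarrow> m y x \<noteq> 2 \<Longrightarrow> y \<in> D" for D
    using K[THEN conjunct2, THEN conjunct2, THEN conjunct1, THEN spec[of _ D]] that by blast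
  show "length ps = 3 \<and> once x \<and> once y \<and> (\<forall>z\<in>P. m z x \<noteq> 2 \<longrightarrow> z = x \<or> z = y)"
    if "local_chain m w (positions P) x y ps" "x \<noteq> y" "3 \<le> length ps" "m x y = enat (length ps)" for x y ps
    using K[THEN conjunct2, THEN conjunct2, THEN conjunct2, THEN conjunct2, THEN spec[of _ x],
        THEN spec[of _ y], THEN spec[of _ ps]] that by blast
qed

lemma local_chain_letters:
  assumes "local_chain m w (positions P) x y ps" "2 \<le> length ps"
  shows "x \<in> P" "y \<in> P"
proof -
  have l: "0 < length ps" "1 < length ps" using assms(2) by linarith+
  have "ps ! 0 \<in> set ps" "ps ! 1 \<in> set ps" using l by (simp_all only: nth_mem)
  then show "x \<in> P" "y \<in> P"
    using assms(1) local_chain_nth[OF assms(1) l(1)] local_chain_nth[OF assms(1) l(2)]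
    by (auto simp: local_chain_def positions_def)
qed

text \<open>Besides itself, \<open>s\<close> fails to commute only with \<open>t\<close>.
  Occurrences of \<open>t\<close> stay separated: \<open>t\<close> has another neighbour in
  \<open>P\<close>, since otherwise \<open>{t}\<close> would become a component without repeated
  letter. A new braid involves \<open>t\<close>; by \<open>once_only_neighbour\<close> a long one
  would make its two letters such a component as well, so only length 3 survives.\<close>

lemma prune:
  assumes K: "prunable P" and s: "s \<in> P" and t: "t \<in> P" and st: "s \<noteq> t"
    and once_s: "once s" and once_t: "once t"
    and nb: "\<And>z. z \<in> P \<Longrightarrow> m z s \<noteq> 2 \<Longrightarrow> z = s \<or> z = t"
  shows "prunable (P - {s})"
proof -
  let ?P = "P - {s}"
  note PS = prunableD(1)[OF K] and sf = prunableD(2)[OF K] and occ = prunableD(3)[OF K]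
    and H = prunableD(4)[OF K] and br = prunableD(5)[OF K]
  have sym: "m x y = m y x" if "x \<in> P" "y \<in> P" for x y using m_sym that PS by blast
  have s_comm: "m s z = 2" "m z s = 2" if "z \<in> P" "z \<noteq> s" "z \<noteq> t" for z
    using nb[of z] that sym[of s z] s by auto
  have H': "\<exists>x\<in>D. \<not> once x"
    if D: "D \<subseteq> ?P" "D \<noteq> {}" "\<And>x y. x \<in> D \<Longrightarrow> y \<in> ?P \<Longrightarrow> m y x \<noteq> 2 \<Longrightarrow> y \<in> D" for D
  proof -
    \<comment> \<open>The closed set of \<open>P\<close> corresponding to \<open>D\<close> before
      the deletion: \<open>s\<close> is attached through \<open>t\<close> alone.\<close>
    define D' where "D' = (if t \<in> D then insert s D else D)"
    have sub: "D' \<subseteq> P" "D' \<noteq> {}" using D s by (auto simp: D'_def)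
    have "y \<in> D'" if x: "x \<in> D'" and y: "y \<in> P" "m y x \<noteq> 2" for x y
    proof (cases "x = s")
      case True
      then have "t \<in> D" using x D(1) by (auto simp: D'_def split: if_splits)
      then show ?thesis using nb[of y] y True by (auto simp: D'_def)
    next
      case False
      then have xD: "x \<in> D" using x by (auto simp: D'_def split: if_splits)
      show ?thesis
      proof (cases "y = s")
        case True
        then have "x = t" using s_comm[of x] y xD D(1) by auto
        then show ?thesis using xD True by (simp add: D'_def)
      next
        case False
        then show ?thesis using D(3)[OF xD, of y] y by (auto simp: D'_def)
      qed
    qed
    then obtain x where "x \<in> D'" "\<not> once x" using H[OF sub] by blast
    then show ?thesis using once_s by (auto simp: D'_def split: if_splits)
  qed
  have sf': "square_free m w (positions ?P)"
    unfolding square_free_def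
  proof (intro ballI impI)
    fix p q assume pq: "p \<in> positions ?P" "q \<in> positions ?P" "p < q" "w p = w q"
    have p: "w p \<in> P" "w p \<noteq> s" using pq by (auto simp: positions_def)
    obtain r where r: "r \<in> positions P" "p < r" "r < q" "m (w r) (w p) \<noteq> 2"
      using sf pq unfolding square_free_def by (metis DiffD1 mem_Collect_eq positions_def)
    show "\<exists>r\<in>positions ?P. p < r \<and> r < q \<and> m (w r) (w p) \<noteq> 2"
    proof (cases "w r = s")
      case False
      then show ?thesis using r by (auto simp: positions_def)
    next
      case True
      then have wp: "w p = t" using s_comm[of "w p"] p r(4) by auto
      then have ge: "p + n \<le> q" using once_t pq unfolding once_def by metis
      have "\<exists>z\<in>?P. z \<noteq> t \<and> m z t \<noteq> 2"
      proof (rule ccontr)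
        assume *: "\<not> ?thesis"
        have "\<exists>x\<in>{t}. \<not> once x"
          by (rule H') (use * t st in auto)
        then show False using once_t by simp
      qed
      then obtain z where z: "z \<in> ?P" "z \<noteq> t" "m z t \<noteq> 2" by blast
      obtain j where "w j = z" using occ z by blast
      then obtain i where i: "p \<le> i" "i < p + n" "w i = z" using window_rep[of p j] w_cong by metis
      then have "p < i" using z wp by (cases "i = p") auto
      then show ?thesis using i z wp ge by (intro bexI[of _ i]) (auto simp: positions_def)
    qed
  qed
  have br': "length qs = 3 \<and> once x \<and> once y \<and> (\<forall>z\<in>?P. m z x \<noteq> 2 \<longrightarrow> z = x \<or> z = y)"
    if c: "local_chain m w (positions ?P) x y qs" and xy: "x \<noteq> y" and l: "3 \<le> length qs"
      and mxy: "m x y = enat (length qs)" for x y qs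
  proof -
    have mem: "x \<in> ?P" "y \<in> ?P" using local_chain_letters[OF c] l by auto
    have nc: "m x y \<noteq> 2" "m y x \<noteq> 2" using mxy l sym mem by (auto simp: numeral_eq_enat)
    have nth: "w (qs ! i) = (if even i then x else y)" if "i < length qs" for i
      using local_chain_nth[OF c that] .
    have lens: "0 < length qs" "1 < length qs" "2 < length qs" using l by linarith+
    have nths: "w (qs ! 0) = x" "w (qs ! 1) = y" "w (qs ! 2) = x"
      using nth[OF lens(1)] nth[OF lens(2)] nth[OF lens(3)] by simp_all
    have lift: "length qs = 3 \<and> once x \<and> once y \<and> (\<forall>z\<in>?P. m z x \<noteq> 2 \<longrightarrow> z = x \<or> z = y)"
      if com: "\<And>a. a + 2 < length qs \<Longrightarrow> m s (w (qs ! a)) = 2"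
    proof -
      have "local_chain m w (positions P) x y qs"
        unfolding local_chain_def
      proof (intro conjI allI impI)
        fix a r assume a: "a + 2 < length qs" and r: "r \<in> positions P" "qs ! a < r"
          "r < qs ! (a + 2)" "r \<noteq> qs ! (a + 1)"
        show "m (w r) (w (qs ! a)) = 2"
          using local_chain_comm[OF c a] r com[OF a] by (cases "w r = s") (auto simp: positions_def)
      qed (use c in \<open>auto simp: local_chain_def positions_def\<close>)
      then show ?thesis using br xy l mxy by blast
    qed
    have occ': "\<And>z. z \<in> ?P \<Longrightarrow> \<exists>i. w i = z" using occ by blast
    have only: "once (w (qs ! (a + 1)))"
        "\<And>z. z \<in> ?P \<Longrightarrow> m z (w (qs ! a)) \<noteq> 2 \<Longrightarrow> z = w (qs ! a) \<or> z = w (qs ! (a + 1))"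
      if "a + 2 < length qs" "once (w (qs ! a))" for a
      using once_only_neighbour[OF c that(1) nc(1) xy that(2)] occ' by simp_all
    \<comment> \<open>Two letters occurring once and adjacent only to each other would form a
      component without repeated letter.\<close>
    have pair: False
      if nx: "\<forall>z\<in>?P. m z x \<noteq> 2 \<longrightarrow> z = x \<or> z = y" and ny: "\<forall>z\<in>?P. m z y \<noteq> 2 \<longrightarrow> z = y \<or> z = x"
        and o: "once x" "once y"
    proof -
      have "\<exists>z\<in>{x, y}. \<not> once z"
      proof (rule H')
        fix v z assume "v \<in> {x, y}" "z \<in> ?P" "m z v \<noteq> 2"
        then show "z \<in> {x, y}" using nx ny by blast
      qed (use mem in auto)
      then show False using o by auto
    qed
    consider "x \<noteq> t" "y \<noteq> t" | "x = t" | "y = t" by blast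
    then show ?thesis
    proof cases
      case 1
      then have "m s x = 2" "m s y = 2" using s_comm mem by auto
      then show ?thesis using nth by (intro lift) auto
    next
      case 2
      have a0: "0 + 2 < length qs" using l by simp
      have n0: "w (qs ! 0) = x" "w (qs ! (0 + 1)) = y" using nths by simp_all
      have o: "once (w (qs ! 0))" using n0 once_t 2 by simp
      have y: "once y" "\<forall>z\<in>?P. m z x \<noteq> 2 \<longrightarrow> z = x \<or> z = y"
        using only[OF a0 o] unfolding n0 by blast+
      have "\<not> 3 < length qs"
      proof
        assume "3 < length qs"
        then have a1: "1 + 2 < length qs" by simp
        have n1: "w (qs ! 1) = y" "w (qs ! (1 + 1)) = x" using nths by (simp_all add: numeral_2_eq_2)
        have "once (w (qs ! 1))" using n1 y by simp
        then have "\<forall>z\<in>?P. m z y \<noteq> 2 \<longrightarrow> z = y \<or> z = x"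
          using only(2)[OF a1] unfolding n1 by blast
        then show False using pair y once_t 2 by blast
      qed
      then show ?thesis using y l once_t 2 by auto
    next
      case 3
      show ?thesis
      proof (cases "length qs = 3")
        case True
        \<comment> \<open>In a chain of length 3 the locality condition concerns only
          \<open>x\<close>, with which \<open>s\<close> commutes, so the chain was already present
          in \<open>P\<close>.\<close>
        have "m s x = 2" using s_comm[of x] mem xy 3 by auto
        then show ?thesis using nth True by (intro lift) auto
      next
        case False
        then have a1: "1 + 2 < length qs" and a0: "0 + 2 < length qs" using l by auto
        have n1: "w (qs ! 1) = y" "w (qs ! (1 + 1)) = x" using nths by (simp_all add: numeral_2_eq_2)
        have n0: "w (qs ! 0) = x" "w (qs ! (0 + 1)) = y" using nths by simp_all
        have o: "once (w (qs ! 1))" using n1 once_t 3 by simp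
        have x: "once x" "\<forall>z\<in>?P. m z y \<noteq> 2 \<longrightarrow> z = y \<or> z = x"
          using only[OF a1 o] unfolding n1 by blast+
        have "once (w (qs ! 0))" using n0 x by simp
        then have "\<forall>z\<in>?P. m z x \<noteq> 2 \<longrightarrow> z = x \<or> z = y"
          using only(2)[OF a0] unfolding n0 by blast
        then show ?thesis using pair x once_t 3 by blast
      qed
    qed
  qed
  have "?P \<subseteq> S" "\<forall>z\<in>?P. \<exists>i. w i = z" using PS occ by auto
  moreover have "\<forall>D. D \<subseteq> ?P \<longrightarrow> D \<noteq> {} \<longrightarrow> (\<forall>x\<in>D. \<forall>y\<in>?P. m y x \<noteq> 2 \<longrightarrow> y \<in> D) \<longrightarrow> (\<exists>x\<in>D. \<not> once x)"
    using H' by metis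
  ultimately show ?thesis unfolding prunable_def using sf' br' by blast
qed

section \<open>Reducedness of prunable periodic words\<close>

lemma word_on_positions:
  "word_on w {i \<in> positions P. i < N} = filter (\<lambda>e. e \<in> P) (map w [0..<N])"
proof -
  have "sorted_list_of_set {i \<in> positions P. i < N} = filter (\<lambda>i. w i \<in> P) [0..<N]"
    by (rule sorted_list_of_set_eq) (auto simp: positions_def sorted_wrt_filter)
  then show ?thesis by (simp add: word_on_def filter_map comp_def)
qed

text \<open>Cutting the periodic word at \<open>N\<close> creates neither squares nor braids,
  because both conditions look only between positions that are kept.\<close>

lemma braid_free_positions_redw:
  assumes sf: "square_free m w (positions P)" and bf: "braid_free m w (positions P)"
  shows "redw (filter (\<lambda>e. e \<in> P) (map w [0..<N]))"
proof -
  let ?I = "{i \<in> positions P. i < N}"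
  have "square_free m w ?I"
    unfolding square_free_def
  proof (intro ballI impI)
    fix p q assume "p \<in> ?I" "q \<in> ?I" "p < q" "w p = w q"
    then obtain r where "r \<in> positions P" "p < r" "r < q" "m (w r) (w p) \<noteq> 2" "q < N"
      using sf unfolding square_free_def by blast
    then show "\<exists>r\<in>?I. p < r \<and> r < q \<and> m (w r) (w p) \<noteq> 2" by (intro bexI[of _ r]) auto
  qed
  moreover have "braid_free m w ?I"
    unfolding braid_free_def
  proof (intro allI impI)
    fix x y ps assume c: "local_chain m w ?I x y ps" and xy: "x \<noteq> y" "3 \<le> length ps"
    have sub: "set ps \<subseteq> ?I" using c by (simp add: local_chain_def)
    have "local_chain m w (positions P) x y ps"
      unfolding local_chain_def
    proof (intro conjI allI impI)
      fix a r assume a: "a + 2 < length ps" and r: "r \<in> positions P" "ps ! a < r" "r < ps ! (a + 2)"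
        "r \<noteq> ps ! (a + 1)"
      have "ps ! (a + 2) < N" using nth_mem[OF a] sub by auto
      then show "m (w r) (w (ps ! a)) = 2" using local_chain_comm[OF c a] r by simp
    qed (use c in \<open>auto simp: local_chain_def\<close>)
    then show "m x y \<noteq> enat (length ps)" using bf xy unfolding braid_free_def by blast
  qed
  moreover have "finite ?I" "w ` ?I \<subseteq> S" using w_S by auto
  ultimately have "redw (word_on w ?I)" using braid_free_redw by blast
  then show ?thesis by (simp only: word_on_positions)
qed

text \<open>A braid names by its first letter an endpoint that \<open>prune\<close> may delete;
  \<open>square_free\<close> supplies the neighbours needed to put it back with
  \<open>redw_insert\<close>.\<close>

lemma prunable_redw:
  assumes "prunable P"
  shows "redw (filter (\<lambda>e. e \<in> P) (map w [0..<N]))"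
  using assms
proof (induction "card P" arbitrary: P rule: less_induct)
  case less
  note PS = prunableD(1)[OF less.prems] and sf = prunableD(2)[OF less.prems]
    and br = prunableD(5)[OF less.prems]
  show ?case
  proof (cases "braid_free m w (positions P)")
    case True
    then show ?thesis using braid_free_positions_redw sf by blast
  next
    case False
    then obtain s t ps where c: "local_chain m w (positions P) s t ps" "s \<noteq> t" "3 \<le> length ps"
        "m s t = enat (length ps)"
      unfolding braid_free_def by blast
    have mem: "s \<in> P" "t \<in> P" using local_chain_letters[OF c(1)] c(3) by auto
    have pr: "prunable (P - {s})"
      using prune[OF less.prems mem c(2)] br[OF c] by blast
    have "card (P - {s}) < card P"
      using mem finite_subset[OF PS finite_S] by (intro psubset_card_mono) auto
    then have IH: "redw (filter (\<lambda>e. e \<in> P - {s}) (map w [0..<N]))"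
      using less.hyps pr by blast
    let ?L = "filter (\<lambda>i. w i \<in> P) [0..<N]"
    let ?v = "filter (\<lambda>e. e \<in> P) (map w [0..<N])"
    have vL: "?v = map w ?L" by (simp add: filter_map comp_def)
    show ?thesis
    proof (rule redw_insert)
      show "set ?v \<subseteq> S" using PS by auto
      show "s \<in> S" using mem PS by auto
      have "filter (\<lambda>t. t \<noteq> s) ?v = filter (\<lambda>e. e \<in> P - {s}) (map w [0..<N])"
        by (auto intro: filter_cong)
      then show "redw (filter (\<lambda>t. t \<noteq> s) ?v)" using IH by (simp only:)
      fix A B D assume "?v = A @ s # B @ s # D"
      then have "map w ?L = A @ s # B @ s # D" by (simp only: vL)
      then obtain LA p LB q LD where L: "?L = LA @ p # LB @ q # LD" "w p = s" "w q = s" "B = map w LB"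
        by (auto simp: map_eq_append_conv map_eq_Cons_conv append_eq_map_conv Cons_eq_map_conv)
      have sorted: "sorted_wrt (<) ?L" by (simp add: sorted_wrt_filter)
      then have pq: "p < q" unfolding L(1) by (simp add: sorted_wrt_append)
      have in_L: "p \<in> set ?L" "q \<in> set ?L" unfolding L(1) by auto
      then have "p \<in> positions P" "q \<in> positions P" "q < N" by (auto simp: positions_def)
      then obtain r where r: "r \<in> positions P" "p < r" "r < q" "m (w r) (w p) \<noteq> 2"
        using sf pq L unfolding square_free_def by metis
      have "r \<in> set ?L" using r \<open>q < N\<close> by (auto simp: positions_def)
      then have "r \<in> set LB" using sorted r unfolding L(1) by (auto simp: sorted_wrt_append)
      moreover have "m s (w r) \<noteq> 2" using r(4) L(2) m_sym w_S by metis
      ultimately show "\<exists>t\<in>set B. m s t \<noteq> 2" using L(4) by auto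
    qed
  qed
qed

end

section \<open>Local chains in a periodic word\<close>

context coxeter_data begin

lemma not_unbounded_dihedral:
  assumes "x \<in> S" "y \<in> S" "m x y = enat l"
  shows "\<not> unbounded {x, y}"
proof
  assume "unbounded {x, y}"
  then obtain v where v: "minw {x, y} v" "Suc l \<le> length v" unfolding unbounded_def by blast
  have sub: "{x, y} \<subseteq> S" using assms by simp
  have "m y x = enat l" using m_sym[OF assms(1,2)] assms(3) by simp
  moreover have "v = alternating x y (length v) \<or> v = alternating y x (length v)"
    using minw_alternating[OF sub v(1) minw_lists[OF v(1)]] .
  ultimately have "length v \<le> l"
    using minw_alternating_length[OF sub, of x y "length v" l] assms(3) v(1)
      minw_alternating_length[OF sub, of y x "length v" l] by auto
  then show False using v(2) by simp
qed

end

section \<open>Windows, letter counts and parts of chains\<close>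

lemma word_on_window: "word_on w {p..<p + n} = map w [p..<p + n]"
  by (simp add: word_on_def)

lemma count_list_word_on:
  assumes "finite I"
  shows "count_list (word_on w I) x = card {i \<in> I. w i = x}"
proof -
  have "count_list (map w l) x = length (filter (\<lambda>i. w i = x) l)" for l
    by (induction l) auto
  moreover have "length (filter (\<lambda>i. w i = x) (sorted_list_of_set I)) = card {i \<in> I. w i = x}"
    using distinct_card[of "filter (\<lambda>i. w i = x) (sorted_list_of_set I)"] assms by simp
  ultimately show ?thesis by (simp add: word_on_def)
qed

lemma local_chain_mono:
  "local_chain m w I x y ps \<Longrightarrow> set ps \<subseteq> J \<Longrightarrow> J \<subseteq> I \<Longrightarrow> local_chain m w J x y ps"
  by (auto simp: local_chain_def)

lemma local_chain_take:
  assumes "local_chain m w I x y ps" "k \<le> length ps"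
  shows "local_chain m w I x y (take k ps)"
proof -
  have c: "sorted_wrt (<) ps" "set ps \<subseteq> I" "map w ps = alternating x y (length ps)"
    using assms(1) by (auto simp: local_chain_def)
  have "alternating x y (k + (length ps - k)) = map w ps" using c(3) assms(2) by simp
  then have "map w (take k ps) = alternating x y k"
    unfolding alternating_add by (metis length_alternating append_eq_conv_conj take_map)
  then show ?thesis
    unfolding local_chain_def
    using assms(2) c set_take_subset[of k ps] local_chain_comm[OF assms(1)]
    by (auto simp: sorted_wrt_take min_def)
qed

context coxeter_data begin

text \<open>A letter \<open>x\<close> or \<open>y\<close> off the chain would fall into a gap whose
  ends it must commute with, but those ends carry \<open>x\<close> or \<open>y\<close> too. After
  the penultimate element the gap starting one step earlier serves.\<close>

lemma local_chain_between:
  assumes c: "local_chain m w I x y ps" and l: "3 \<le> length ps" and xy: "m x y \<noteq> 2" "x \<in> S" "y \<in> S"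
    and r: "r \<in> I" "ps ! 0 \<le> r" "r \<le> ps ! (length ps - 1)" "w r = x \<or> w r = y"
  shows "r \<in> set ps"
proof (rule ccontr)
  assume nr: "r \<notin> set ps"
  have nc: "m x y \<noteq> 2" "m y x \<noteq> 2" "m x x \<noteq> 2" "m y y \<noteq> 2"
    using xy m_sym[OF xy(2,3)] m_eq_1_iff[of x x] m_eq_1_iff[of y y] by auto
  have nth: "w (ps ! i) = x \<or> w (ps ! i) = y" if "i < length ps" for i
    using local_chain_nth[OF c that] by simp
  have not_comm: "m (w r) (w (ps ! i)) \<noteq> 2" if "i < length ps" for i
    using nth[OF that] r(4) nc by auto
  define J where "J = {j. j < length ps \<and> ps ! j \<le> r}"
  define j where "j = Max J"
  have fin: "finite J" by (simp add: J_def)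
  have "0 < length ps" using l by linarith
  then have "0 \<in> J" using r(2) by (simp add: J_def)
  then have jJ: "j \<in> J" unfolding j_def using Max_in[OF fin] by blast
  then have j: "j < length ps" "ps ! j \<le> r" by (auto simp: J_def)
  then have jr: "ps ! j < r" using nr nth_mem[OF j(1)] by (metis le_neq_implies_less)
  have "j \<noteq> length ps - 1" using jr r(3) by auto
  then have j1: "j + 1 < length ps" using j(1) by simp
  have "Suc j \<notin> J" using Max_ge[OF fin, of "Suc j"] by (auto simp: j_def)
  then have rj: "r < ps ! (j + 1)" using j1 by (simp add: J_def)
  show False
  proof (cases "j + 2 < length ps")
    case True
    have "r < ps ! (j + 2)" using rj local_chain_less[OF c, of "j + 1" "j + 2"] True by simp
    then show False
      using local_chain_comm[OF c True r(1) jr] rj not_comm[OF j(1)] by simp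
  next
    case False
    then have "j = length ps - 2" using j1 by simp
    then have "0 < j" using l by simp
    then obtain h where h: "j = h + 1" using gr0_implies_Suc[of j] by auto
    have h2: "h + 2 < length ps" using j1 h by simp
    have "ps ! h < r" using local_chain_less[OF c, of h j] j jr h by simp
    then show False
      using local_chain_comm[OF c h2 r(1)] rj jr not_comm[of h] h h2 by simp
  qed
qed

end

context periodic_word begin

lemma letter_in_window:
  assumes "z \<in> range w"
  shows "\<exists>i. p \<le> i \<and> i < p + n \<and> w i = z"
proof -
  obtain j where j: "w j = z" using assms by auto
  obtain i where i: "p \<le> i" "i < p + n" "i mod n = j mod n" using window_rep[of p j] by blast
  then show ?thesis using w_cong[OF i(3)] j by blast
qed

text \<open>Here the group-theoretic assumptions become conditions on windows: \<open>red\<close>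
  and \<open>fc\<close> hold for all cyclic shifts, and \<open>nlb\<close> excludes large bands. Its
  third neighbour condition on \<open>y\<close> prevents \<open>y\<close> from being an endpoint, so
  exactly one of \<open>x\<close> and \<open>y\<close> is odd.\<close>

lemma prunable_component:
  assumes C: "C \<subseteq> range w" and conn: "cox_connected C" and unb: "unbounded C"
    and sep: "\<And>c d. c \<in> C \<Longrightarrow> d \<in> range w \<Longrightarrow> d \<notin> C \<Longrightarrow> m d c = 2"
    and rep: "x0 \<in> C" "\<not> once x0"
    and red: "\<And>i. minw S (map w [i..<i + n])"
    and fc: "\<And>i a b x y l. ceq m (map w [i..<i + n]) (a @ alternating x y l @ b) \<Longrightarrow>
      x \<in> S \<Longrightarrow> y \<in> S \<Longrightarrow> x \<noteq> y \<Longrightarrow> 3 \<le> l \<Longrightarrow> m x y = enat l \<Longrightarrow> False"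
    and nlb: "\<And>x y k p a b. x \<in> C \<Longrightarrow> y \<in> C \<Longrightarrow> x \<noteq> y \<Longrightarrow> 2 \<le> k \<Longrightarrow> m x y = enat (2 * k + 1) \<Longrightarrow>
      (\<And>z. z \<in> range w \<Longrightarrow> m z x \<noteq> 2 \<Longrightarrow> z = x \<or> z = y) \<Longrightarrow>
      (\<exists>z\<in>range w. m z y \<noteq> 2 \<and> z \<noteq> x \<and> z \<noteq> y) \<Longrightarrow>
      ceq m (map w [p..<p + n]) (a @ alternating x y (2 * k) @ b) \<Longrightarrow>
      (\<And>z. z \<in> {x, y} \<Longrightarrow> count_list (map w [p..<p + n]) z = count_list (alternating x y (2 * k)) z) \<Longrightarrow>
      False"
  shows "prunable C"
proof -
  have CS: "C \<subseteq> S" using C w_S by auto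
  have finS: "w ` I \<subseteq> S" for I using w_S by auto
  have closed_eq: "D = C"
    if "D \<subseteq> C" "D \<noteq> {}" "\<And>x y. x \<in> D \<Longrightarrow> y \<in> C \<Longrightarrow> m y x \<noteq> 2 \<Longrightarrow> y \<in> D" for D
  proof -
    have "\<forall>x\<in>D. \<forall>y\<in>C. m x y \<noteq> 2 \<longrightarrow> y \<in> D"
    proof (intro ballI impI)
      fix x y assume xy: "x \<in> D" "y \<in> C" "m x y \<noteq> 2"
      then have "x \<in> S" "y \<in> S" using that(1) CS by auto
      then show "y \<in> D" using that(3)[OF xy(1,2)] xy(3) m_sym[of x y] by simp
    qed
    then show ?thesis using conn[unfolded cox_connected_def, THEN spec[of _ D]] that by blast
  qed
  have sf: "square_free m w (positions C)"
    unfolding square_free_def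
  proof (intro ballI impI)
    fix p q assume p: "p \<in> positions C" and q: "q \<in> positions C" "p < q" and eq: "w p = w q"
    show "\<exists>r\<in>positions C. p < r \<and> r < q \<and> m (w r) (w p) \<noteq> 2"
    proof (rule ccontr)
      assume *: "\<not> ?thesis"
      have pC: "w p \<in> C" using p by (simp add: positions_def)
      have com: "m (w r) (w p) = 2" if "p < r" "r < q" for r
        using * that sep[OF pC, of "w r"] by (cases "w r \<in> C") (auto simp: positions_def)
      have one: "m (w p) (w p) \<noteq> 2" using m_eq_1_iff[of "w p" "w p"] w_S by auto
      \<comment> \<open>The letter recurs at \<open>p + n\<close>; were this strictly between
        \<open>p\<close> and \<open>q\<close>, it would have to commute with itself.\<close>
      have "q \<le> p + n"
      proof (rule ccontr)
        assume "\<not> q \<le> p + n"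
        then have "m (w (p + n)) (w p) = 2" using com n_pos by simp
        then show False using one period by simp
      qed
      then consider "q < p + n" | "q = p + n" by linarith
      then show False
      proof cases
        case 1
        obtain a b where ab: "ceq m (word_on w {p..<p + n}) (a @ [w p, w p] @ b)"
          using gather_square[of "{p..<p + n}" w p q] finS 1 q eq com n_pos by auto
        have v: "minw S (map w [p..<p + n])" by (rule red)
        have "eqw S (map w [p..<p + n]) (a @ [w p, w p] @ b)"
          using eqw_ceq[OF subset_refl ab[unfolded word_on_window]] minw_lists[OF v] by blast
        moreover have "length (a @ [w p, w p] @ b) = length (map w [p..<p + n])"
          using mset_eq_length[OF ceq_mset[OF ab[unfolded word_on_window]]] by simp
        ultimately have "minw S (a @ [w p, w p] @ b)" using minw_eqw[OF v] eqw_sym by simp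
        then show False using not_minw_square[of S a "w p" b] by simp
      next
        case 2
        \<comment> \<open>A whole period commuting with \<open>w p\<close> isolates it, so
          \<open>C\<close> would be a single letter occurring once, although \<open>C\<close>
          contains a repeated letter.\<close>
        have "{w p} = C"
        proof (rule closed_eq)
          fix x y assume x: "x \<in> {w p}" and y: "y \<in> C" "m y x \<noteq> 2"
          obtain i where i: "p \<le> i" "i < p + n" "w i = y" using letter_in_window[of y p] y C by blast
          then show "y \<in> {w p}" using com[of i] 2 x y by (cases "i = p") auto
        qed (use pC in auto)
        then have "\<not> once (w p)" using rep by auto
        moreover have "once (w p)"
        proof (rule onceI)
          fix i assume i: "p \<le> i" "i < p + n" "w i = w p"
          then show "i = p" using com[of i] 2 one by (cases "i = p") auto
        qed
        ultimately show False by blast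
      qed
    qed
  qed
  have br: "length ps = 3 \<and> once x \<and> once y \<and> (\<forall>z\<in>C. m z x \<noteq> 2 \<longrightarrow> z = x \<or> z = y)"
    if c: "local_chain m w (positions C) x y ps" and xy: "x \<noteq> y" and l: "3 \<le> length ps"
      and mxy: "m x y = enat (length ps)" for x y ps
  proof -
    let ?l = "length ps"
    have mem: "x \<in> C" "y \<in> C" using local_chain_letters[OF c] l by auto
    then have xyS: "x \<in> S" "y \<in> S" using CS by auto
    have nc: "m x y \<noteq> 2" "m y x \<noteq> 2" using mxy l m_sym[OF xyS] by (auto simp: numeral_eq_enat)
    have nth: "w (ps ! i) = (if even i then x else y)" if "i < ?l" for i
      using local_chain_nth[OF c that] .
    have cU: "local_chain m w UNIV x y ps"
      unfolding local_chain_def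
    proof (intro conjI allI impI)
      fix a r assume a: "a + 2 < ?l" and r: "ps ! a < r" "r < ps ! (a + 2)" "r \<noteq> ps ! (a + 1)"
      have "w (ps ! a) \<in> C" using nth[of a] a mem by simp
      then show "m (w r) (w (ps ! a)) = 2"
        using local_chain_comm[OF c a, of r] r sep[of "w (ps ! a)" "w r"]
        by (cases "w r \<in> C") (auto simp: positions_def)
    qed (use c in \<open>auto simp: local_chain_def\<close>)
    have less: "ps ! i < ps ! j" if "i < j" "j < ?l" for i j using local_chain_less[OF c that] .
    have le: "ps ! i \<le> ps ! j" if "i \<le> j" "j < ?l" for i j
      using less[of i j] that by (cases "i = j") auto
    have between: "r \<in> set ps" if "ps ! 0 \<le> r" "r \<le> ps ! (?l - 1)" "w r = x \<or> w r = y" for r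
      using local_chain_between[OF cU l nc(1) xyS UNIV_I that] .
    have index: "\<exists>i<?l. r = ps ! i \<and> w r = (if even i then x else y)"
      if "ps ! 0 \<le> r" "r \<le> ps ! (?l - 1)" "w r = x \<or> w r = y" for r
    proof -
      have "r \<in> set ps" using between[OF that] .
      then obtain i where "i < ?l" "r = ps ! i" by (auto simp: in_set_conv_nth)
      then show ?thesis using nth[of i] by blast
    qed
    let ?p = "ps ! 0"
    have lens: "0 < ?l" "1 < ?l" "2 < ?l" "?l - 1 < ?l" using l by linarith+
    have wp: "w ?p = x" using nth[OF lens(1)] by simp
    have window: "local_chain m w {?p..<?p + n} x y (take j ps)"
      if j: "0 < j" "j \<le> ?l" "ps ! (j - 1) < ?p + n" for j
    proof (rule local_chain_mono[OF local_chain_take[OF cU j(2)]])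
      show "set (take j ps) \<subseteq> {?p..<?p + n}"
      proof
        fix r assume "r \<in> set (take j ps)"
        then obtain i where i: "i < j" "r = ps ! i" using j(2) by (auto simp: in_set_conv_nth)
        have ij: "i < ?l" "i \<le> j - 1" "j - 1 < ?l" using i(1) j(1,2) by linarith+
        have "?p \<le> ps ! i" using le[of 0 i] ij(1) by simp
        moreover have "ps ! i \<le> ps ! (j - 1)" using le ij by simp
        ultimately show "r \<in> {?p..<?p + n}" using i j(3) by auto
      qed
    qed simp
    have gather: "\<exists>a b. ceq m (map w [?p..<?p + n]) (a @ alternating x y j @ b)"
      if j: "3 \<le> j" "j \<le> ?l" "ps ! (j - 1) < ?p + n" for j
    proof -
      have lt: "length (take j ps) = j" using j(2) by simp
      have "local_chain m w {?p..<?p + n} x y (take j ps)" using window j by simp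
      from gather_chain[OF _ finS this] show ?thesis
        unfolding lt word_on_window using j(1) by simp
    qed
    \<comment> \<open>A braid inside one window could be gathered by commutations, against full
      commutativity of a cyclic shift.\<close>
    have "?p + n \<le> ps ! (?l - 1)"
    proof (rule ccontr)
      assume "\<not> ?thesis"
      then obtain a b where "ceq m (map w [?p..<?p + n]) (a @ alternating x y ?l @ b)"
        using gather[of ?l] l by auto
      then show False using fc[OF _ xyS xy l mxy] by blast
    qed
    moreover have "w (?p + n) = x" using wp period by simp
    ultimately obtain i where i: "i < ?l" "?p + n = ps ! i" "even i"
      using index[of "?p + n"] xy by (auto split: if_splits)
    have "i \<noteq> 0" using i(2) n_pos by (cases "i = 0") auto
    then obtain k where k: "i = 2 * k" "1 \<le> k" using i(3) by (auto elim!: evenE)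
    have pn: "?p + n = ps ! (2 * k)" "2 * k < ?l" using i k by auto
    \<comment> \<open>The gaps between successive chain occurrences of \<open>v\<close> tile a whole
      period. Each neighbour of \<open>v\<close> is therefore found in one of them, where only the
      chain's own letters may fail to commute with \<open>v\<close>.\<close>
    have nb: "z = v \<or> z \<in> {x, y}"
      if z: "z \<in> range w" "m z v \<noteq> 2" and v: "w (ps ! a) = v" and a: "a + 2 * k < ?l" "a \<le> 1"
        and ge: "ps ! a + n \<le> ps ! (a + 2 * k)" for z v a
    proof -
      obtain j where j: "ps ! a \<le> j" "j < ps ! a + n" "w j = z" using letter_in_window[OF z(1), of "ps ! a"] by blast
      define J where "J = {b. b \<le> k \<and> ps ! (a + 2 * b) \<le> j}"
      define b where "b = Max J"
      have fin: "finite J" unfolding J_def by (rule finite_subset[of _ "{..k}"]) auto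
      have "0 \<in> J" using j(1) by (simp add: J_def)
      then have "b \<in> J" unfolding b_def using Max_in[OF fin] by blast
      then have b: "b \<le> k" "ps ! (a + 2 * b) \<le> j" by (auto simp: J_def)
      have "b \<noteq> k" using b(2) j(2) ge by auto
      then have bk: "b < k" using b(1) by simp
      have "Suc b \<notin> J" using Max_ge[OF fin, of "Suc b"] by (auto simp: b_def)
      then have jb: "j < ps ! (a + 2 * b + 2)" using bk by (simp add: J_def)
      have ab: "a + 2 * b + 2 < ?l" using bk a(1) by simp
      have wv: "w (ps ! (a + 2 * b)) = v" using nth[of "a + 2 * b"] nth[of a] v ab by simp
      show ?thesis
      proof (cases "j = ps ! (a + 2 * b) \<or> j = ps ! (a + 2 * b + 1)")
        case True
        then show ?thesis using nth[of "a + 2 * b"] nth[of "a + 2 * b + 1"] ab j(3) by auto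
      next
        case False
        then have "m (w j) (w (ps ! (a + 2 * b))) = 2"
          using local_chain_comm[OF cU ab, of j] b(2) jb by simp
        then show ?thesis using j(3) z(2) wv by simp
      qed
    qed
    have nbx: "z = x \<or> z = y" if "z \<in> range w" "m z x \<noteq> 2" for z
      using nb[OF that wp] pn by auto
    \<comment> \<open>Then \<open>C\<close> would be \<open>{x, y}\<close> with a finite label, a
      finite dihedral group, although \<open>C\<close> is unbounded.\<close>
    have not_dihedral: False if ny: "\<And>z. z \<in> range w \<Longrightarrow> m z y \<noteq> 2 \<Longrightarrow> z = x \<or> z = y"
    proof -
      have "{x, y} = C"
      proof (rule closed_eq)
        fix v z assume "v \<in> {x, y}" "z \<in> C" "m z v \<noteq> 2"
        then show "z \<in> {x, y}" using ny[of z] nbx[of z] C by auto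
      qed (use mem in auto)
      then show False using unb not_unbounded_dihedral[OF xyS mxy] by simp
    qed
    have l2k: "?l = 2 * k + 1"
    proof (rule ccontr)
      assume "\<not> ?thesis"
      then have l2: "1 + 2 * k < ?l" using pn(2) by simp
      have y2: "w (ps ! (1 + 2 * k)) = y" "w (ps ! 1) = y" using nth[OF l2] nth[OF lens(2)] by auto
      have gt: "?p + n < ps ! (1 + 2 * k)" using less[of "2 * k" "1 + 2 * k"] l2 pn(1) by simp
      \<comment> \<open>One period before a \<open>y\<close> of the chain there is again a
        \<open>y\<close>. It lies after \<open>?p\<close>, hence on the chain and not before
        \<open>ps ! 1\<close>, so the occurrences of \<open>y\<close> on the chain also cover a
        whole period.\<close>
      define r where "r = ps ! (1 + 2 * k) - n"
      have r: "r + n = ps ! (1 + 2 * k)" "?p < r" using gt by (auto simp: r_def)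
      have "1 + 2 * k \<le> ?l - 1" using l2 by linarith
      note last = le[OF this lens(4)]
      have "w r = y" using period[of r] r(1) y2 by simp
      moreover have "r \<le> ps ! (?l - 1)"
        using last r(1) by linarith
      ultimately obtain h where h: "h < ?l" "r = ps ! h" "odd h"
        using index[of r] r(2) xy by (auto split: if_splits)
      then have "1 \<le> h" by (auto elim!: oddE)
      then have "ps ! 1 \<le> r" using le[of 1 h] h by simp
      then have "ps ! 1 + n \<le> ps ! (1 + 2 * k)" using r(1) by simp
      then have "z = x \<or> z = y" if "z \<in> range w" "m z y \<noteq> 2" for z
        using nb[OF that y2(2) l2] by auto
      then show False by (rule not_dihedral)
    qed
    have win_index: "\<exists>h<2 * k. r = ps ! h \<and> w r = (if even h then x else y)"
      if r: "?p \<le> r" "r < ?p + n" "w r = x \<or> w r = y" for r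
    proof -
      have "r \<le> ps ! (?l - 1)" using r(2) pn(1) l2k by simp
      then obtain h where h: "h < ?l" "r = ps ! h" "w r = (if even h then x else y)"
        using index[OF r(1) _ r(3)] by blast
      moreover have "h < 2 * k"
      proof (rule ccontr)
        assume "\<not> h < 2 * k"
        then have "h = 2 * k" using h(1) l2k by simp
        then show False using h(2) r(2) pn(1) by simp
      qed
      ultimately show ?thesis by blast
    qed
    \<comment> \<open>The first \<open>2 * k\<close> chain positions are all the occurrences of
      \<open>x\<close> and \<open>y\<close> in the window. As \<open>m x y\<close> is
      \<open>2 * k + 1\<close>, they are the alternating subword of a large band.\<close>
    have "\<not> 2 \<le> k"
    proof
      assume k2: "2 \<le> k"
      have lt: "ps ! (2 * k - 1) < ?p + n" using less[of "2 * k - 1" "2 * k"] pn k by simp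
      obtain a b where ab: "ceq m (map w [?p..<?p + n]) (a @ alternating x y (2 * k) @ b)"
        using gather[of "2 * k"] lt k2 pn(2) by auto
      have cq: "local_chain m w {?p..<?p + n} x y (take (2 * k) ps)"
        using window[of "2 * k"] lt pn(2) k by simp
      have "count_list (map w [?p..<?p + n]) z = count_list (alternating x y (2 * k)) z"
        if z: "z \<in> {x, y}" for z
      proof -
        have "length (take (2 * k) ps) = 2 * k" using pn(2) by simp
        then have "alternating x y (2 * k) = word_on w (set (take (2 * k) ps))"
          using cq word_on_set[of "take (2 * k) ps" w] by (simp add: local_chain_def)
        moreover have "{i \<in> set (take (2 * k) ps). w i = z} = {i \<in> {?p..<?p + n}. w i = z}"
        proof
          show "{i \<in> set (take (2 * k) ps). w i = z} \<subseteq> {i \<in> {?p..<?p + n}. w i = z}"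
            using cq by (auto simp: local_chain_def)
          show "{i \<in> {?p..<?p + n}. w i = z} \<subseteq> {i \<in> set (take (2 * k) ps). w i = z}"
          proof
            fix r assume "r \<in> {i \<in> {?p..<?p + n}. w i = z}"
            then have r: "?p \<le> r" "r < ?p + n" "w r = z" by auto
            then obtain h where h: "h < 2 * k" "r = ps ! h" using win_index[of r] z by auto
            then have "r = take (2 * k) ps ! h" "h < length (take (2 * k) ps)" using pn(2) by auto
            then show "r \<in> {i \<in> set (take (2 * k) ps). w i = z}" using r(3) nth_mem by blast
          qed
        qed
        ultimately show ?thesis
          using count_list_word_on[of "set (take (2 * k) ps)" w z]
            count_list_word_on[of "{?p..<?p + n}" w z] word_on_window[of w ?p n] by simp
      qed
      note count = this
      have ex: "\<exists>z\<in>range w. m z y \<noteq> 2 \<and> z \<noteq> x \<and> z \<noteq> y"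
        using not_dihedral by blast
      have "m x y = enat (2 * k + 1)" using mxy l2k by simp
      from nlb[OF mem xy k2 this nbx ex ab count] show False .
    qed
    then have k1: "k = 1" using k(2) by simp
    have ox: "once x"
    proof (rule onceI)
      fix j assume j: "?p \<le> j" "j < ?p + n" "w j = x"
      then obtain h where h: "h < 2" "j = ps ! h" "w j = (if even h then x else y)"
        using win_index[of j] k1 by auto
      then have "h = 0" using j(3) xy by (cases "h = 0") (auto split: if_splits elim: oddE)
      then show "j = ?p" using h by simp
    qed
    have oy: "once y"
    proof (rule onceI)
      fix j assume j: "?p \<le> j" "j < ?p + n" "w j = y"
      then obtain h where h: "h < 2" "j = ps ! h" "w j = (if even h then x else y)"
        using win_index[of j] k1 by auto
      then have "h = 1" using j(3) xy by (cases "h = 0") auto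
      then show "j = ps ! 1" using h by simp
    qed
    show ?thesis using l2k k1 ox oy nbx C by auto
  qed
  have H: "\<exists>x\<in>D. \<not> once x"
    if "D \<subseteq> C" "D \<noteq> {}" "\<forall>x\<in>D. \<forall>y\<in>C. m y x \<noteq> 2 \<longrightarrow> y \<in> D" for D
  proof -
    have "D = C" using closed_eq[of D] that by blast
    then show ?thesis using rep by blast
  qed
  have "\<forall>z\<in>C. \<exists>i. w i = z" using C by auto
  moreover have "\<forall>D. D \<subseteq> C \<longrightarrow> D \<noteq> {} \<longrightarrow> (\<forall>x\<in>D. \<forall>y\<in>C. m y x \<noteq> 2 \<longrightarrow> y \<in> D) \<longrightarrow> (\<exists>x\<in>D. \<not> once x)"
    using H by simp
  moreover have "\<forall>x y ps. local_chain m w (positions C) x y ps \<longrightarrow> x \<noteq> y \<longrightarrow> 3 \<le> length ps \<longrightarrow>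
      m x y = enat (length ps) \<longrightarrow>
      length ps = 3 \<and> once x \<and> once y \<and> (\<forall>z\<in>C. m z x \<noteq> 2 \<longrightarrow> z = x \<or> z = y)"
    using br by simp
  ultimately show ?thesis unfolding prunable_def using CS sf by simp
qed

end

section \<open>From words to the Coxeter group\<close>

lemma presentation_rel_mono:
  assumes "(u, v) \<in> presentation_rel K R" "K \<subseteq> L" "R \<subseteq> R'"
  shows "(u, v) \<in> presentation_rel L R'"
  using assms(1)
proof (induction rule: presentation_rel.induct)
  case (refl u)
  then show ?case using assms(2) by (auto intro!: presentation_rel.refl)
next
  case (sym u v)
  show ?case by (rule presentation_rel.sym) (rule sym.IH)
next
  case (trans u v w)
  show ?case by (rule presentation_rel.trans[OF trans.IH])
next
  case (cancel u v x b)
  show ?case by (rule presentation_rel.cancel) (use cancel assms(2) in auto)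
next
  case (relator u v r)
  show ?case by (rule presentation_rel.relator) (use relator assms(2,3) in auto)
qed

context coxeter_data begin

section \<open>Positive words and elements of the presented group\<close>

lemma eqw_mono:
  assumes "K \<subseteq> L" "eqw K u v"
  shows "eqw L u v"
proof -
  have "coxeter_relators K m \<subseteq> coxeter_relators L m"
    using assms(1) unfolding coxeter_relators_def by blast
  then show ?thesis using presentation_rel_mono[OF _ assms(1)] assms(2) unfolding eqw_def by simp
qed

definition word_class :: "'a set \<Rightarrow> 'a list \<Rightarrow> ('a \<times> bool) list set" where
  "word_class L u = presentation_rel L (coxeter_relators L m) `` {pos_word u}"

lemma word_class_carrier: "u \<in> lists L \<Longrightarrow> word_class L u \<in> carrier (coxeter_group L m)"
  unfolding word_class_def coxeter_group_def presented_group_def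
  by (simp add: quotientI pos_word_lists[of u L, symmetric])

lemma word_class_eq_iff:
  "u \<in> lists L \<Longrightarrow> v \<in> lists L \<Longrightarrow> word_class L u = word_class L v \<longleftrightarrow> eqw L u v"
  unfolding word_class_def eqw_def
  by (rule eq_equiv_class_iff[OF equiv_presentation_rel]) (simp_all only: pos_word_lists)

lemma word_class_mult:
  "u \<in> lists L \<Longrightarrow> v \<in> lists L \<Longrightarrow>
    word_class L u \<otimes>\<^bsub>coxeter_group L m\<^esub> word_class L v = word_class L (u @ v)"
  unfolding word_class_def coxeter_group_def
  by (subst presented_group_mult) (simp_all only: pos_word_lists map_append)

lemma word_class_one: "word_class L [] = \<one>\<^bsub>coxeter_group L m\<^esub>"
  by (simp add: word_class_def coxeter_group_def presented_group_def)

text \<open>The square of a generator is a relation because \<open>m x x = 1\<close>, so a formal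
  inverse may be replaced by the letter itself.\<close>

lemma unsign:
  assumes "L \<subseteq> S" "q \<in> lists (L \<times> UNIV)"
  shows "(q, pos_word (map fst q)) \<in> presentation_rel L (coxeter_relators L m)"
  using assms(2)
proof (induction q)
  case Nil
  then show ?case by (simp add: presentation_rel.refl)
next
  case (Cons p q)
  obtain x b where p: "p = (x, b)" by force
  have x: "x \<in> L" using Cons p by auto
  let ?R = "presentation_rel L (coxeter_relators L m)"
  have "([(x, b)], [(x, True)]) \<in> ?R"
  proof (cases b)
    case True
    then show ?thesis using x by (auto intro: presentation_rel.refl)
  next
    case False
    have "eqw L [] [x, x]" by (rule eqw_sym[OF eqw_square[OF assms(1) x]])
    then have "([] @ [(x, False)], [(x, True), (x, True)] @ [(x, False)]) \<in> ?R"
      by (intro presentation_rel_append) (use x in \<open>auto simp: eqw_def intro!: presentation_rel.refl\<close>)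
    moreover have "([(x, True)] @ [(x, True), (x, \<not> True)] @ [], [(x, True)] @ []) \<in> ?R"
      by (rule presentation_rel.cancel) (use x in auto)
    ultimately show ?thesis
      using False presentation_rel.trans[of "[(x, False)]" "[(x, True), (x, True), (x, False)]"] by simp
  qed
  then have "([(x, b)] @ q, [(x, True)] @ pos_word (map fst q)) \<in> ?R"
    using Cons by (intro presentation_rel_append) auto
  then show ?case by (simp add: p)
qed

lemma carrier_word_class:
  assumes "L \<subseteq> S" "A \<in> carrier (coxeter_group L m)"
  obtains u where "u \<in> lists L" "A = word_class L u"
proof -
  obtain q where q: "q \<in> lists (L \<times> UNIV)" "A = presentation_rel L (coxeter_relators L m) `` {q}"
    using assms(2) by (auto simp: coxeter_group_def presented_group_def elim!: quotientE)
  have "A = word_class L (map fst q)"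
    unfolding word_class_def q(2) using unsign[OF assms(1) q(1)]
    by (rule equiv_class_eq[OF equiv_presentation_rel])
  moreover have "map fst q \<in> lists L" using q(1) by (auto simp: in_lists_conv_set)
  ultimately show ?thesis using that by blast
qed

text \<open>Over a finite alphabet only finitely many classes have a representative of bounded
  length.\<close>

lemma infinite_imp_unbounded:
  assumes C: "C \<subseteq> S" and inf: "infinite (carrier (coxeter_group C m))"
  shows "unbounded C"
proof (rule ccontr)
  assume "\<not> unbounded C"
  then obtain M where M: "\<And>v. minw C v \<Longrightarrow> length v < M"
    unfolding unbounded_def by (auto simp: not_le)
  have fin: "finite {u. set u \<subseteq> C \<and> length u \<le> M}"
    using finite_lists_length_le finite_subset[OF C finite_S] by blast
  have "carrier (coxeter_group C m) \<subseteq> word_class C ` {u. set u \<subseteq> C \<and> length u \<le> M}"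
  proof
    fix A assume "A \<in> carrier (coxeter_group C m)"
    then obtain u where u: "u \<in> lists C" "A = word_class C u" using carrier_word_class[OF C] by blast
    obtain v where v: "eqw C v u" "minw C v" using ex_minw[OF u(1)] .
    then have "A = word_class C v" "v \<in> lists C"
      using u word_class_eq_iff[of u C v] eqw_sym minw_lists by auto
    then show "A \<in> word_class C ` {u. set u \<subseteq> C \<and> length u \<le> M}"
      using M[OF v(2)] by (intro image_eqI[of _ _ v]) auto
  qed
  then show False using inf finite_subset[OF _ finite_imageI[OF fin]] by blast
qed

text \<open>The exponent is the order of the group, by Lagrange.\<close>

lemma finite_order_word:
  assumes C: "C \<subseteq> S" and fin: "finite (carrier (coxeter_group C m))" and u: "u \<in> lists C"
  obtains k where "1 \<le> k" "eqw C (concat (replicate k u)) []"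
proof -
  let ?G = "coxeter_group C m"
  interpret G: group ?G unfolding coxeter_group_def by (rule presented_group_is_group)
  have uG: "word_class C u \<in> carrier ?G" using u by (rule word_class_carrier)
  have lists: "concat (replicate j u) \<in> lists C" for j using u by (induction j) auto
  have pow: "word_class C u [^]\<^bsub>?G\<^esub> j = word_class C (concat (replicate j u))" for j :: nat
  proof (induction j)
    case (Suc j)
    have "concat (replicate j u) @ u = u @ concat (replicate j u)" by (induction j) auto
    then show ?case using Suc word_class_mult[OF lists[of j] u] by simp
  qed (simp add: word_class_one)
  have "word_class C u [^]\<^bsub>?G\<^esub> order ?G = \<one>\<^bsub>?G\<^esub>" by (rule G.pow_order_eq_1[OF uG])
  then have "word_class C (concat (replicate (order ?G) u)) = word_class C []"
    by (simp only: pow word_class_one)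
  then have "eqw C (concat (replicate (order ?G) u)) []" using word_class_eq_iff[OF lists] by simp
  moreover have "1 \<le> order ?G" using fin G.order_gt_0_iff_finite by simp
  ultimately show ?thesis using that by blast
qed

end

sublocale coxeter_system \<subseteq> coxeter_data S m
  by unfold_locales (rule finite_rank, rule matrix)

context coxeter_system begin

section \<open>Length and reduced expressions in the Coxeter group\<close>

lemma word_prod_morphism:
  "\<exists>\<phi>. inj_on \<phi> (carrier (coxeter_group S m)) \<and>
    \<phi> ` carrier (coxeter_group S m) = carrier W \<and>
    (\<forall>u\<in>lists S. word_prod W u = \<phi> (word_class S u))"
proof -
  let ?G = "coxeter_group S m"
  obtain \<phi> where \<phi>: "\<phi> \<in> iso ?G W" "\<And>s. s \<in> S \<Longrightarrow> \<phi> (coxeter_generator S m s) = s"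
    using presentation by blast
  interpret G: group ?G unfolding coxeter_group_def by (rule presented_group_is_group)
  interpret hom: group_hom ?G W \<phi>
    using \<phi>(1) G.is_group is_group by (simp add: group_hom_def group_hom_axioms_def iso_def)
  have "word_prod W u = \<phi> (word_class S u)" if "u \<in> lists S" for u
    using that
  proof (induction u)
    case Nil
    then show ?case by (simp add: word_prod_def word_class_one)
  next
    case (Cons s u)
    then have s: "s \<in> S" "u \<in> lists S" "[s] \<in> lists S" by auto
    have "\<phi> (word_class S ([s] @ u)) = \<phi> (word_class S [s]) \<otimes> \<phi> (word_class S u)"
      using s by (subst word_class_mult[symmetric]) (auto intro!: hom.hom_mult word_class_carrier)
    moreover have "\<phi> (word_class S [s]) = s"
      using \<phi>(2)[OF s(1)] by (simp add: word_class_def coxeter_generator_def)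
    ultimately show ?case using Cons by (simp add: word_prod_def)
  qed
  moreover have "inj_on \<phi> (carrier ?G)" "\<phi> ` carrier ?G = carrier W"
    using \<phi>(1) by (auto simp: iso_def bij_betw_def)
  ultimately show ?thesis by (intro exI[of _ \<phi>]) simp
qed

lemma word_prod_eq_iff:
  assumes "u \<in> lists S" "v \<in> lists S"
  shows "word_prod W u = word_prod W v \<longleftrightarrow> eqw S u v"
proof -
  obtain \<phi> where \<phi>: "inj_on \<phi> (carrier (coxeter_group S m))"
    "\<phi> ` carrier (coxeter_group S m) = carrier W"
    "\<And>u. u \<in> lists S \<Longrightarrow> word_prod W u = \<phi> (word_class S u)"
    using word_prod_morphism by blast
  show ?thesis
    using inj_on_eq_iff[OF \<phi>(1) word_class_carrier[OF assms(1)] word_class_carrier[OF assms(2)]]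
      \<phi>(3)[OF assms(1)] \<phi>(3)[OF assms(2)] word_class_eq_iff[OF assms] by simp
qed

lemma word_prod_closed: "v \<in> lists S \<Longrightarrow> word_prod W v \<in> carrier W"
  using generators_carrier by (induction v) (auto simp: word_prod_def)

lemma word_prod_append:
  assumes "u \<in> lists S" "v \<in> lists S"
  shows "word_prod W (u @ v) = word_prod W u \<otimes> word_prod W v"
  using assms(1)
proof (induction u)
  case Nil
  then show ?case using word_prod_closed[OF assms(2)] by (simp add: word_prod_def)
next
  case (Cons s u)
  then show ?case
    using word_prod_closed[OF assms(2)] word_prod_closed[of u] generators_carrier
    by (auto simp: word_prod_def m_assoc)
qed

lemma word_prod_power:
  assumes "u \<in> lists S"
  shows "word_prod W (concat (replicate k u)) = word_prod W u [^] k"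
proof (induction k)
  case (Suc k)
  have "concat (replicate k u) @ u = u @ concat (replicate k u)" by (induction k) auto
  moreover have "concat (replicate k u) \<in> lists S" using assms by (induction k) auto
  ultimately show ?case using Suc word_prod_append[OF _ assms, of "concat (replicate k u)"] by simp
qed (simp add: word_prod_def)

lemma ex_expression:
  assumes "g \<in> carrier W"
  obtains u where "minw S u" "word_prod W u = g"
proof -
  obtain \<phi> where "inj_on \<phi> (carrier (coxeter_group S m))" and \<phi>: "\<phi> ` carrier (coxeter_group S m) = carrier W"
    "\<And>u. u \<in> lists S \<Longrightarrow> word_prod W u = \<phi> (word_class S u)"
    using word_prod_morphism by blast
  obtain A where "A \<in> carrier (coxeter_group S m)" "g = \<phi> A" using assms \<phi>(1) by blast
  moreover from this obtain v where v: "v \<in> lists S" "A = word_class S v"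
    using carrier_word_class[OF subset_refl, of A] by blast
  ultimately have vg: "word_prod W v = g" using \<phi>(2) by simp
  obtain u where u: "eqw S u v" "minw S u" using ex_minw[OF v(1)] .
  then have "word_prod W u = g" using word_prod_eq_iff[OF minw_lists[OF u(2)] v(1)] vg by simp
  then show ?thesis using that u(2) by blast
qed

lemma cox_length_minw:
  assumes "minw S u"
  shows "cox_length W S (word_prod W u) = length u"
  unfolding cox_length_def
proof (rule Least_equality)
  have l: "u \<in> lists S" using minw_lists[OF assms] .
  then show "\<exists>v\<in>expressions W S (word_prod W u). length v = length u"
    by (auto simp: expressions_def)
  fix k assume "\<exists>v\<in>expressions W S (word_prod W u). length v = k"
  then obtain v where v: "v \<in> lists S" "word_prod W v = word_prod W u" "length v = k"
    by (auto simp: expressions_def)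
  then have "eqw S v u" using word_prod_eq_iff[OF v(1) l] by simp
  then show "length u \<le> k" using assms v(3) by (auto simp: minw_def)
qed

lemma cox_length_le:
  assumes "u \<in> lists S"
  shows "cox_length W S (word_prod W u) \<le> length u"
  unfolding cox_length_def
  by (rule Least_le) (use assms in \<open>auto simp: expressions_def\<close>)

lemma reduced_expressions_iff: "u \<in> reduced_expressions W S g \<longleftrightarrow> minw S u \<and> word_prod W u = g"
proof
  assume u: "u \<in> reduced_expressions W S g"
  then have l: "u \<in> lists S" "word_prod W u = g" "length u = cox_length W S g"
    by (auto simp: reduced_expressions_def expressions_def)
  obtain v where v: "eqw S v u" "minw S v" using ex_minw[OF l(1)] .
  have "word_prod W v = g" using word_prod_eq_iff[OF minw_lists[OF v(2)] l(1)] v(1) l(2) by simp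
  then have "length u = length v" using cox_length_minw[OF v(2)] l(3) by simp
  then show "minw S u \<and> word_prod W u = g" using minw_eqw[OF v(2) eqw_sym[OF v(1)]] l(2) by simp
next
  assume "minw S u \<and> word_prod W u = g"
  then show "u \<in> reduced_expressions W S g"
    using cox_length_minw[of u] minw_lists[of S u]
    by (auto simp: reduced_expressions_def expressions_def)
qed

lemma reduced_word_iff: "reduced_word W S u \<longleftrightarrow> minw S u"
  by (simp add: reduced_word_def reduced_expressions_iff)

text \<open>Applying the braid gives another reduced expression, hence a commutation equivalent one.
  The sequence of letters \<open>x\<close> and \<open>y\<close> is invariant under commutations, yet
  the two alternating words start differently.\<close>

lemma fully_commutative_no_braid:
  assumes fc: "fully_commutative W S m (word_prod W v)" and v: "minw S v"
    and ce: "ceq m v (a @ alternating x y l @ b)"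
    and xy: "x \<in> S" "y \<in> S" "x \<noteq> y" and l: "3 \<le> l" "m x y = enat l"
  shows False
proof -
  let ?v = "a @ alternating x y l @ b" and ?v' = "a @ alternating y x l @ b"
  have vl: "v \<in> lists S" using minw_lists[OF v] .
  have e1: "eqw S v ?v" using eqw_ceq[OF subset_refl ce vl] .
  then have "?v \<in> lists S" using eqw_lists[OF e1] by simp
  then have e2: "eqw S ?v ?v'"
    using xy l by (intro eqw_context eqw_braid) auto
  have e3: "eqw S v ?v'" using e1 e2 by (rule eqw_trans)
  then have v': "?v' \<in> lists S" using eqw_lists[OF e3] by simp
  have "length ?v' = length v" using mset_eq_length[OF ceq_mset[OF ce]] by simp
  then have "minw S ?v'" using minw_eqw[OF v eqw_sym[OF e3]] by simp
  moreover have "word_prod W ?v' = word_prod W v" using word_prod_eq_iff[OF vl v'] e3 by simp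
  ultimately have "?v' \<in> reduced_expressions W S (word_prod W v)"
    "v \<in> reduced_expressions W S (word_prod W v)"
    using v by (simp_all add: reduced_expressions_iff)
  then have ce': "ceq m v ?v'" using fc by (simp add: fully_commutative_def)
  let ?P = "\<lambda>s. s = x \<or> s = y"
  have P: "m s t \<noteq> 2" if "?P s" "?P t" for s t
    using that l m_sym[OF xy(1,2)] m_eq_1_iff[of x x] m_eq_1_iff[of y y] xy
    by (auto simp: numeral_eq_enat one_enat_def)
  have id: "filter ?P (alternating s t l) = alternating s t l" if "{s, t} = {x, y}" for s t
    using set_alternating[of s t l] that by (auto simp: filter_id_conv)
  have "filter ?P ?v = filter ?P ?v'"
    using ceq_filter[OF ce P] ceq_filter[OF ce' P] by simp
  then have "alternating x y l = alternating y x l" using id[of x y] id[of y x] by auto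
  then have "alternating x y l ! 0 = alternating y x l ! 0" by simp
  then show False using l(1) xy(3) by (simp add: nth_alternating)
qed

end

section \<open>Splitting words and reading powers periodically\<close>

lemma ceq_move_right:
  "(\<And>a. a \<in> set v \<Longrightarrow> m c a = 2) \<Longrightarrow> ceq m (c # v) (v @ [c])"
proof (induction v)
  case (Cons a v)
  have "ceq m ([] @ c # a # v) ([] @ a # c # v)"
    using Cons.prems by (intro ceq_swap) auto
  moreover have "ceq m ([a] @ c # v) ([a] @ v @ [c])"
    using Cons by (intro ceq_append1) auto
  ultimately show ?case using ceq_trans by fastforce
qed simp

lemma ceq_partition:
  assumes "\<And>c d. c \<in> set v \<Longrightarrow> d \<in> set v \<Longrightarrow> P c \<Longrightarrow> \<not> P d \<Longrightarrow> m d c = 2"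
  shows "ceq m v (filter P v @ filter (\<lambda>d. \<not> P d) v)"
  using assms
proof (induction v)
  case (Cons d v)
  let ?F = "filter P v" and ?G = "filter (\<lambda>d. \<not> P d) v"
  have "ceq m v (?F @ ?G)" using Cons by simp
  then have 1: "ceq m (d # v) (d # ?F @ ?G)"
    using ceq_append1[of m v "?F @ ?G" "[d]"] by simp
  show ?case
  proof (cases "P d")
    case False
    have "ceq m (d # ?F) (?F @ [d])"
      using Cons.prems False by (intro ceq_move_right) auto
    then have "ceq m (d # ?F @ ?G) (?F @ d # ?G)"
      using ceq_append2[of m "d # ?F" "?F @ [d]" ?G] by simp
    then show ?thesis using ceq_trans[OF 1] False by simp
  qed (use 1 in simp)
qed simp

lemma filter_concat_replicate: "filter P (concat (replicate k u)) = concat (replicate k (filter P u))"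
  by (induction k) auto

lemma map_upt_concat_replicate:
  fixes u :: "'a list"
  assumes "u \<noteq> []"
  shows "map (\<lambda>i. u ! (i mod length u)) [0..<k * length u] = concat (replicate k u)"
proof (induction k)
  case (Suc k)
  let ?n = "length u"
  have "[0..<Suc k * ?n] = [0..<?n] @ map (\<lambda>i. i + ?n) [0..<k * ?n]"
    by (simp add: map_add_upt upt_add_eq_append[symmetric] add.commute flip: upt_add_eq_append[of 0])
  moreover have "map (\<lambda>i. u ! (i mod ?n)) [0..<?n] = u"
    by (rule nth_equalityI) auto
  ultimately show ?case using Suc by (simp add: comp_def)
qed simp

lemma map_upt_rotate:
  assumes "u \<noteq> []"
  shows "map (\<lambda>i. u ! (i mod length u)) [p..<p + length u] = rotate p u"
  by (rule nth_equalityI) (auto simp: nth_rotate)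

context coxeter_data begin

lemma component_properties:
  assumes U: "U \<subseteq> S" and e: "e \<in> U" and C: "C = (cox_edges U m)\<^sup>* `` {e}"
  shows "C \<subseteq> U" "e \<in> C" "cox_connected C" "\<And>c d. c \<in> C \<Longrightarrow> d \<in> U \<Longrightarrow> d \<notin> C \<Longrightarrow> m d c = 2"
proof -
  let ?E = "cox_edges U m"
  show CU: "C \<subseteq> U"
  proof
    fix c assume "c \<in> C"
    then have "(e, c) \<in> ?E\<^sup>*" by (simp add: C)
    then show "c \<in> U" by (induction rule: rtrancl_induct) (auto simp: e cox_edges_def)
  qed
  show "e \<in> C" by (simp add: C)
  have step: "d \<in> C" if "c \<in> C" "(c, d) \<in> ?E" for c d
    using that by (auto simp: C intro: rtrancl_into_rtrancl)
  show "m d c = 2" if cd: "c \<in> C" "d \<in> U" "d \<notin> C" for c d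
  proof (rule ccontr)
    assume ne: "m d c \<noteq> 2"
    have S: "c \<in> S" "d \<in> S" "c \<noteq> d" "c \<in> U" using cd CU U by auto
    then have "3 \<le> m c d" using ne m_sym[of c d] m_neq_2_iff[of c d] by simp
    then have "(c, d) \<in> ?E" using S cd by (simp add: cox_edges_def)
    then show False using step cd by blast
  qed
  have "sym ?E" using m_sym U by (auto simp: sym_def cox_edges_def subset_iff)
  then have symE: "sym (?E\<^sup>*)" by (rule sym_rtrancl)
  show "cox_connected C"
    unfolding cox_connected_def
  proof (intro allI impI)
    fix T assume T: "T \<subseteq> C" "T \<noteq> {}" "\<forall>x\<in>T. \<forall>y\<in>C. m x y \<noteq> 2 \<longrightarrow> y \<in> T"
    obtain t where t: "t \<in> T" using T(2) by blast
    have "C \<subseteq> T"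
    proof
      fix y assume "y \<in> C"
      then have "(e, y) \<in> ?E\<^sup>*" by (simp add: C)
      moreover have "(e, t) \<in> ?E\<^sup>*" using t T(1) by (auto simp: C)
      then have "(t, e) \<in> ?E\<^sup>*" using symE by (simp add: sym_def)
      ultimately have "(t, y) \<in> ?E\<^sup>*" by (rule rtrancl_trans[rotated])
      then show "y \<in> T"
      proof (induction rule: rtrancl_induct)
        case (step a b)
        then have "a \<in> C" "3 \<le> m a b" using T(1) by (auto simp: cox_edges_def)
        moreover have "b \<in> C" using \<open>\<And>c d. c \<in> C \<Longrightarrow> (c, d) \<in> ?E \<Longrightarrow> d \<in> C\<close>[OF \<open>a \<in> C\<close> step.hyps(2)] .
        moreover have "m a b \<noteq> 2" using \<open>3 \<le> m a b\<close> by auto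
        ultimately show ?case using T(3) step.IH by blast
      qed (rule t)
    qed
    then show "T = C" using T(1) by blast
  qed
qed

end

context coxeter_system begin

section \<open>The two implications\<close>

lemma cox_supp_eq:
  assumes fc: "fully_commutative W S m g" and u: "minw S u" "word_prod W u = g"
  shows "cox_supp W S g = set u"
proof -
  have ur: "u \<in> reduced_expressions W S g" using u by (simp add: reduced_expressions_iff)
  have "set v = set u" if "v \<in> reduced_expressions W S g" for v
  proof -
    have "ceq m v u" using fc that ur by (simp add: fully_commutative_def)
    then have "mset v = mset u" by (rule ceq_mset)
    then show ?thesis by (rule mset_eq_setD)
  qed
  then show ?thesis unfolding cox_supp_def using ur by blast
qed

lemma torsion_free_iff:
  assumes "cox_supp W S g = U"
  shows "torsion_free W S m g \<longleftrightarrow>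
    (\<forall>e\<in>U. infinite (carrier (coxeter_group ((cox_edges U m)\<^sup>* `` {e}) m)))"
  by (auto simp: torsion_free_def cox_components_def quotient_def assms)

text \<open>Let \<open>k\<close> kill the part of \<open>u\<close> in a finite component
  \<open>C\<close>. In the \<open>k\<close>-fold repetition of \<open>u\<close> the letters of
  \<open>C\<close> commute to the front and disappear, leaving at most \<open>k\<close> times the
  number of letters outside \<open>C\<close>.\<close>

lemma logarithmic_imp_torsion_free:
  assumes fc: "fully_commutative W S m g" and u: "minw S u" "word_prod W u = g"
    and log: "logarithmic W S g"
  shows "torsion_free W S m g"
  unfolding torsion_free_iff[OF cox_supp_eq[OF fc u]]
proof (intro ballI notI)
  fix e assume e: "e \<in> set u"
  define C where "C = (cox_edges (set u) m)\<^sup>* `` {e}"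
  assume "finite (carrier (coxeter_group ((cox_edges (set u) m)\<^sup>* `` {e}) m))"
  then have fin: "finite (carrier (coxeter_group C m))" by (simp only: C_def)
  have ul: "u \<in> lists S" using minw_lists[OF u(1)] .
  then have uS: "set u \<subseteq> S" by auto
  note props = component_properties[OF uS e C_def]
  have CS: "C \<subseteq> S" using props(1) uS by blast
  let ?c = "filter (\<lambda>d. d \<in> C) u" and ?r = "filter (\<lambda>d. d \<notin> C) u"
  have "?c \<in> lists C" by (auto simp: in_lists_conv_set)
  then obtain k where k: "1 \<le> k" "eqw C (concat (replicate k ?c)) []"
    using finite_order_word[OF CS fin] by blast
  let ?v = "concat (replicate k u)" and ?R = "concat (replicate k ?r)"
  have vS: "set ?v \<subseteq> set u" by auto
  have vl: "?v \<in> lists S" using vS uS by (auto simp: in_lists_conv_set)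
  have Rl: "?R \<in> lists S" using uS by (auto simp: in_lists_conv_set)
  have "ceq m ?v (filter (\<lambda>d. d \<in> C) ?v @ filter (\<lambda>d. d \<notin> C) ?v)"
    by (rule ceq_partition) (use vS props(4) in auto)
  then have "eqw S ?v (concat (replicate k ?c) @ ?R)"
    using eqw_ceq[OF subset_refl _ vl] by (simp only: filter_concat_replicate)
  also have "eqw S (concat (replicate k ?c) @ ?R) ([] @ ?R)"
    by (rule eqw_append[OF eqw_mono[OF CS k(2)] eqw_refl[OF Rl]])
  finally have "word_prod W ?v = word_prod W ?R" using word_prod_eq_iff[OF vl Rl] by simp
  then have "word_prod W ?R = g [^] k" using word_prod_power[OF ul] u(2) by simp
  then have "cox_length W S (g [^] k) \<le> length ?R" using cox_length_le[OF Rl] by simp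
  moreover have "cox_length W S (g [^] k) = k * length u"
    using log k(1) cox_length_minw[OF u(1)] u(2) by (simp add: logarithmic_def)
  moreover have "length ?R = k * length ?r" by (simp add: length_concat sum_list_replicate)
  moreover have "length ?r < length u"
    using e props(2) by (intro length_filter_less) auto
  ultimately show False using k(1) by simp
qed

lemma CFC_D:
  assumes "g \<in> CFC W S m" "minw S u" "word_prod W u = g"
  shows "minw S (rotate p u)" "fully_commutative W S m (word_prod W (rotate p u))"
proof -
  have "u \<in> reduced_expressions W S g" using assms(2,3) by (simp add: reduced_expressions_iff)
  moreover have "cyclic_shift u (rotate p u)" by (auto simp: cyclic_shift_def)
  ultimately have "reduced_word W S (rotate p u) \<and> fully_commutative W S m (word_prod W (rotate p u))"
    using assms(1) by (simp add: CFC_def)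
  then show "minw S (rotate p u)" "fully_commutative W S m (word_prod W (rotate p u))"
    by (simp_all add: reduced_word_iff)
qed

text \<open>The only neighbour of \<open>x\<close> is \<open>y\<close>, along an odd label, while a
  second neighbour keeps \<open>y\<close> from being an endpoint. The counts pass from the rotation
  to \<open>u\<close> because rotating permutes letters.\<close>

lemma large_bandI:
  assumes supp: "cox_supp W S g = set u" and u: "minw S u" "word_prod W u = g"
    and red: "minw S (rotate p u)"
    and xy: "x \<in> set u" "y \<in> set u" "x \<noteq> y" and k: "2 \<le> k" "m x y = enat (2 * k + 1)"
    and nbx: "\<And>z. z \<in> set u \<Longrightarrow> m z x \<noteq> 2 \<Longrightarrow> z = x \<or> z = y"
    and nby: "\<exists>z\<in>set u. m z y \<noteq> 2 \<and> z \<noteq> x \<and> z \<noteq> y"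
    and ce: "ceq m (rotate p u) (a @ alternating x y (2 * k) @ b)"
    and count: "\<And>z. z \<in> {x, y} \<Longrightarrow> count_list (rotate p u) z = count_list (alternating x y (2 * k)) z"
  shows "has_large_band W S m g x y"
proof -
  let ?U = "set u"
  have US: "?U \<subseteq> S" using minw_lists[OF u(1)] by auto
  then have xyS: "x \<in> S" "y \<in> S" using xy by auto
  have myx: "m y x = enat (2 * k + 1)" using k(2) m_sym[OF xyS] by simp
  have ge3: "3 \<le> m x y" "3 \<le> m y x" using k myx by (auto simp: numeral_eq_enat)
  have nx: "cox_neighbours ?U m x = {y}"
  proof
    show "cox_neighbours ?U m x \<subseteq> {y}"
    proof
      fix z assume "z \<in> cox_neighbours ?U m x"
      then have z: "z \<in> ?U" "3 \<le> m x z" by (auto simp: cox_neighbours_def cox_edges_def)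
      then have zS: "z \<in> S" using US by auto
      have zx: "z \<noteq> x" using z(2) m_eq_1_iff[of x x] xyS by auto
      then have "m z x \<noteq> 2" using z(2) m_neq_2_iff[of x z] m_sym[of x z] xyS zS by auto
      then show "z \<in> {y}" using nbx[OF z(1)] zx by simp
    qed
    show "{y} \<subseteq> cox_neighbours ?U m x"
      using xy ge3 by (auto simp: cox_neighbours_def cox_edges_def)
  qed
  have ox: "odd_endpoint ?U m x"
    using nx xy(1) k(2) by (auto simp: odd_endpoint_def endpoint_def endpoint_weight_def)
  obtain z where z: "z \<in> ?U" "m z y \<noteq> 2" "z \<noteq> x" "z \<noteq> y" using nby by blast
  then have zS: "z \<in> S" using US by auto
  have "3 \<le> m y z" using z m_neq_2_iff[of y z] m_sym[of y z] xyS zS by auto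
  then have "z \<in> cox_neighbours ?U m y" using xy z by (simp add: cox_neighbours_def cox_edges_def)
  moreover have "x \<in> cox_neighbours ?U m y" using xy ge3 by (simp add: cox_neighbours_def cox_edges_def)
  ultimately have "card (cox_neighbours ?U m y) \<noteq> 1"
    using z(3) by (auto simp: card_1_singleton_iff)
  then have oy: "\<not> odd_endpoint ?U m y" by (simp add: odd_endpoint_def endpoint_def)
  let ?v = "a @ alternating x y (2 * k) @ b"
  have "eqw S (rotate p u) ?v"
    using eqw_ceq[OF subset_refl ce minw_lists[OF red]] .
  moreover have "length ?v = length (rotate p u)"
    using mset_eq_length[OF ceq_mset[OF ce]] by simp
  ultimately have "minw S ?v" using minw_eqw[OF red eqw_sym] by simp
  then have redv: "reduced_word W S ?v" by (simp add: reduced_word_iff)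
  have ur: "u \<in> reduced_expressions W S g" using u by (simp add: reduced_expressions_iff)
  have cnt: "count_list u z = count_list (alternating x y (2 * k)) z" if "z \<in> {x, y}" for z
  proof -
    have "mset (rotate1 v) = mset v" for v :: "'a list" by (cases v) auto
    then have "mset (rotate p u) = mset u" by (induction p) auto
    then have "count_list (rotate p u) z = count_list u z" by (simp flip: count_mset)
    then show ?thesis using count[OF that] by simp
  qed
  have cs: "cyclic_shift u (rotate p u)" by (auto simp: cyclic_shift_def)
  have k1: "2 * k + 1 - 1 = 2 * k" by simp
  have "\<exists>v a b. cyclic_shift u v \<and>
      ceq m v (a @ alternating x y (2 * k) @ b) \<and>
      reduced_word W S (a @ alternating x y (2 * k) @ b)"
    using cs ce redv by blast
  note ex = this
  \<comment> \<open>\<open>Q\<close> is the existential body of \<open>has_band\<close>; with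
    \<open>2 * k + 1\<close> for \<open>j\<close>, every \<open>j - 1\<close> becomes
    \<open>2 * k\<close>.\<close>
  define Q where "Q j v \<longleftrightarrow> m x y = enat j \<and> v \<in> reduced_expressions W S g \<and>
      (\<exists>v' a b. cyclic_shift v v' \<and>
        ceq m v' (a @ alternating x y (j - 1) @ b) \<and>
        reduced_word W S (a @ alternating x y (j - 1) @ b)) \<and>
      (\<forall>z \<in> {x, y}. count_list v z = count_list (alternating x y (j - 1)) z)" for j v
  have "Q (2 * k + 1) u"
    unfolding Q_def k1
  proof (intro conjI)
    show "\<forall>z\<in>{x, y}. count_list u z = count_list (alternating x y (2 * k)) z" using cnt by simp
  qed (rule k(2) ur ex)+
  then have "\<exists>j v. Q j v" by (intro exI)
  then have "has_band W S m g x y"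
    unfolding has_band_def supp using xy ox oy by (simp only: Q_def) simp
  moreover have "m x y \<noteq> 3" using k by (auto simp: numeral_eq_enat)
  ultimately show ?thesis by (simp add: has_large_band_def)
qed

lemma powers_redw:
  assumes g: "g \<in> CFC W S m" and u: "minw S u" "word_prod W u = g" and ne: "u \<noteq> []"
    and supp: "cox_supp W S g = set u"
    and nlb: "no_large_bands W S m g" and tf: "torsion_free W S m g"
  shows "redw (concat (replicate k u))"
proof -
  define n where "n = length u"
  define w where "w i = u ! (i mod n)" for i
  have uS: "set u \<subseteq> S" using minw_lists[OF u(1)] by auto
  have n: "0 < n" using ne by (simp add: n_def)
  have wu: "w i \<in> set u" for i using n by (simp add: w_def n_def)
  interpret P: periodic_word S m w n
    by unfold_locales (use n wu uS in \<open>auto simp: w_def\<close>)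
  have window: "map w [p..<p + n] = rotate p u" for p
    unfolding n_def w_def using ne by (rule map_upt_rotate)
  have powers: "map w [0..<k * n] = concat (replicate k u)"
    unfolding n_def w_def using ne by (rule map_upt_concat_replicate)
  have u0: "map w [0..<n] = u" using window[of 0] by simp
  have "set u \<subseteq> range w" unfolding u0[symmetric] by auto
  then have range: "range w = set u" using wu by auto
  have red: "minw S (map w [i..<i + n])" for i unfolding window by (rule CFC_D(1)[OF g u])
  have fc: False if "ceq m (map w [i..<i + n]) (a @ alternating x y l @ b)"
    "x \<in> S" "y \<in> S" "x \<noteq> y" "3 \<le> l" "m x y = enat l" for i a b x y l
    using fully_commutative_no_braid[OF CFC_D(2)[OF g u] CFC_D(1)[OF g u] _ that(2-)] that(1)
    by (simp only: window)
  have comp: "redw (filter (\<lambda>d. d \<in> C) (map w [0..<k * n]))"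
    if e: "e \<in> set u" and C: "C = (cox_edges (set u) m)\<^sup>* `` {e}" for e C
  proof -
    note props = component_properties[OF uS e C]
    have CS: "C \<subseteq> S" using props(1) uS by blast
    have unb: "unbounded C"
      using tf e infinite_imp_unbounded[OF CS] unfolding torsion_free_iff[OF supp] C by blast
    show ?thesis
    proof (cases "distinct (filter (\<lambda>d. d \<in> C) u)")
      case True
      let ?c = "filter (\<lambda>d. d \<in> C) u"
      have cC: "set ?c = C" using props(1) by auto
      have "e \<in> set ?c" unfolding cC by (rule props(2))
      then have cne: "?c \<noteq> []" using length_pos_if_in_set by fastforce
      \<comment> \<open>Only the letters of \<open>C\<close> are kept here, and the period shrinks
        to the length of \<open>?c\<close>. The other case keeps the labelling by all of
        \<open>u\<close>, because cyclic shifts and bands refer to the whole word.\<close>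
      let ?w = "\<lambda>i. ?c ! (i mod length ?c)"
      have "redw (map ?w [0..<k * length ?c])"
      proof (rule coxeter_powers_redw[OF CS props(3) unb])
        fix i
        show "distinct (map ?w [i..<i + length ?c])" "set (map ?w [i..<i + length ?c]) = C"
          unfolding map_upt_rotate[OF cne] using True cC by simp_all
      qed simp
      then show ?thesis
        unfolding powers filter_concat_replicate map_upt_concat_replicate[OF cne] .
    next
      case False
      have "\<exists>x\<in>C. \<not> P.once x"
      proof (rule ccontr)
        assume once: "\<not> ?thesis"
        have "inj_on w {i. i < n \<and> w i \<in> C}"
        proof (rule linorder_inj_onI')
          fix i j assume ij: "i \<in> {i. i < n \<and> w i \<in> C}" "j \<in> {i. i < n \<and> w i \<in> C}" "i < j"
          show "w i \<noteq> w j"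
          proof
            assume eq: "w i = w j"
            have "P.once (w i)" using once ij by blast
            then have "i + n \<le> j" using eq ij(3) unfolding P.once_def by simp
            then show False using ij by simp
          qed
        qed
        then have "distinct (map w (filter (\<lambda>i. w i \<in> C) [0..<n]))"
          by (simp add: distinct_map inj_on_def)
        then have "distinct (filter (\<lambda>d. d \<in> C) (map w [0..<n]))"
          by (simp add: filter_map comp_def)
        then show False using False by (simp add: u0)
      qed
      then obtain x0 where x0: "x0 \<in> C" "\<not> P.once x0" by blast
      have "P.prunable C"
      proof (rule P.prunable_component[OF _ props(3) unb _ x0 red])
        show "C \<subseteq> range w" using props(1) range by simp
        show "m d c = 2" if "c \<in> C" "d \<in> range w" "d \<notin> C" for c d
          using props(4) that range by simp
        show False if "ceq m (map w [i..<i + n]) (a @ alternating x y l @ b)"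
          "x \<in> S" "y \<in> S" "x \<noteq> y" "3 \<le> l" "m x y = enat l" for i a b x y l
          using fc that by blast
        fix x y k p a b
        assume xy: "x \<in> C" "y \<in> C" "x \<noteq> y" and k: "2 \<le> k" "m x y = enat (2 * k + 1)"
          and nbx: "\<And>z. z \<in> range w \<Longrightarrow> m z x \<noteq> 2 \<Longrightarrow> z = x \<or> z = y"
          and nby: "\<exists>z\<in>range w. m z y \<noteq> 2 \<and> z \<noteq> x \<and> z \<noteq> y"
          and ce: "ceq m (map w [p..<p + n]) (a @ alternating x y (2 * k) @ b)"
          and count: "\<And>z. z \<in> {x, y} \<Longrightarrow>
            count_list (map w [p..<p + n]) z = count_list (alternating x y (2 * k)) z"
        have "has_large_band W S m g x y"
          by (rule large_bandI[OF supp u CFC_D(1)[OF g u, of p] _ _ xy(3) k _ _ ce[unfolded window]])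
            (use xy props(1) nbx nby count in \<open>auto simp: range window\<close>)
        then show False using nlb by (simp add: no_large_bands_def)
      qed
      then show ?thesis by (rule P.prunable_redw)
    qed
  qed
  have "redw (map w [0..<k * n])"
  proof (rule redw_components)
    fix e assume "e \<in> set (map w [0..<k * n])"
    then have e: "e \<in> set u" using wu by auto
    define C where "C = (cox_edges (set u) m)\<^sup>* `` {e}"
    note props = component_properties[OF uS e C_def]
    have "\<forall>d\<in>set (map w [0..<k * n]) - C. \<forall>b\<in>C. m d b = 2"
      using props(4) wu by auto
    then show "\<exists>C. e \<in> C \<and> redw (filter (\<lambda>d. d \<in> C) (map w [0..<k * n])) \<and>
        (\<forall>d\<in>set (map w [0..<k * n]) - C. \<forall>b\<in>C. m d b = 2)"
      using props(2) comp[OF e C_def] by blast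
  qed
  then show ?thesis by (simp only: powers)
qed

lemma logarithmic_iff_torsion_free:
  assumes g: "g \<in> CFC W S m" and nlb: "no_large_bands W S m g"
  shows "logarithmic W S g \<longleftrightarrow> torsion_free W S m g"
proof -
  have "g \<in> carrier W" using g by (simp add: CFC_def)
  then obtain u where u: "minw S u" "word_prod W u = g" by (rule ex_expression)
  \<comment> \<open>The rotation by 0 gives full commutativity of \<open>g\<close> itself.\<close>
  have fc: "fully_commutative W S m g" using CFC_D(2)[OF g u, of 0] u(2) by simp
  have supp: "cox_supp W S g = set u" using cox_supp_eq[OF fc u] .
  have ul: "u \<in> lists S" using minw_lists[OF u(1)] .
  show ?thesis
  proof
    assume "logarithmic W S g"
    then show "torsion_free W S m g" by (rule logarithmic_imp_torsion_free[OF fc u])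
  next
    assume tf: "torsion_free W S m g"
    show "logarithmic W S g"
      unfolding logarithmic_def
    proof (intro allI impI)
      fix k :: nat
      let ?v = "concat (replicate k u)"
      have "redw ?v"
      proof (cases "u = []")
        case True
        then have "?v = []" by (simp add: concat_eq_Nil_conv)
        then show ?thesis by (simp only: redw_def) simp
      next
        case False
        then show ?thesis using powers_redw[OF g u _ supp nlb tf] by blast
      qed
      moreover have "?v \<in> lists S" using ul by (induction k) auto
      ultimately have "minw S ?v" using minw_iff_redw[OF subset_refl] by blast
      then have "cox_length W S (word_prod W ?v) = length ?v" by (rule cox_length_minw)
      moreover have "length ?v = k * length u" by (simp add: length_concat sum_list_replicate)
      moreover have "cox_length W S g = length u" using cox_length_minw[OF u(1)] u(2) by simp
      ultimately show "cox_length W S (g [^] k) = k * cox_length W S g"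
        using word_prod_power[OF ul, of k] u(2) by simp
    qed
  qed
qed

end

theorem theorem7p1:
  fixes W :: "('a, 'b) monoid_scheme" and S :: "'a set" and m :: "'a \<Rightarrow> 'a \<Rightarrow> enat" and w :: 'a
  assumes "coxeter_system W S m"
    and "w \<in> CFC W S m"
    and "no_large_bands W S m w"
  shows "logarithmic W S w \<longleftrightarrow> torsion_free W S m w"
  using assms by (rule coxeter_system.logarithmic_iff_torsion_free)

end
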